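(* Let $\alpha\ge 0$ and let $\Sigma_\sigma=[\sigma,+\infty[$, where $\sigma\ge 0$ if $\alpha>0$ and $\sigma\in\mathbb R$ if $\alpha=0$. Let $Q_\alpha(x)=x^2+2\alpha\log\frac1x$ on $\Sigma_\sigma$ (so $Q_\alpha(0)=+\infty$ when $\alpha>0$), and let $\nu^\sigma_\alpha$ be the equilibrium measure associated to $(\Sigma_\sigma,Q_\alpha)$. Then: (1) If $\sigma=0$ and $\alpha>0$, there is a unique $a_c=a(\alpha)>0$ and a unique $b_c=b(\alpha)$ with $b_c>\sqrt\alpha>a_c>0$ such that the equilibrium measure on $\Sigma_0$ is the measure $\nu^0_\alpha$ with support $[a_c,b_c]$ and density $$f_{\alpha,0}(x)=\frac1\pi\sqrt{(b_c-x)(x-a_c)}\Big(1+\frac{\alpha}{\sqrt{a_cb_c}}\frac1x\Big),$$ where $b_c=\frac23\Big(\sqrt{6(\alpha+1)-2a_c^2}-\frac{a_c}{2}\Big)$. (2) If $\alpha>0$ and $0<\sigma\le a_c$, then $\nu^\sigma_\alpha=\nu^0_\alpha$. (3) If $\alpha>0$ and $\sigma>a_c$, then $\nu^\sigma_\alpha$ is supported by $]\sigma,b]$ and has density $$f_{\alpha,\sigma}(x)=\frac1{2\pi}\sqrt{\frac{b-x}{x-\sigma}}\Big(2x+b-\sigma-2\alpha\sqrt{\frac\sigma b}\frac1x\Big),$$ where $b=b(\alpha,\sigma)$ is the unique solution $b>\sigma$ of $$\sigma+b-\frac{2\alpha}{\sqrt{\sigma b}}\ge 0,\qquad \frac34(b-\sigma)^2+\sigma(b-\sigma)+2\alpha\sqrt{\frac\sigma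 b}-2\alpha-2=0.$$ (4) If $\alpha=0$ and $\sigma\in\mathbb R$: (a) if $\sigma\ge-\sqrt2$, then $\nu^\sigma_0$ has support $]\sigma,b]$ with $b=\frac23\Big(\sqrt{\sigma^2+6}+\frac\sigma2\Big)$ and density $f_{0,\sigma}(x)=\frac1{2\pi}\sqrt{\frac{b-x}{x-\sigma}}\,(2x+b-\sigma)$; (b) if $\sigma\le-\sqrt2$, then $\nu^\sigma_0$ is the semicircle law with density $\frac1\pi\sqrt{2-x^2}$ on $[-\sqrt2,\sqrt2]$.
   Context: For a closed interval $\Sigma$ and a lower semicontinuous $Q:\Sigma\to(-\infty,+\infty]$ with $Q(x)-\log(1+x^2)\to+\infty$ as $|x|\to\infty$ (if $\Sigma$ is unbounded), the energy of a Borel probability measure $\mu$ on $\Sigma$ is $E_{Q,\Sigma}(\mu)=\iint\log\frac1{|x-y|}\,\mu(dx)\mu(dy)+\int Q\,d\mu$. The equilibrium measure associated to $(\Sigma,Q)$ is the unique probability measure on $\Sigma$ minimizing $E_{Q,\Sigma}$ (it has compact support). *)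

theory Defs
  imports "HOL-Probability.Probability"
begin

definition log_kernel :: "(real \<Rightarrow> ereal) \<Rightarrow> real \<times> real \<Rightarrow> ereal" where
  "log_kernel Q p =
     (if fst p = snd p then \<infinity> else ereal (- ln \<bar>fst p - snd p\<bar>))
       + Q (fst p) / 2 + Q (snd p) / 2"

definition energy :: "(real \<Rightarrow> ereal) \<Rightarrow> real measure \<Rightarrow> ereal" where
  "energy Q \<mu> =
     enn2ereal (\<integral>\<^sup>+ p. e2ennreal (log_kernel Q p) \<partial>(\<mu> \<Otimes>\<^sub>M \<mu>))
     - enn2ereal (\<integral>\<^sup>+ p. e2ennreal (- log_kernel Q p) \<partial>(\<mu> \<Otimes>\<^sub>M \<mu>))"

definition prob_on :: "real set \<Rightarrow> real measure \<Rightarrow> bool" where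
  "prob_on S \<mu> \<longleftrightarrow> sets \<mu> = sets borel \<and> prob_space \<mu> \<and> emeasure \<mu> S = 1"

definition equilibrium_measure :: "real set \<Rightarrow> (real \<Rightarrow> ereal) \<Rightarrow> real measure" where
  "equilibrium_measure S Q =
     (THE \<mu>. prob_on S \<mu> \<and> (\<forall>\<nu>. prob_on S \<nu> \<longrightarrow> energy Q \<mu> \<le> energy Q \<nu>))"

definition Q_alpha :: "real \<Rightarrow> real \<Rightarrow> ereal" where
  "Q_alpha \<alpha> x = (if \<alpha> > 0 \<and> x \<le> 0 then \<infinity> else ereal (x\<^sup>2 - 2 * \<alpha> * ln x))"

definition f_crit :: "real \<Rightarrow> real \<Rightarrow> real \<Rightarrow> real \<Rightarrow> real" where
  "f_crit \<alpha> a b x = 1 / pi * sqrt ((b - x) * (x - a)) * (1 + \<alpha> / sqrt (a * b) * (1 / x))"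

definition f_hard :: "real \<Rightarrow> real \<Rightarrow> real \<Rightarrow> real \<Rightarrow> real" where
  "f_hard \<alpha> \<sigma> b x = 1 / (2 * pi) * sqrt ((b - x) / (x - \<sigma>))
      * (2 * x + b - \<sigma> - 2 * \<alpha> * sqrt (\<sigma> / b) * (1 / x))"

definition dens_measure :: "real set \<Rightarrow> (real \<Rightarrow> real) \<Rightarrow> real measure" where
  "dens_measure S f = density lborel (\<lambda>x. ennreal (indicator S x * f x))"

end

theory Submission
  imports Defs "HOL-Complex_Analysis.Cauchy_Integral_Formula"
begin

text \<open>
  Writing \<open>- ln \<bar>x - y\<bar>\<close> as a Frullani integral of Gaussians makes the logarithmic energy of a
  difference of probability measures an integral of squared moduli of differences of characteristic
  functions. Hence it is nonnegative, and zero only if the measures agree, so that a measure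
  satisfying the Euler--Lagrange conditions (\<open>2 U + Q\<close> constant on the support and at least that
  constant on the rest of the half-line) is the unique minimiser.

  For a measure on \<open>[m - r, m + r]\<close> put \<open>y = m - r cos t\<close>. In all cases of the theorem the
  density becomes a trigonometric polynomial of degree two minus a multiple of a Poisson kernel, and
  the Joukowski substitution \<open>x = m - (r / 2) (u + 1 / u)\<close> turns the potential into an integral of
  \<open>ln \<bar>1 - u exp (i t)\<bar>\<close>, which Cauchy's formula evaluates. For every interval (with positive left
  end point if \<open>\<alpha> > 0\<close>) this gives a density of total mass one with \<open>2 U + Q\<close> constant on the
  interval, and the derivative of \<open>2 U + Q\<close> outside has the sign of the same function that gives the
  density inside. The end points are then dictated by sign conditions alone.
\<close>

section \<open>Positivity of the logarithmic energy\<close>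

text \<open>A competitor is only known to have finite energy, so its logarithmic and field parts
  must first be separated. This works because the field outgrows the logarithm, which bounds the
  kernel below; mixed energies exist because the potential of the candidate is bounded above on the
  whole line. Positivity needs differences of total mass zero: only then does the regularising term
  exp(-r^2/2) of \<open>frullani\<close> cancel. The candidate density comes from matching Fourier
  coefficients. In the angle t the logarithmic potential acts diagonally on cosines (it divides
  cos(nt) by n, up to a common factor), so the terms cos t and cos 2t of x^2 and the terms p^n
  cos(nt) of ln x dictate every coefficient but the mean, which the mass fixes. Where the resulting
  numerator \<open>H\<close> does not vanish at an end point, the density has an inverse square root
  singularity, which the sign condition outside tolerates only at the wall \<sigma>. The end point
  equations (\<open>S1\<close> with \<open>S2\<close>, or the vanishing of \<open>edge_eq\<close>)
  say that \<open>H\<close> vanishes at the free end points.\<close>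

definition frullani :: "real \<Rightarrow> real \<Rightarrow> real" where
  "frullani r t = (exp (- (r * t)\<^sup>2 / 2) - exp (- r\<^sup>2 / 2)) / r"

lemma borel_measurable_cnj[measurable (raw)]:
  "f \<in> borel_measurable M \<Longrightarrow> (\<lambda>x. cnj (f x)) \<in> borel_measurable M"
  by (rule borel_measurable_continuous_on[OF continuous_on_cnj[OF continuous_on_id]])

lemma nn_integral_gauss_linear:
  assumes "0 < (u::real)"
  shows "(\<integral>\<^sup>+r. ennreal (r * u * exp (- (r * u)\<^sup>2 / 2)) * indicator {0..} r \<partial>lborel) = ennreal (1 / u)"
proof -
  have "(\<integral>\<^sup>+r. ennreal (r * u * exp (- (r * u)\<^sup>2 / 2)) * indicator {0..} r \<partial>lborel)
      = 0 - (\<lambda>r. - exp (- (r * u)\<^sup>2 / 2) / u) 0"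
  proof (rule nn_integral_FTC_atLeast)
    fix r :: real assume "0 \<le> r"
    show "DERIV (\<lambda>r. - exp (- (r * u)\<^sup>2 / 2) / u) r :> r * u * exp (- (r * u)\<^sup>2 / 2)"
      using assms by (auto intro!: derivative_eq_intros simp: power2_eq_square field_simps)
    show "0 \<le> r * u * exp (- (r * u)\<^sup>2 / 2)" using assms \<open>0 \<le> r\<close> by simp
  next
    have "((\<lambda>r. exp (- (r * u)\<^sup>2 / 2)) \<longlongrightarrow> 0) at_top"
    proof (rule filterlim_compose[OF exp_at_bot])
      show "filterlim (\<lambda>r. - (r * u)\<^sup>2 / 2) at_bot at_top"
        using assms by real_asymp
    qed
    from tendsto_divide[OF tendsto_minus[OF this] tendsto_const[of u]]
    show "((\<lambda>r. - exp (- (r * u)\<^sup>2 / 2) / u) \<longlongrightarrow> 0) at_top" using assms by simp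
  qed simp
  then show ?thesis using assms by simp
qed

text \<open>The difference of Gaussians over r is the integral of r u exp(-(r u)^2 / 2) over u in
  [s, t]. By Tonelli the r-integral comes first and gives 1/u, which then integrates to a difference
  of logarithms.\<close>

lemma nn_integral_frullani_gauss:
  assumes "0 < s" "s \<le> t"
  shows "(\<integral>\<^sup>+r. ennreal ((exp (- (r * s)\<^sup>2 / 2) - exp (- (r * t)\<^sup>2 / 2)) / r) * indicator {0<..} r \<partial>lborel)
       = ennreal (ln t - ln (s::real))"
proof -
  have inner: "ennreal ((exp (- (r * s)\<^sup>2 / 2) - exp (- (r * t)\<^sup>2 / 2)) / r)
      = (\<integral>\<^sup>+u. ennreal (r * u * exp (- (r * u)\<^sup>2 / 2)) * indicator {s..t} u \<partial>lborel)"
    if "0 < r" for r :: real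
  proof -
    have "(\<integral>\<^sup>+u. ennreal (r * u * exp (- (r * u)\<^sup>2 / 2)) * indicator {s..t} u \<partial>lborel)
       = (\<lambda>u. - exp (- (r * u)\<^sup>2 / 2) / r) t - (\<lambda>u. - exp (- (r * u)\<^sup>2 / 2) / r) s"
    proof (rule nn_integral_FTC_Icc)
      fix u assume "u \<in> {s..t}"
      show "DERIV (\<lambda>u. - exp (- (r * u)\<^sup>2 / 2) / r) u :> r * u * exp (- (r * u)\<^sup>2 / 2)"
        using that by (auto intro!: derivative_eq_intros simp: power2_eq_square field_simps)
      show "0 \<le> r * u * exp (- (r * u)\<^sup>2 / 2)" using that \<open>u \<in> _\<close> assms by simp
    qed (use assms in auto)
    then show ?thesis by (simp add: diff_divide_distrib)
  qed
  have "(\<integral>\<^sup>+r. ennreal ((exp (- (r * s)\<^sup>2 / 2) - exp (- (r * t)\<^sup>2 / 2)) / r) * indicator {0<..} r \<partial>lborel)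
     = (\<integral>\<^sup>+r. (\<integral>\<^sup>+u. ennreal (r * u * exp (- (r * u)\<^sup>2 / 2)) * indicator {s..t} u * indicator {0..} r \<partial>lborel) \<partial>lborel)"
  proof (rule nn_integral_cong_AE)
    show "AE r in lborel. ennreal ((exp (- (r * s)\<^sup>2 / 2) - exp (- (r * t)\<^sup>2 / 2)) / r) * indicator {0<..} r
       = (\<integral>\<^sup>+u. ennreal (r * u * exp (- (r * u)\<^sup>2 / 2)) * indicator {s..t} u * indicator {0..} r \<partial>lborel)"
      using AE_lborel_singleton[of 0]
    proof eventually_elim
      case (elim r)
      then show ?case using inner[of r] by (cases "0 < r") (auto split: split_indicator)
    qed
  qed
  also have "\<dots> = (\<integral>\<^sup>+u. (\<integral>\<^sup>+r. ennreal (r * u * exp (- (r * u)\<^sup>2 / 2)) * indicator {s..t} u * indicator {0..} r \<partial>lborel) \<partial>lborel)"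
    by (rule lborel_pair.Fubini') measurable
  also have "\<dots> = (\<integral>\<^sup>+u. ennreal (1 / u) * indicator {s..t} u \<partial>lborel)"
  proof (rule nn_integral_cong)
    fix u :: real
    show "(\<integral>\<^sup>+r. ennreal (r * u * exp (- (r * u)\<^sup>2 / 2)) * indicator {s..t} u * indicator {0..} r \<partial>lborel)
        = ennreal (1 / u) * indicator {s..t} u"
      using nn_integral_gauss_linear[of u] assms by (cases "u \<in> {s..t}") auto
  qed
  also have "\<dots> = ln t - ln s"
    by (rule nn_integral_FTC_Icc) (use assms in \<open>auto intro!: derivative_eq_intros\<close>)
  finally show ?thesis .
qed

text \<open>Comparison of \<bar>t\<bar> with the reference point 1, where the logarithm vanishes.
  The integrand has a constant sign in r, so its absolute integral is known too; that third fact is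
  what later permits Fubini over pairs of points.\<close>

lemma frullani_integral:
  assumes "t \<noteq> 0"
  shows "integrable lborel (\<lambda>r. indicator {0<..} r * frullani r t)"
    and "(\<integral>r. indicator {0<..} r * frullani r t \<partial>lborel) = - ln \<bar>t\<bar>"
    and "(\<integral>r. \<bar>indicator {0<..} r * frullani r t\<bar> \<partial>lborel) = \<bar>ln \<bar>t\<bar>\<bar>"
proof -
  have sq: "frullani r t = frullani r \<bar>t\<bar>" for r by (simp add: frullani_def power_mult_distrib)
  \<comment> \<open>The sign of -ln \<bar>t\<bar>. Multiplying by it treats both orders of
    \<bar>t\<bar> and 1 as one nonnegative integral.\<close>
  define \<sigma> :: real where "\<sigma> = (if \<bar>t\<bar> \<le> 1 then 1 else -1)"
  have s2: "\<sigma> * \<sigma> = 1" by (simp add: \<sigma>_def)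
  have nonneg: "0 \<le> \<sigma> * (indicator {0<..} r * frullani r t)" for r
  proof (cases "0 < r")
    case True
    have "(r * \<bar>t\<bar>)\<^sup>2 \<le> r\<^sup>2" if "\<bar>t\<bar> \<le> 1"
      using that True power_mono[of "r * \<bar>t\<bar>" r 2] by (simp add: mult_left_le)
    moreover have "(r * \<bar>t\<bar>)\<^sup>2 \<ge> r\<^sup>2" if "\<not> \<bar>t\<bar> \<le> 1"
      using that True power_mono[of r "r * \<bar>t\<bar>" 2] by simp
    ultimately show ?thesis using True
      unfolding sq by (auto simp: \<sigma>_def frullani_def divide_le_0_iff)
  qed simp
  have ln_nonneg: "0 \<le> \<sigma> * - ln \<bar>t\<bar>" using assms by (auto simp: \<sigma>_def)
  have nn: "(\<integral>\<^sup>+r. ennreal (\<sigma> * (indicator {0<..} r * frullani r t)) \<partial>lborel) = ennreal (\<sigma> * - ln \<bar>t\<bar>)"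
  proof (cases "\<bar>t\<bar> \<le> 1")
    case True
    then have "(\<integral>\<^sup>+r. ennreal ((exp (- (r * \<bar>t\<bar>)\<^sup>2 / 2) - exp (- r\<^sup>2 / 2)) / r) * indicator {0<..} r \<partial>lborel)
       = ennreal (- ln \<bar>t\<bar>)"
      using nn_integral_frullani_gauss[of "\<bar>t\<bar>" 1] assms by simp
    moreover have "ennreal (\<sigma> * (indicator {0<..} r * frullani r t))
       = ennreal ((exp (- (r * \<bar>t\<bar>)\<^sup>2 / 2) - exp (- r\<^sup>2 / 2)) / r) * indicator {0<..} r" for r
      using True unfolding sq \<sigma>_def by (auto simp: frullani_def split: split_indicator)
    ultimately show ?thesis using True by (simp add: \<sigma>_def)
  next
    case False
    then have "(\<integral>\<^sup>+r. ennreal ((exp (- r\<^sup>2 / 2) - exp (- (r * \<bar>t\<bar>)\<^sup>2 / 2)) / r) * indicator {0<..} r \<partial>lborel)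
       = ennreal (ln \<bar>t\<bar>)"
      using nn_integral_frullani_gauss[of 1 "\<bar>t\<bar>"] by simp
    moreover have "ennreal (\<sigma> * (indicator {0<..} r * frullani r t))
       = ennreal ((exp (- r\<^sup>2 / 2) - exp (- (r * \<bar>t\<bar>)\<^sup>2 / 2)) / r) * indicator {0<..} r" for r
      using False unfolding sq \<sigma>_def by (auto simp: frullani_def field_simps split: split_indicator)
    ultimately show ?thesis using False by (simp add: \<sigma>_def)
  qed
  have m: "(\<lambda>r. \<sigma> * (indicator {0<..} r * frullani r t)) \<in> borel_measurable lborel"
    unfolding frullani_def by measurable
  have hb: "has_bochner_integral lborel (\<lambda>r. \<sigma> * (indicator {0<..} r * frullani r t)) (\<sigma> * - ln \<bar>t\<bar>)"
    by (rule has_bochner_integral_nn_integral[OF m _ ln_nonneg nn]) (use nonneg in auto)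
  from has_bochner_integral_mult_right[OF this, of \<sigma>]
  have hb1: "has_bochner_integral lborel (\<lambda>r. indicator {0<..} r * frullani r t) (- ln \<bar>t\<bar>)"
    by (simp add: mult.assoc[symmetric] s2)
  show "integrable lborel (\<lambda>r. indicator {0<..} r * frullani r t)"
    "(\<integral>r. indicator {0<..} r * frullani r t \<partial>lborel) = - ln \<bar>t\<bar>"
    using hb1 by (auto dest: has_bochner_integral_integral_eq simp: has_bochner_integral_iff)
  have "\<bar>indicator {0<..} r * frullani r t\<bar> = \<sigma> * (indicator {0<..} r * frullani r t)" for r
    using nonneg[of r] by (auto simp: \<sigma>_def abs_if split: if_splits)
  moreover have "\<bar>ln \<bar>t\<bar>\<bar> = \<sigma> * - ln \<bar>t\<bar>" using ln_nonneg by (auto simp: \<sigma>_def abs_if split: if_splits)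
  ultimately show "(\<integral>r. \<bar>indicator {0<..} r * frullani r t\<bar> \<partial>lborel) = \<bar>ln \<bar>t\<bar>\<bar>"
    using hb by (auto dest: has_bochner_integral_integral_eq)
qed

section \<open>Fourier representation of the logarithmic energy\<close>

locale two_real_dist = M: real_distribution M + N: real_distribution N for M N
begin

sublocale MN: pair_prob_space M N ..

lemma setsMN[measurable_cong]: "sets (M \<Otimes>\<^sub>M N) = sets (borel \<Otimes>\<^sub>M borel)"
  by (rule sets_pair_measure_cong) auto

text \<open>The Gaussian is the characteristic function of the standard normal law. Inserting this
  and exchanging integrals factors the exponential of a difference into a product of characteristic
  functions.\<close>

lemma gauss_char:
  "(\<integral>p. exp (- (r * (fst p - snd p))\<^sup>2 / 2) \<partial>(M \<Otimes>\<^sub>M N))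
     = (\<integral>z. Re (char M (r * z) * cnj (char N (r * z))) \<partial>std_normal_distribution)"
proof -
  interpret G: real_distribution std_normal_distribution by (rule real_dist_normal_dist)
  interpret P: pair_prob_space "M \<Otimes>\<^sub>M N" std_normal_distribution ..
  have i: "iexp (r * z * (x - y)) = iexp (r * z * x) * cnj (iexp (r * z * y))" for x y z :: real
    by (simp add: exp_cnj exp_add[symmetric] algebra_simps)
  have "complex_of_real (\<integral>p. exp (- (r * (fst p - snd p))\<^sup>2 / 2) \<partial>(M \<Otimes>\<^sub>M N))
     = (\<integral>p. char std_normal_distribution (r * (fst p - snd p)) \<partial>(M \<Otimes>\<^sub>M N))"
    by (simp add: char_std_normal_distribution)
  also have "\<dots> = (\<integral>p. (\<integral>z. iexp (r * z * (fst p - snd p)) \<partial>std_normal_distribution) \<partial>(M \<Otimes>\<^sub>M N))"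
    unfolding char_def by (simp add: ac_simps)
  also have "\<dots> = (\<integral>z. (\<integral>p. iexp (r * z * (fst p - snd p)) \<partial>(M \<Otimes>\<^sub>M N)) \<partial>std_normal_distribution)"
  proof (rule P.Fubini_integral[symmetric])
    show "integrable ((M \<Otimes>\<^sub>M N) \<Otimes>\<^sub>M std_normal_distribution) (\<lambda>(p, z). iexp (r * z * (fst p - snd p)))"
      by (rule P.integrable_const_bound[where B = 1]) (auto simp: split_beta)
  qed
  also have "\<dots> = (\<integral>z. char M (r * z) * cnj (char N (r * z)) \<partial>std_normal_distribution)"
  proof (rule Bochner_Integration.integral_cong[OF refl])
    fix z
    have int: "integrable (M \<Otimes>\<^sub>M N) (\<lambda>p. iexp (r * z * (fst p - snd p)))"
      by (rule MN.integrable_const_bound[where B = 1]) auto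
    have "(\<integral>p. iexp (r * z * (fst p - snd p)) \<partial>(M \<Otimes>\<^sub>M N))
       = (\<integral>x. (\<integral>y. iexp (r * z * x) * cnj (iexp (r * z * y)) \<partial>N) \<partial>M)"
      using MN.integral_fst'[OF int] by (simp only: i fst_conv snd_conv)
    also have "\<dots> = char M (r * z) * cnj (char N (r * z))"
      unfolding char_def by (simp only: integral_mult_right_zero integral_mult_left_zero Bochner_Integration.integral_cnj)
    finally show "(\<integral>p. iexp (r * z * (fst p - snd p)) \<partial>(M \<Otimes>\<^sub>M N)) = char M (r * z) * cnj (char N (r * z))" .
  qed
  finally have *: "complex_of_real (\<integral>p. exp (- (r * (fst p - snd p))\<^sup>2 / 2) \<partial>(M \<Otimes>\<^sub>M N))
    = (\<integral>z. char M (r * z) * cnj (char N (r * z)) \<partial>std_normal_distribution)" .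
  have "integrable std_normal_distribution (\<lambda>z. char M (r * z) * cnj (char N (r * z)))"
  proof (rule G.integrable_const_bound[where B = 1])
    show "AE z in std_normal_distribution. norm (char M (r * z) * cnj (char N (r * z))) \<le> 1"
      using mult_mono[OF M.cmod_char_le_1 N.cmod_char_le_1] by (simp add: norm_mult)
    have [measurable]: "char M \<in> borel_measurable borel" "char N \<in> borel_measurable borel"
      by (rule M.char_measurable N.char_measurable)+
    show "(\<lambda>z. char M (r * z) * cnj (char N (r * z))) \<in> borel_measurable std_normal_distribution"
      by measurable
  qed
  from integral_Re[OF this, folded *] show ?thesis by simp
qed

text \<open>Fubini for the Frullani integral. Its absolute r-integral at distance d is \<bar>ln
  d\<bar>, so integrability of the logarithm on the product is exactly what is required.\<close>

lemma log_energy_frullani: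
  assumes int: "integrable (M \<Otimes>\<^sub>M N) (\<lambda>p. ln \<bar>fst p - snd p\<bar>)"
    and diag: "AE p in M \<Otimes>\<^sub>M N. fst p \<noteq> snd p"
  shows "integrable lborel (\<lambda>r. indicator {0<..} r * (\<integral>p. frullani r (fst p - snd p) \<partial>(M \<Otimes>\<^sub>M N)))"
    and "(\<integral>r. indicator {0<..} r * (\<integral>p. frullani r (fst p - snd p) \<partial>(M \<Otimes>\<^sub>M N)) \<partial>lborel)
       = (\<integral>p. - ln \<bar>fst p - snd p\<bar> \<partial>(M \<Otimes>\<^sub>M N))"
proof -
  interpret P: pair_sigma_finite "M \<Otimes>\<^sub>M N" lborel ..
  let ?f = "\<lambda>q. indicator {0<..} (snd q) * frullani (snd q) (fst (fst q) - snd (fst q))"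
  have I: "integrable ((M \<Otimes>\<^sub>M N) \<Otimes>\<^sub>M lborel) ?f"
  proof (rule P.Fubini_integrable)
    show "?f \<in> borel_measurable ((M \<Otimes>\<^sub>M N) \<Otimes>\<^sub>M lborel)"
      unfolding frullani_def by measurable
    have "AE p in M \<Otimes>\<^sub>M N. \<bar>ln \<bar>fst p - snd p\<bar>\<bar> = (\<integral>r. norm (?f (p, r)) \<partial>lborel)"
      using diag
    proof eventually_elim
      case (elim p)
      then show ?case using frullani_integral(3)[of "fst p - snd p"] by simp
    qed
    moreover have "(\<lambda>p. \<integral>r. norm (?f (p, r)) \<partial>lborel) \<in> borel_measurable (M \<Otimes>\<^sub>M N)"
      unfolding frullani_def by measurable
    ultimately show "integrable (M \<Otimes>\<^sub>M N) (\<lambda>p. \<integral>r. norm (?f (p, r)) \<partial>lborel)"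
      by (subst integrable_cong_AE[where g = "\<lambda>p. \<bar>ln \<bar>fst p - snd p\<bar>\<bar>"])
        (use int in auto)
    show "AE p in M \<Otimes>\<^sub>M N. integrable lborel (\<lambda>r. ?f (p, r))"
      using diag by eventually_elim (use frullani_integral(1) in auto)
  qed
  have I': "integrable ((M \<Otimes>\<^sub>M N) \<Otimes>\<^sub>M lborel) (\<lambda>(p, r). indicator {0<..} r * frullani r (fst p - snd p))"
    by (rule back_subst[where P = "integrable _", OF I]) auto
  show "integrable lborel (\<lambda>r. indicator {0<..} r * (\<integral>p. frullani r (fst p - snd p) \<partial>(M \<Otimes>\<^sub>M N)))"
    using P.integrable_snd[OF I'] by simp
  have "(\<integral>r. indicator {0<..} r * (\<integral>p. frullani r (fst p - snd p) \<partial>(M \<Otimes>\<^sub>M N)) \<partial>lborel)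
     = (\<integral>p. (\<integral>r. indicator {0<..} r * frullani r (fst p - snd p) \<partial>lborel) \<partial>(M \<Otimes>\<^sub>M N))"
    using P.Fubini_integral[OF I'] by simp
  also have "\<dots> = (\<integral>p. - ln \<bar>fst p - snd p\<bar> \<partial>(M \<Otimes>\<^sub>M N))"
  proof (rule integral_cong_AE)
    show "(\<lambda>p. \<integral>r. indicator {0<..} r * frullani r (fst p - snd p) \<partial>lborel) \<in> borel_measurable (M \<Otimes>\<^sub>M N)"
      unfolding frullani_def by measurable
    show "AE p in M \<Otimes>\<^sub>M N. (\<integral>r. indicator {0<..} r * frullani r (fst p - snd p) \<partial>lborel) = - ln \<bar>fst p - snd p\<bar>"
      using diag by eventually_elim (use frullani_integral(2) in auto)
  qed measurable
  finally show "(\<integral>r. indicator {0<..} r * (\<integral>p. frullani r (fst p - snd p) \<partial>(M \<Otimes>\<^sub>M N)) \<partial>lborel)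
       = (\<integral>p. - ln \<bar>fst p - snd p\<bar> \<partial>(M \<Otimes>\<^sub>M N))" .
qed

lemma frullani_char:
  "(\<integral>p. frullani r (fst p - snd p) \<partial>(M \<Otimes>\<^sub>M N))
     = ((\<integral>z. Re (char M (r * z) * cnj (char N (r * z))) \<partial>std_normal_distribution) - exp (- r\<^sup>2 / 2)) / r"
proof -
  have "integrable (M \<Otimes>\<^sub>M N) (\<lambda>p. exp (- (r * (fst p - snd p))\<^sup>2 / 2))"
    by (rule MN.integrable_const_bound[where B = 1]) auto
  then show ?thesis
    unfolding frullani_def using gauss_char[of r] by (simp add: MN.prob_space)
qed

end

lemma continuous_AE_zero:
  fixes f :: "real \<Rightarrow> real"
  assumes "continuous_on UNIV f" "AE z in lborel. f z = 0"
  shows "f z = 0"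
proof (rule ccontr)
  assume "f z \<noteq> 0"
  have "open {z. f z \<noteq> 0}"
    using assms(1) by (intro open_Collect_neq) auto
  then obtain e where e: "0 < e" "cball z e \<subseteq> {z. f z \<noteq> 0}"
    using \<open>f z \<noteq> 0\<close> open_contains_cball by blast
  have "AE x in lborel. x \<notin> {z - e..z + e}"
    using assms(2)
  proof eventually_elim
    case (elim x)
    then show ?case using e(2) by (auto simp: cball_eq_atLeastAtMost)
  qed
  then have "emeasure lborel {z - e..z + e} = 0"
    by (subst (asm) AE_iff_null_sets[symmetric]) auto
  then show False using e(1) by simp
qed

text \<open>The defect J(\<mu>,\<mu>) + J(\<nu>,\<nu>) - 2 J(\<mu>,\<nu>) equals the integral over r
  > 0 of \<open>?D r / r\<close>, where \<open>?D r\<close> is the Gaussian mean of the squared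
  distance between the two characteristic functions at r z.\<close>

lemma log_energy_positive:
  assumes "real_distribution \<mu>" "real_distribution \<nu>"
    and imm: "integrable (\<mu> \<Otimes>\<^sub>M \<mu>) (\<lambda>p. ln \<bar>fst p - snd p\<bar>)"
    and inn: "integrable (\<nu> \<Otimes>\<^sub>M \<nu>) (\<lambda>p. ln \<bar>fst p - snd p\<bar>)"
    and imn: "integrable (\<mu> \<Otimes>\<^sub>M \<nu>) (\<lambda>p. ln \<bar>fst p - snd p\<bar>)"
    and dmm: "AE p in \<mu> \<Otimes>\<^sub>M \<mu>. fst p \<noteq> snd p"
    and dnn: "AE p in \<nu> \<Otimes>\<^sub>M \<nu>. fst p \<noteq> snd p"
    and dmn: "AE p in \<mu> \<Otimes>\<^sub>M \<nu>. fst p \<noteq> snd p"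
  defines "J \<equiv> (\<lambda>M N. \<integral>p. - ln \<bar>fst p - snd p\<bar> \<partial>(M \<Otimes>\<^sub>M N))"
  shows "2 * J \<mu> \<nu> \<le> J \<mu> \<mu> + J \<nu> \<nu>"
    and "2 * J \<mu> \<nu> = J \<mu> \<mu> + J \<nu> \<nu> \<Longrightarrow> \<mu> = \<nu>"
proof -
  interpret M: real_distribution \<mu> by fact
  interpret N: real_distribution \<nu> by fact
  interpret G: real_distribution std_normal_distribution by (rule real_dist_normal_dist)
  interpret MM: two_real_dist \<mu> \<mu> ..
  interpret NN: two_real_dist \<nu> \<nu> ..
  interpret MN: two_real_dist \<mu> \<nu> ..
  let ?D = "\<lambda>r. \<integral>z. (cmod (char \<mu> (r * z) - char \<nu> (r * z)))\<^sup>2 \<partial>std_normal_distribution"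
  have [measurable]: "char \<mu> \<in> borel_measurable borel" "char \<nu> \<in> borel_measurable borel"
    by (rule M.char_measurable N.char_measurable)+
  have int_char: "integrable std_normal_distribution (\<lambda>z. Re (char A (r * z) * cnj (char B (r * z))))"
    if "real_distribution A" "real_distribution B" for A B and r :: real
  proof (rule G.integrable_const_bound[where B = 1])
    interpret A: real_distribution A by fact
    interpret B: real_distribution B by fact
    have [measurable]: "char A \<in> borel_measurable borel" "char B \<in> borel_measurable borel"
      by (rule A.char_measurable B.char_measurable)+
    show "(\<lambda>z. Re (char A (r * z) * cnj (char B (r * z)))) \<in> borel_measurable std_normal_distribution"
      by measurable
    show "AE z in std_normal_distribution. norm (Re (char A (r * z) * cnj (char B (r * z)))) \<le> 1"
    proof (rule AE_I2)
      fix z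
      have "\<bar>Re (char A (r * z) * cnj (char B (r * z)))\<bar> \<le> cmod (char A (r * z) * cnj (char B (r * z)))"
        by (rule abs_Re_le_cmod)
      also have "\<dots> \<le> 1" using mult_mono[OF A.cmod_char_le_1 B.cmod_char_le_1] by (simp add: norm_mult)
      finally show "norm (Re (char A (r * z) * cnj (char B (r * z)))) \<le> 1" by simp
    qed
  qed
  have int_D: "integrable std_normal_distribution (\<lambda>z. (cmod (char \<mu> (r * z) - char \<nu> (r * z)))\<^sup>2)"
   and D_eq: "?D r / r = (\<integral>p. frullani r (fst p - snd p) \<partial>(\<mu> \<Otimes>\<^sub>M \<mu>)) + (\<integral>p. frullani r (fst p - snd p) \<partial>(\<nu> \<Otimes>\<^sub>M \<nu>))
        - 2 * (\<integral>p. frullani r (fst p - snd p) \<partial>(\<mu> \<Otimes>\<^sub>M \<nu>))" for r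
  proof -
    have e: "(cmod (a - b))\<^sup>2 = Re (a * cnj a) + Re (b * cnj b) - 2 * Re (a * cnj b)" for a b
      by (simp only: cmod_power2 times_complex.sel minus_complex.sel cnj.sel, simp only: power2_eq_square ring_distribs, algebra)
    note ints = int_char[OF assms(1,1), of r] int_char[OF assms(2,2), of r] int_char[OF assms(1,2), of r]
    show "integrable std_normal_distribution (\<lambda>z. (cmod (char \<mu> (r * z) - char \<nu> (r * z)))\<^sup>2)"
      unfolding e by (intro Bochner_Integration.integrable_diff Bochner_Integration.integrable_add integrable_mult_right ints)
    have "?D r = (\<integral>z. Re (char \<mu> (r * z) * cnj (char \<mu> (r * z))) \<partial>std_normal_distribution)
       + (\<integral>z. Re (char \<nu> (r * z) * cnj (char \<nu> (r * z))) \<partial>std_normal_distribution)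
       - 2 * (\<integral>z. Re (char \<mu> (r * z) * cnj (char \<nu> (r * z))) \<partial>std_normal_distribution)"
      unfolding e using ints
      by (simp only: Bochner_Integration.integral_diff Bochner_Integration.integral_add integral_mult_right_zero
          Bochner_Integration.integrable_add integrable_mult_right)
    \<comment> \<open>The regularising terms exp(-r^2/2) / r occur with coefficients 1 + 1 - 2 and
      drop out.\<close>
    then show "?D r / r = (\<integral>p. frullani r (fst p - snd p) \<partial>(\<mu> \<Otimes>\<^sub>M \<mu>)) + (\<integral>p. frullani r (fst p - snd p) \<partial>(\<nu> \<Otimes>\<^sub>M \<nu>))
        - 2 * (\<integral>p. frullani r (fst p - snd p) \<partial>(\<mu> \<Otimes>\<^sub>M \<nu>))"
      unfolding MM.frullani_char NN.frullani_char MN.frullani_char by (simp add: diff_divide_distrib add_divide_distrib)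
  qed
  note i = MM.log_energy_frullani[OF imm dmm] NN.log_energy_frullani[OF inn dnn] MN.log_energy_frullani[OF imn dmn]
  have eq: "indicator {0<..} r * (?D r / r) = indicator {0<..} r * (\<integral>p. frullani r (fst p - snd p) \<partial>(\<mu> \<Otimes>\<^sub>M \<mu>))
     + indicator {0<..} r * (\<integral>p. frullani r (fst p - snd p) \<partial>(\<nu> \<Otimes>\<^sub>M \<nu>))
     - 2 * (indicator {0<..} r * (\<integral>p. frullani r (fst p - snd p) \<partial>(\<mu> \<Otimes>\<^sub>M \<nu>)))" for r :: real
    unfolding D_eq by (simp add: algebra_simps)
  have Dint: "integrable lborel (\<lambda>r. indicator {0<..} r * (?D r / r))"
    unfolding eq using i by auto
  have Deq: "(\<integral>r. indicator {0<..} r * (?D r / r) \<partial>lborel) = J \<mu> \<mu> + J \<nu> \<nu> - 2 * J \<mu> \<nu>"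
    unfolding eq J_def using i by simp
  have Dpos: "0 \<le> indicator {0<..} r * (?D r / r)" for r :: real
    by (auto split: split_indicator)
  show "2 * J \<mu> \<nu> \<le> J \<mu> \<mu> + J \<nu> \<nu>"
    using integral_nonneg_AE[of "\<lambda>r. indicator {0<..} r * (?D r / r)" lborel, OF AE_I2[OF Dpos]] Deq
    by linarith
  assume "2 * J \<mu> \<nu> = J \<mu> \<mu> + J \<nu> \<nu>"
  then have "(\<integral>r. indicator {0<..} r * (?D r / r) \<partial>lborel) = 0" using Deq by simp
  then have "AE r in lborel. indicator {0<..} r * (?D r / r) = 0"
    using integral_nonneg_eq_0_iff_AE[OF Dint] Dpos by simp
  then have "AE r in lborel. r \<in> {0<..} \<longrightarrow> ?D r = 0"
    by eventually_elim auto
  then have Dae: "AE r in lborel. r \<in> {0<..} \<longrightarrow> ?D r = 0" .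
  \<comment> \<open>A single positive r is enough: as z runs over the line, so does r z, and the
    normal density is positive everywhere.\<close>
  have "\<exists>r>0. ?D r = 0"
  proof (rule ccontr)
    assume no: "\<not> (\<exists>r>0. ?D r = 0)"
    have "AE r in lborel. r \<notin> {0<..(1::real)}"
      using Dae by eventually_elim (use no in auto)
    then have "emeasure lborel {0<..(1::real)} = 0"
      by (subst (asm) AE_iff_null_sets[symmetric]) auto
    then show False by simp
  qed
  then obtain r where r: "0 < r" "?D r = 0" by blast
  have "AE z in std_normal_distribution. (cmod (char \<mu> (r * z) - char \<nu> (r * z)))\<^sup>2 = 0"
    using integral_nonneg_eq_0_iff_AE[OF int_D] r by simp
  then have "AE z in lborel. 0 < ennreal (std_normal_density z) \<longrightarrow> (cmod (char \<mu> (r * z) - char \<nu> (r * z)))\<^sup>2 = 0"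
    by (rule AE_density[THEN iffD1, rotated]) measurable
  then have ae: "AE z in lborel. (cmod (char \<mu> (r * z) - char \<nu> (r * z)))\<^sup>2 = 0"
    by eventually_elim (use normal_density_pos[of 1 0] in auto)
  have "continuous_on UNIV (char \<mu>)" "continuous_on UNIV (char \<nu>)"
    using M.isCont_char N.isCont_char by (simp_all add: continuous_at_imp_continuous_on)
  moreover have "continuous_on UNIV (\<lambda>z. r * z)" by (intro continuous_intros)
  ultimately have "continuous_on UNIV (\<lambda>z. char \<mu> (r * z))" "continuous_on UNIV (\<lambda>z. char \<nu> (r * z))"
    using continuous_on_compose2[OF _ _ subset_UNIV] by blast+
  then have cont: "continuous_on UNIV (\<lambda>z. (cmod (char \<mu> (r * z) - char \<nu> (r * z)))\<^sup>2)"
    by (intro continuous_on_power continuous_on_norm continuous_on_diff)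
  have "(cmod (char \<mu> (r * z) - char \<nu> (r * z)))\<^sup>2 = 0" for z
    by (rule continuous_AE_zero[OF cont ae])
  then have eqz: "char \<mu> (r * z) = char \<nu> (r * z)" for z by simp
  have "char \<mu> = char \<nu>"
  proof
    fix t show "char \<mu> t = char \<nu> t" using eqz[of "t / r"] r by simp
  qed
  then show "\<mu> = \<nu>" by (rule Levy_uniqueness[OF assms(1,2)])
qed

section \<open>Energies and the variational inequality\<close>

text \<open>Since \<open>ln 0 = 0\<close> in HOL, the diagonal has to be excluded separately (it is null for every
  measure of finite energy).\<close>

definition log_energy :: "real measure \<Rightarrow> real measure \<Rightarrow> real" where
  "log_energy M N = (\<integral>p. - ln \<bar>fst p - snd p\<bar> \<partial>(M \<Otimes>\<^sub>M N))"

definition ext_field :: "real \<Rightarrow> real \<Rightarrow> real" where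
  "ext_field \<alpha> x = x\<^sup>2 - 2 * \<alpha> * ln x"

text \<open>The set where \<open>Q_alpha\<close> is finite. Outside it the real-valued
  \<open>ext_field\<close> no longer represents the field.\<close>

definition ext_field_dom :: "real \<Rightarrow> real set" where
  "ext_field_dom \<alpha> = {x. \<alpha> > 0 \<longrightarrow> x > 0}"

definition kern :: "real \<Rightarrow> real \<times> real \<Rightarrow> real" where
  "kern \<alpha> p = - ln \<bar>fst p - snd p\<bar> + ext_field \<alpha> (fst p) / 2 + ext_field \<alpha> (snd p) / 2"

lemma ext_field_measurable[measurable]: "ext_field \<alpha> \<in> borel_measurable borel"
  unfolding ext_field_def by measurable

lemma ext_field_dom_sets[measurable]: "ext_field_dom \<alpha> \<in> sets borel"
  unfolding ext_field_dom_def by measurable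

lemma pred_dom: "Measurable.pred borel (\<lambda>x. x \<in> ext_field_dom \<alpha>)"
  by measurable

lemma Q_alpha_eq: "Q_alpha \<alpha> x = (if x \<in> ext_field_dom \<alpha> then ereal (ext_field \<alpha> x) else \<infinity>)"
  by (auto simp: Q_alpha_def ext_field_dom_def ext_field_def)

lemma Q_alpha_measurable[measurable]: "Q_alpha \<alpha> \<in> borel_measurable borel"
  unfolding Q_alpha_eq[abs_def] by measurable

lemma log_kernel_measurable[measurable]:
  "log_kernel (Q_alpha \<alpha>) \<in> borel_measurable (borel \<Otimes>\<^sub>M borel)"
  unfolding log_kernel_def[abs_def] by measurable

lemma kern_measurable[measurable]: "kern \<alpha> \<in> borel_measurable (borel \<Otimes>\<^sub>M borel)"
  unfolding kern_def[abs_def] by measurable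

lemma log_kernel_eq:
  "log_kernel (Q_alpha \<alpha>) p = (if fst p \<noteq> snd p \<and> fst p \<in> ext_field_dom \<alpha> \<and> snd p \<in> ext_field_dom \<alpha>
     then ereal (kern \<alpha> p) else \<infinity>)"
proof -
  have h: "ereal a / 2 = ereal (a / 2)" for a by simp
  have i: "(\<infinity>::ereal) / 2 = \<infinity>" by simp
  show ?thesis
    unfolding log_kernel_def Q_alpha_eq kern_def by (auto simp: h)
qed

text \<open>The product (1 + x^2)(1 + y^2) exceeds (x - y)^2 by the square of 1 + x y.\<close>

lemma ln_dist_le: "ln \<bar>x - y\<bar> \<le> (ln (1 + x\<^sup>2) + ln (1 + y\<^sup>2)) / (2::real)"
proof (cases "x = y")
  case True
  then show ?thesis by simp
next
  case False
  have "(x - y)\<^sup>2 \<le> (1 + x\<^sup>2) * (1 + y\<^sup>2)"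
    using zero_le_power2[of "1 + x * y"] by (simp add: power2_eq_square algebra_simps)
  then have "ln ((x - y)\<^sup>2) \<le> ln ((1 + x\<^sup>2) * (1 + y\<^sup>2))"
    using False by (subst ln_le_cancel_iff) (auto simp: add_pos_nonneg)
  also have "\<dots> = ln (1 + x\<^sup>2) + ln (1 + y\<^sup>2)"
    by (intro ln_mult_pos) (auto simp: add_pos_nonneg)
  finally have "2 * ln \<bar>x - y\<bar> \<le> ln (1 + x\<^sup>2) + ln (1 + y\<^sup>2)"
    using False ln_realpow[of "\<bar>x - y\<bar>" 2] by simp
  then show ?thesis by simp
qed

text \<open>The tangent bound ln z \<le> z - 1 at z = (1 + x^2) / (2 K); this scale turns into slope
  1/2 after multiplication by K.\<close>

lemma ln_le_quadratic:
  assumes "1 \<le> (K::real)"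
  shows "K * ln (1 + x\<^sup>2) \<le> x\<^sup>2 / 2 + (1 + K * ln (2 * K))"
proof -
  have p: "0 < 1 + x\<^sup>2" by (simp add: add_pos_nonneg)
  have "ln ((1 + x\<^sup>2) / (2 * K)) \<le> (1 + x\<^sup>2) / (2 * K) - 1"
    using p assms by (intro ln_le_minus_one) simp
  then have "ln (1 + x\<^sup>2) \<le> (1 + x\<^sup>2) / (2 * K) - 1 + ln (2 * K)"
    using p assms by (simp add: ln_div)
  then have "K * ln (1 + x\<^sup>2) \<le> K * ((1 + x\<^sup>2) / (2 * K) - 1 + ln (2 * K))"
    using assms by (intro mult_left_mono) auto
  also have "\<dots> = (1 + x\<^sup>2) / 2 - K + K * ln (2 * K)" using assms by (simp add: field_simps)
  finally show ?thesis using assms by argo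
qed

text \<open>Both terms on the left are wanted later: the absolute value makes the field integrable
  for measures of finite energy, the logarithm gives them a logarithmic moment.\<close>

lemma ext_field_lower_bound:
  assumes "0 \<le> \<alpha>"
  obtains C where "0 \<le> C" "\<And>x. x \<in> ext_field_dom \<alpha> \<Longrightarrow> \<bar>ext_field \<alpha> x\<bar> / 2 + ln (1 + x\<^sup>2) \<le> ext_field \<alpha> x + C"
proof
  \<comment> \<open>Twice \<alpha> + 1: \<alpha> pays for 2 \<alpha> ln x \<le> \<alpha> ln(1 +
    x^2), 1 for the logarithm to be absorbed, and the factor 2 for the part of the field spent on
    its absolute value.\<close>
  let ?K = "2 * \<alpha> + 2"
  define C where "C = 1 + ?K * ln (2 * ?K)"
  show "0 \<le> C" unfolding C_def using assms by (intro add_nonneg_nonneg mult_nonneg_nonneg) auto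
  fix x assume x: "x \<in> ext_field_dom \<alpha>"
  have l: "0 \<le> ln (1 + x\<^sup>2)" by simp
  have "2 * \<alpha> * ln x \<le> \<alpha> * ln (1 + x\<^sup>2)"
  proof (cases "\<alpha> = 0")
    case False
    then have "0 < x" using x assms by (auto simp: ext_field_dom_def)
    then have "2 * ln x = ln (x\<^sup>2)" by (simp add: ln_realpow)
    also have "\<dots> \<le> ln (1 + x\<^sup>2)" using \<open>0 < x\<close> by (subst ln_le_cancel_iff) (auto simp: add_pos_nonneg)
    finally show ?thesis using mult_left_mono[of "2 * ln x" "ln (1 + x\<^sup>2)" \<alpha>] assms by simp
  qed simp
  then have q: "x\<^sup>2 - \<alpha> * ln (1 + x\<^sup>2) \<le> ext_field \<alpha> x" by (simp add: ext_field_def)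
  have K: "2 * (\<alpha> * ln (1 + x\<^sup>2)) + 2 * ln (1 + x\<^sup>2) \<le> x\<^sup>2 / 2 + C"
    using ln_le_quadratic[of ?K x] assms unfolding C_def by (simp add: ring_distribs)
  have al: "0 \<le> \<alpha> * ln (1 + x\<^sup>2)" using assms l by simp
  show "\<bar>ext_field \<alpha> x\<bar> / 2 + ln (1 + x\<^sup>2) \<le> ext_field \<alpha> x + C"
    using q K al l zero_le_power2[of x] by linarith
qed

text \<open>The kernel contains half the field at each point, and \<open>ln_dist_le\<close> splits
  the logarithm in the same way, so half of the one-point bound is used at each of the two
  points.\<close>

lemma kern_lower_bound:
  assumes "0 \<le> \<alpha>"
  obtains C where "0 \<le> C" "\<And>p. fst p \<in> ext_field_dom \<alpha> \<Longrightarrow> snd p \<in> ext_field_dom \<alpha> \<Longrightarrow>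
     \<bar>ext_field \<alpha> (fst p)\<bar> / 4 + \<bar>ext_field \<alpha> (snd p)\<bar> / 4 \<le> kern \<alpha> p + C"
proof -
  obtain C where C: "0 \<le> C" "\<And>x. x \<in> ext_field_dom \<alpha> \<Longrightarrow> \<bar>ext_field \<alpha> x\<bar> / 2 + ln (1 + x\<^sup>2) \<le> ext_field \<alpha> x + C"
    using ext_field_lower_bound[OF assms] by blast
  show thesis
  proof
    show "0 \<le> C" by fact
    fix p :: "real \<times> real" assume p: "fst p \<in> ext_field_dom \<alpha>" "snd p \<in> ext_field_dom \<alpha>"
    show "\<bar>ext_field \<alpha> (fst p)\<bar> / 4 + \<bar>ext_field \<alpha> (snd p)\<bar> / 4 \<le> kern \<alpha> p + C"
      using C(2)[OF p(1)] C(2)[OF p(2)] ln_dist_le[of "fst p" "snd p"] unfolding kern_def by (simp add: field_simps)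
  qed
qed

lemma prob_on_real_distribution: "prob_on S \<nu> \<Longrightarrow> real_distribution \<nu>"
  unfolding prob_on_def by (auto intro!: real_distribution.intro real_distribution_axioms.intro dest: sets_eq_imp_space_eq)

context real_distribution
begin

interpretation MM: two_real_dist M M ..

lemma AE_pair_fst_snd:
  assumes "AE x in M. P x" and [measurable]: "Measurable.pred borel P"
  shows "AE p in M \<Otimes>\<^sub>M M. P (fst p) \<and> P (snd p)"
proof (rule MM.MN.AE_pair_measure)
  show "{x \<in> space (M \<Otimes>\<^sub>M M). P (fst x) \<and> P (snd x)} \<in> sets (M \<Otimes>\<^sub>M M)" by measurable
  show "AE x in M. AE y in M. P (fst (x, y)) \<and> P (snd (x, y))"
    using assms(1) by eventually_elim (use assms(1) in auto)
qed

lemma energy_eq: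
  assumes diag: "AE p in M \<Otimes>\<^sub>M M. fst p \<noteq> snd p" and dom: "AE x in M. x \<in> ext_field_dom \<alpha>"
    and kern: "integrable (M \<Otimes>\<^sub>M M) (kern \<alpha>)"
  shows "energy (Q_alpha \<alpha>) M = ereal (\<integral>p. kern \<alpha> p \<partial>(M \<Otimes>\<^sub>M M))"
proof -
  have ae: "AE p in M \<Otimes>\<^sub>M M. log_kernel (Q_alpha \<alpha>) p = ereal (kern \<alpha> p)"
    using diag AE_pair_fst_snd[OF dom pred_dom] by eventually_elim (auto simp: log_kernel_eq)
  have 1: "(\<integral>\<^sup>+ p. e2ennreal (log_kernel (Q_alpha \<alpha>) p) \<partial>(M \<Otimes>\<^sub>M M)) = (\<integral>\<^sup>+ p. ennreal (kern \<alpha> p) \<partial>(M \<Otimes>\<^sub>M M))"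
    using ae by (intro nn_integral_cong_AE) (auto simp: e2ennreal_ereal elim: eventually_mono)
  have 2: "(\<integral>\<^sup>+ p. e2ennreal (- log_kernel (Q_alpha \<alpha>) p) \<partial>(M \<Otimes>\<^sub>M M)) = (\<integral>\<^sup>+ p. ennreal (- kern \<alpha> p) \<partial>(M \<Otimes>\<^sub>M M))"
    using ae by (intro nn_integral_cong_AE) (auto simp: e2ennreal_ereal elim: eventually_mono)
  have fin: "(\<integral>\<^sup>+ p. ennreal (kern \<alpha> p) \<partial>(M \<Otimes>\<^sub>M M)) \<noteq> \<infinity>" "(\<integral>\<^sup>+ p. ennreal (- kern \<alpha> p) \<partial>(M \<Otimes>\<^sub>M M)) \<noteq> \<infinity>"
    using kern by (auto simp: real_integrable_def)
  have r: "enn2ereal a = ereal (enn2real a)" if "a \<noteq> \<infinity>" for a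
    using that by (cases a) (auto simp: enn2ereal_ennreal)
  show ?thesis
    unfolding energy_def 1 2 real_lebesgue_integral_def[OF kern] r[OF fin(1)] r[OF fin(2)] by simp
qed

text \<open>The kernel is bounded below, so the subtracted integral in \<open>energy\<close> is
  finite and finite energy bounds the other one. Since \<open>log_kernel\<close> is infinite on the
  diagonal and off the domain of the field, these sets are null, and real integrals take
  over.\<close>

lemma finite_energy:
  assumes "0 \<le> \<alpha>" and fin: "energy (Q_alpha \<alpha>) M \<noteq> \<infinity>"
  shows "AE p in M \<Otimes>\<^sub>M M. fst p \<noteq> snd p" and "AE x in M. x \<in> ext_field_dom \<alpha>"
    and "integrable (M \<Otimes>\<^sub>M M) (kern \<alpha>)"
    and "integrable M (ext_field \<alpha>)"
proof -
  obtain C where C: "0 \<le> C" "\<And>p. fst p \<in> ext_field_dom \<alpha> \<Longrightarrow> snd p \<in> ext_field_dom \<alpha> \<Longrightarrow>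
     \<bar>ext_field \<alpha> (fst p)\<bar> / 4 + \<bar>ext_field \<alpha> (snd p)\<bar> / 4 \<le> kern \<alpha> p + C"
    using kern_lower_bound[OF \<open>0 \<le> \<alpha>\<close>] by blast
  have neg_le: "e2ennreal (- log_kernel (Q_alpha \<alpha>) p) \<le> ennreal C" for p
  proof (cases "fst p \<noteq> snd p \<and> fst p \<in> ext_field_dom \<alpha> \<and> snd p \<in> ext_field_dom \<alpha>")
    case True
    then have "\<bar>ext_field \<alpha> (fst p)\<bar> / 4 + \<bar>ext_field \<alpha> (snd p)\<bar> / 4 \<le> kern \<alpha> p + C" using C(2)[of p] by simp
    moreover have "0 \<le> \<bar>ext_field \<alpha> (fst p)\<bar> / 4 + \<bar>ext_field \<alpha> (snd p)\<bar> / 4" by simp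
    ultimately have "0 \<le> kern \<alpha> p + C" by linarith
    then show ?thesis using True unfolding log_kernel_eq by (auto simp: e2ennreal_ereal intro!: ennreal_leI)
  next
    case False
    then show ?thesis unfolding log_kernel_eq by (auto simp: e2ennreal_neg)
  qed
  have neg: "(\<integral>\<^sup>+ p. e2ennreal (- log_kernel (Q_alpha \<alpha>) p) \<partial>(M \<Otimes>\<^sub>M M)) \<le> ennreal C"
    using nn_integral_mono[of "M \<Otimes>\<^sub>M M", OF neg_le] by (simp add: MM.MN.emeasure_space_1)
  then have "(\<integral>\<^sup>+ p. e2ennreal (- log_kernel (Q_alpha \<alpha>) p) \<partial>(M \<Otimes>\<^sub>M M)) \<noteq> \<top>"
    by (auto simp: top_unique)
  then have pos: "(\<integral>\<^sup>+ p. e2ennreal (log_kernel (Q_alpha \<alpha>) p) \<partial>(M \<Otimes>\<^sub>M M)) \<noteq> \<infinity>"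
    using fin unfolding energy_def by (auto simp: top_ereal_def)
  have "AE p in M \<Otimes>\<^sub>M M. e2ennreal (log_kernel (Q_alpha \<alpha>) p) \<noteq> \<infinity>"
    by (rule nn_integral_PInf_AE[OF _ pos]) measurable
  then have ae: "AE p in M \<Otimes>\<^sub>M M. fst p \<noteq> snd p \<and> fst p \<in> ext_field_dom \<alpha> \<and> snd p \<in> ext_field_dom \<alpha>"
    by eventually_elim (auto simp: log_kernel_eq split: if_splits)
  then show "AE p in M \<Otimes>\<^sub>M M. fst p \<noteq> snd p" by eventually_elim auto
  have "AE x in M. AE y in M. x \<in> ext_field_dom \<alpha>"
    using MM.MN.AE_pair[OF ae] by (rule eventually_mono) (auto elim: eventually_mono)
  then show dom: "AE x in M. x \<in> ext_field_dom \<alpha>" by simp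
  have aek: "AE p in M \<Otimes>\<^sub>M M. log_kernel (Q_alpha \<alpha>) p = ereal (kern \<alpha> p)"
    using ae by eventually_elim (auto simp: log_kernel_eq)
  have 1: "(\<integral>\<^sup>+ p. e2ennreal (log_kernel (Q_alpha \<alpha>) p) \<partial>(M \<Otimes>\<^sub>M M)) = (\<integral>\<^sup>+ p. ennreal (kern \<alpha> p) \<partial>(M \<Otimes>\<^sub>M M))"
    using aek by (intro nn_integral_cong_AE) (auto simp: e2ennreal_ereal elim: eventually_mono)
  have 2: "(\<integral>\<^sup>+ p. e2ennreal (- log_kernel (Q_alpha \<alpha>) p) \<partial>(M \<Otimes>\<^sub>M M)) = (\<integral>\<^sup>+ p. ennreal (- kern \<alpha> p) \<partial>(M \<Otimes>\<^sub>M M))"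
    using aek by (intro nn_integral_cong_AE) (auto simp: e2ennreal_ereal elim: eventually_mono)
  show k: "integrable (M \<Otimes>\<^sub>M M) (kern \<alpha>)"
    unfolding real_integrable_def
  proof (intro conjI)
    show "kern \<alpha> \<in> borel_measurable (M \<Otimes>\<^sub>M M)" by measurable
    show "(\<integral>\<^sup>+ p. ennreal (kern \<alpha> p) \<partial>(M \<Otimes>\<^sub>M M)) \<noteq> \<infinity>" using pos 1 by simp
    show "(\<integral>\<^sup>+ p. ennreal (- kern \<alpha> p) \<partial>(M \<Otimes>\<^sub>M M)) \<noteq> \<infinity>"
      using neg unfolding 2 by (auto simp: top_unique)
  qed
  \<comment> \<open>For one fixed good x the section of the kernel is integrable, and by the lower
    bound it dominates the field up to constants.\<close>
  have "AE x in M. integrable M (\<lambda>y. kern \<alpha> (x, y)) \<and> x \<in> ext_field_dom \<alpha>"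
    using MM.MN.AE_integrable_fst'[OF k] dom by eventually_elim auto
  from eventually_happens'[OF ae_filter_bot this]
  obtain x where x: "integrable M (\<lambda>y. kern \<alpha> (x, y))" "x \<in> ext_field_dom \<alpha>" by blast
  show "integrable M (ext_field \<alpha>)"
  proof (rule Bochner_Integration.integrable_bound)
    show "integrable M (\<lambda>y. 4 * (kern \<alpha> (x, y) + C))" using x(1) by simp
    show "AE y in M. norm (ext_field \<alpha> y) \<le> norm (4 * (kern \<alpha> (x, y) + C))"
      using dom
    proof eventually_elim
      case (elim y)
      have "0 \<le> \<bar>ext_field \<alpha> x\<bar>" by simp
      then have "\<bar>ext_field \<alpha> y\<bar> \<le> 4 * (kern \<alpha> (x, y) + C)"
        using C(2)[of "(x, y)"] elim x(2) by simp
      then show ?case by simp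
    qed
  qed measurable
qed

lemma integrable_pair_fst_snd:
  assumes "integrable M f"
  shows "integrable (M \<Otimes>\<^sub>M M) (\<lambda>p. f (fst p) :: real)" "integrable (M \<Otimes>\<^sub>M M) (\<lambda>p. f (snd p))"
    and "(\<integral>p. f (fst p) \<partial>(M \<Otimes>\<^sub>M M)) = (\<integral>x. f x \<partial>M)" "(\<integral>p. f (snd p) \<partial>(M \<Otimes>\<^sub>M M)) = (\<integral>x. f x \<partial>M)"
proof -
  have 1: "integrable (M \<Otimes>\<^sub>M M) (\<lambda>(x, y). f x)" "integrable (M \<Otimes>\<^sub>M M) (\<lambda>(x, y). f y)"
    using assms by (auto intro!: MM.MN.Fubini_integrable simp: prob_space)
  then show "integrable (M \<Otimes>\<^sub>M M) (\<lambda>p. f (fst p))" "integrable (M \<Otimes>\<^sub>M M) (\<lambda>p. f (snd p))"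
    by (simp_all add: split_beta')
  show "(\<integral>p. f (fst p) \<partial>(M \<Otimes>\<^sub>M M)) = (\<integral>x. f x \<partial>M)" "(\<integral>p. f (snd p) \<partial>(M \<Otimes>\<^sub>M M)) = (\<integral>x. f x \<partial>M)"
    using MM.MN.integral_fst'[OF 1(1)] MM.MN.integral_fst'[OF 1(2)]
    by (simp_all add: prob_space[simplified] split_beta')
qed

lemma integral_kern:
  assumes f: "integrable M (ext_field \<alpha>)"
  shows "integrable (M \<Otimes>\<^sub>M M) (kern \<alpha>) \<longleftrightarrow> integrable (M \<Otimes>\<^sub>M M) (\<lambda>p. ln \<bar>fst p - snd p\<bar>)"
    and "integrable (M \<Otimes>\<^sub>M M) (\<lambda>p. ln \<bar>fst p - snd p\<bar>) \<Longrightarrow>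
      (\<integral>p. kern \<alpha> p \<partial>(M \<Otimes>\<^sub>M M)) = log_energy M M + (\<integral>x. ext_field \<alpha> x \<partial>M)"
proof -
  note i = integrable_pair_fst_snd[OF f]
  show "integrable (M \<Otimes>\<^sub>M M) (kern \<alpha>) \<longleftrightarrow> integrable (M \<Otimes>\<^sub>M M) (\<lambda>p. ln \<bar>fst p - snd p\<bar>)"
  proof
    assume k: "integrable (M \<Otimes>\<^sub>M M) (kern \<alpha>)"
    have "ln \<bar>fst p - snd p\<bar> = ext_field \<alpha> (fst p) / 2 + ext_field \<alpha> (snd p) / 2 - kern \<alpha> p" for p
      by (simp add: kern_def)
    then show "integrable (M \<Otimes>\<^sub>M M) (\<lambda>p. ln \<bar>fst p - snd p\<bar>)" using k i by simp
  next
    assume "integrable (M \<Otimes>\<^sub>M M) (\<lambda>p. ln \<bar>fst p - snd p\<bar>)"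
    then show "integrable (M \<Otimes>\<^sub>M M) (kern \<alpha>)" unfolding kern_def[abs_def] using i by simp
  qed
  assume "integrable (M \<Otimes>\<^sub>M M) (\<lambda>p. ln \<bar>fst p - snd p\<bar>)"
  then show "(\<integral>p. kern \<alpha> p \<partial>(M \<Otimes>\<^sub>M M)) = log_energy M M + (\<integral>x. ext_field \<alpha> x \<partial>M)"
    unfolding kern_def[abs_def] log_energy_def using i by simp
qed

end

section \<open>Potentials bounded above and a sufficient condition for minimality\<close>

definition potential :: "real measure \<Rightarrow> real \<Rightarrow> real" where
  "potential \<mu> x = (\<integral>y. - ln \<bar>x - y\<bar> \<partial>\<mu>)"

text \<open>What a candidate must satisfy so that its mixed energy with every measure having a
  logarithmic moment is finite. Only an upper bound on the potential is asked for: from below it is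
  controlled by \<open>ln_dist_le\<close>.\<close>

locale bounded_potential = real_distribution \<mu> for \<mu> +
  fixes C :: real
  assumes integrable_log: "\<And>x. integrable \<mu> (\<lambda>y. ln \<bar>x - y\<bar>)"
    and potential_le: "\<And>x. potential \<mu> x \<le> C"
    and no_atom: "\<And>x. AE y in \<mu>. y \<noteq> x"
    and log_moment: "integrable \<mu> (\<lambda>y. ln (1 + y\<^sup>2))"
begin

lemma mixed_log_energy:
  assumes "real_distribution \<nu>" and lm: "integrable \<nu> (\<lambda>y. ln (1 + y\<^sup>2))"
  shows "integrable (\<nu> \<Otimes>\<^sub>M \<mu>) (\<lambda>p. ln \<bar>fst p - snd p\<bar>)"
    and "AE p in \<nu> \<Otimes>\<^sub>M \<mu>. fst p \<noteq> snd p"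
    and "integrable \<nu> (potential \<mu>)"
    and "log_energy \<nu> \<mu> = (\<integral>x. potential \<mu> x \<partial>\<nu>)"
proof -
  interpret N: real_distribution \<nu> by fact
  interpret NM: two_real_dist \<nu> \<mu> ..
  let ?c = "\<integral>y. ln (1 + y\<^sup>2) \<partial>\<mu>"
  have bound: "(\<integral>y. \<bar>ln \<bar>x - y\<bar>\<bar> \<partial>\<mu>) \<le> ln (1 + x\<^sup>2) + ?c + C" for x
  proof -
    \<comment> \<open>If t \<le> A / 2 and A \<ge> 0, then \<bar>t\<bar> \<le> A - t. This replaces
      the absolute value by a quantity whose integral contains the potential.\<close>
    have "\<bar>ln \<bar>x - y\<bar>\<bar> \<le> (ln (1 + x\<^sup>2) + ln (1 + y\<^sup>2)) - ln \<bar>x - y\<bar>" for y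
      using ln_dist_le[of x y] by (auto simp: abs_if field_simps add_nonneg_nonneg)
    then have "(\<integral>y. \<bar>ln \<bar>x - y\<bar>\<bar> \<partial>\<mu>) \<le> (\<integral>y. (ln (1 + x\<^sup>2) + ln (1 + y\<^sup>2)) - ln \<bar>x - y\<bar> \<partial>\<mu>)"
      using integrable_log[of x] log_moment by (intro integral_mono) auto
    also have "\<dots> = ln (1 + x\<^sup>2) + ?c + potential \<mu> x"
      using integrable_log[of x] log_moment by (simp add: potential_def prob_space[simplified])
    finally show ?thesis using potential_le[of x] by simp
  qed
  show I: "integrable (\<nu> \<Otimes>\<^sub>M \<mu>) (\<lambda>p. ln \<bar>fst p - snd p\<bar>)"
  proof (rule NM.MN.Fubini_integrable)
    show "(\<lambda>p. ln \<bar>fst p - snd p\<bar>) \<in> borel_measurable (\<nu> \<Otimes>\<^sub>M \<mu>)" by measurable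
    show "AE x in \<nu>. integrable \<mu> (\<lambda>y. ln \<bar>fst (x, y) - snd (x, y)\<bar>)" using integrable_log by simp
    show "integrable \<nu> (\<lambda>x. \<integral>y. norm (ln \<bar>fst (x, y) - snd (x, y)\<bar>) \<partial>\<mu>)"
    proof (rule Bochner_Integration.integrable_bound)
      show "integrable \<nu> (\<lambda>x. ln (1 + x\<^sup>2) + ?c + C)" using lm by simp
      show "(\<lambda>x. \<integral>y. norm (ln \<bar>fst (x, y) - snd (x, y)\<bar>) \<partial>\<mu>) \<in> borel_measurable \<nu>" by measurable
      show "AE x in \<nu>. norm (\<integral>y. norm (ln \<bar>fst (x, y) - snd (x, y)\<bar>) \<partial>\<mu>) \<le> norm (ln (1 + x\<^sup>2) + ?c + C)"
      proof (rule AE_I2)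
        fix x
        have "0 \<le> (\<integral>y. \<bar>ln \<bar>x - y\<bar>\<bar> \<partial>\<mu>)" by simp
        then show "norm (\<integral>y. norm (ln \<bar>fst (x, y) - snd (x, y)\<bar>) \<partial>\<mu>) \<le> norm (ln (1 + x\<^sup>2) + ?c + C)"
          using bound[of x] by simp
      qed
    qed
  qed
  show "AE p in \<nu> \<Otimes>\<^sub>M \<mu>. fst p \<noteq> snd p"
  proof (rule NM.MN.AE_pair_measure)
    show "{p \<in> space (\<nu> \<Otimes>\<^sub>M \<mu>). fst p \<noteq> snd p} \<in> sets (\<nu> \<Otimes>\<^sub>M \<mu>)" by measurable
    show "AE x in \<nu>. AE y in \<mu>. fst (x, y) \<noteq> snd (x, y)"
    proof (rule AE_I2)
      fix x show "AE y in \<mu>. fst (x, y) \<noteq> snd (x, y)" using no_atom[of x] by eventually_elim auto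
    qed
  qed
  have I': "integrable (\<nu> \<Otimes>\<^sub>M \<mu>) (\<lambda>p. - ln \<bar>fst p - snd p\<bar>)" using I by simp
  show "integrable \<nu> (potential \<mu>)"
    using NM.MN.integrable_fst'[OF I'] unfolding potential_def[abs_def] by simp
  show "log_energy \<nu> \<mu> = (\<integral>x. potential \<mu> x \<partial>\<nu>)"
    using NM.MN.integral_fst'[OF I'] unfolding potential_def[abs_def] log_energy_def by simp
qed

text \<open>Integrating the equality against \<mu> and the inequality against \<nu> gives l = 2
  J(\<mu>,\<mu>) + int Q d\<mu> and l \<le> 2 J(\<nu>,\<mu>) + int Q d\<nu>. Hence E(\<nu>) -
  E(\<mu>) is at least J(\<nu>,\<nu>) + J(\<mu>,\<mu>) - 2 J(\<nu>,\<mu>), which is nonnegative and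
  vanishes only for \<nu> = \<mu>. Uniqueness comes out of the same estimate, as the definite
  description requires.\<close>

theorem equilibrium_measureI:
  assumes \<alpha>: "0 \<le> \<alpha>" and K: "AE x in \<mu>. x \<in> K" "K \<subseteq> S" "K \<subseteq> ext_field_dom \<alpha>" and S: "S \<in> sets borel"
    and f: "integrable \<mu> (ext_field \<alpha>)"
    and eq: "\<And>x. x \<in> K \<Longrightarrow> 2 * potential \<mu> x + ext_field \<alpha> x = l"
    and ge: "\<And>x. x \<in> S \<Longrightarrow> x \<in> ext_field_dom \<alpha> \<Longrightarrow> l \<le> 2 * potential \<mu> x + ext_field \<alpha> x"
  shows "equilibrium_measure S (Q_alpha \<alpha>) = \<mu>"
proof -
  have rm: "real_distribution \<mu>" ..
  note mm = mixed_log_energy[OF rm log_moment]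
  have domm: "AE x in \<mu>. x \<in> ext_field_dom \<alpha>" using K(1) by eventually_elim (use K in auto)
  have km: "integrable (\<mu> \<Otimes>\<^sub>M \<mu>) (kern \<alpha>)" using integral_kern(1)[OF f] mm(1) by simp
  have em: "energy (Q_alpha \<alpha>) \<mu> = ereal (log_energy \<mu> \<mu> + (\<integral>x. ext_field \<alpha> x \<partial>\<mu>))"
    using energy_eq[OF mm(2) domm km] integral_kern(2)[OF f mm(1)] by simp
  have prob: "prob_on S \<mu>"
    unfolding prob_on_def
  proof (intro conjI)
    have "AE x in \<mu>. x \<in> S" using K(1) by eventually_elim (use K in auto)
    then show "emeasure \<mu> S = 1" using S by (intro emeasure_eq_1_AE) auto
  qed (auto intro: prob_space_axioms)
  have "(\<integral>x. 2 * potential \<mu> x + ext_field \<alpha> x \<partial>\<mu>) = (\<integral>x. l \<partial>\<mu>)"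
  proof (rule integral_cong_AE)
    have [measurable]: "potential \<mu> \<in> borel_measurable \<mu>" using mm(3) by auto
    show "(\<lambda>x. 2 * potential \<mu> x + ext_field \<alpha> x) \<in> borel_measurable \<mu>" by measurable
    show "AE x in \<mu>. 2 * potential \<mu> x + ext_field \<alpha> x = l" using K(1) by eventually_elim (use eq in auto)
  qed simp
  then have eqm: "2 * log_energy \<mu> \<mu> + (\<integral>x. ext_field \<alpha> x \<partial>\<mu>) = l"
    using mm(3,4) f by (simp add: prob_space[simplified])
  have key: "energy (Q_alpha \<alpha>) \<mu> \<le> energy (Q_alpha \<alpha>) \<nu> \<and> (energy (Q_alpha \<alpha>) \<nu> \<le> energy (Q_alpha \<alpha>) \<mu> \<longrightarrow> \<nu> = \<mu>)"
    if nu: "prob_on S \<nu>" for \<nu>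
  proof (cases "energy (Q_alpha \<alpha>) \<nu> = \<infinity>")
    case True
    then show ?thesis using em by simp
  next
    case False
    have rn: "real_distribution \<nu>" using nu by (rule prob_on_real_distribution)
    interpret N: real_distribution \<nu> by fact
    note fin = N.finite_energy[OF \<alpha> False]
    have ln: "integrable (\<nu> \<Otimes>\<^sub>M \<nu>) (\<lambda>p. ln \<bar>fst p - snd p\<bar>)"
      using N.integral_kern(1)[OF fin(4)] fin(3) by simp
    have en: "energy (Q_alpha \<alpha>) \<nu> = ereal (log_energy \<nu> \<nu> + (\<integral>x. ext_field \<alpha> x \<partial>\<nu>))"
      using N.energy_eq[OF fin(1-3)] N.integral_kern(2)[OF fin(4) ln] by simp
    obtain C' where C': "\<And>x. x \<in> ext_field_dom \<alpha> \<Longrightarrow> \<bar>ext_field \<alpha> x\<bar> / 2 + ln (1 + x\<^sup>2) \<le> ext_field \<alpha> x + C'"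
      using ext_field_lower_bound[OF \<alpha>] by blast
    have lm: "integrable \<nu> (\<lambda>y. ln (1 + y\<^sup>2))"
    proof (rule Bochner_Integration.integrable_bound)
      show "integrable \<nu> (\<lambda>x. ext_field \<alpha> x + C')" using fin(4) by simp
      show "AE x in \<nu>. norm (ln (1 + x\<^sup>2)) \<le> norm (ext_field \<alpha> x + C')"
        using fin(2)
      proof eventually_elim
        case (elim x)
        have "0 \<le> \<bar>ext_field \<alpha> x\<bar>" "0 \<le> ln (1 + x\<^sup>2)" by auto
        then show ?case using C'[OF elim] by simp
      qed
    qed measurable
    note nm = mixed_log_energy[OF rn lm]
    have "AE x in \<nu>. x \<in> S"
      using nu S unfolding prob_on_def by (intro N.AE_in_set_eq_1[THEN iffD2]) (auto simp: N.emeasure_eq_measure)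
    then have "AE x in \<nu>. l \<le> 2 * potential \<mu> x + ext_field \<alpha> x"
      using fin(2) by eventually_elim (use ge in auto)
    then have "(\<integral>x. l \<partial>\<nu>) \<le> (\<integral>x. 2 * potential \<mu> x + ext_field \<alpha> x \<partial>\<nu>)"
      using nm(3) fin(4) by (intro integral_mono_AE) auto
    then have gen: "l \<le> 2 * log_energy \<nu> \<mu> + (\<integral>x. ext_field \<alpha> x \<partial>\<nu>)"
      using nm(3,4) fin(4) by (simp add: N.prob_space[simplified])
    note pd = log_energy_positive[OF rn rm ln mm(1) nm(1) fin(1) mm(2) nm(2), folded log_energy_def]
    show ?thesis
      unfolding em en using pd gen eqm by auto
  qed
  show ?thesis
    unfolding equilibrium_measure_def
  proof (rule the_equality)
    show "prob_on S \<mu> \<and> (\<forall>\<nu>. prob_on S \<nu> \<longrightarrow> energy (Q_alpha \<alpha>) \<mu> \<le> energy (Q_alpha \<alpha>) \<nu>)"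
      using prob key by blast
    fix \<nu> assume "prob_on S \<nu> \<and> (\<forall>\<nu>'. prob_on S \<nu>' \<longrightarrow> energy (Q_alpha \<alpha>) \<nu> \<le> energy (Q_alpha \<alpha>) \<nu>')"
    then show "\<nu> = \<mu>" using prob key by blast
  qed
qed

end

section \<open>Logarithmic potentials on the circle\<close>

definition poisson :: "real \<Rightarrow> real \<Rightarrow> real" where
  "poisson p t = (1 - p\<^sup>2) / (1 - 2 * p * cos t + p\<^sup>2)"

definition trig_poisson :: "real \<Rightarrow> real \<Rightarrow> real \<Rightarrow> real \<Rightarrow> real \<Rightarrow> real \<Rightarrow> real" where
  "trig_poisson c0 c1 c2 d p t = c0 + c1 * cos t + c2 * cos (2 * t) + d * poisson p t"

lemma poisson_denom_pos:
  fixes p t :: real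
  assumes p: "\<bar>p\<bar> < 1"
  shows "0 < 1 - 2 * p * cos t + p\<^sup>2"
proof -
  have "p * cos t \<le> \<bar>p * cos t\<bar>" by (rule abs_ge_self)
  also have "\<dots> \<le> \<bar>p\<bar>" using mult_left_mono[of "\<bar>cos t\<bar>" 1 "\<bar>p\<bar>"] by (simp add: abs_mult)
  finally have "1 - 2 * p * cos t + p\<^sup>2 \<ge> (1 - \<bar>p\<bar>)\<^sup>2" by (simp add: power2_eq_square algebra_simps)
  moreover have "0 < (1 - \<bar>p\<bar>)\<^sup>2" using p by simp
  ultimately show ?thesis by linarith
qed

lemma cauchy_circle:
  fixes F :: "complex \<Rightarrow> complex"
  assumes "F holomorphic_on cball 0 1" "norm w < 1"
  shows "((\<lambda>t. F (cis t) * cis t / (cis t - w)) has_integral 2 * pi * F w) {0..2*pi}"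
proof -
  have "((\<lambda>u. F u / (u - w)) has_contour_integral (2 * of_real pi * \<i> * F w)) (circlepath 0 1)"
    using assms by (intro Cauchy_integral_circlepath_simple) auto
  then have "((\<lambda>t. F (0 + of_real 1 * cis t) / (0 + of_real 1 * cis t - w) * of_real 1 * \<i> * cis t)
      has_integral (2 * of_real pi * \<i> * F w)) {0..2*pi}"
    unfolding circlepath_def by (subst (asm) has_contour_integral_part_circlepath_iff) auto
  from has_integral_mult_right[OF this, of "- \<i>"] show ?thesis
    by (simp add: algebra_simps)
qed

lemma cauchy_circle_deriv:
  fixes F :: "complex \<Rightarrow> complex"
  assumes "F holomorphic_on cball 0 1"
  shows "((\<lambda>t. F (cis t) * cis (- (real k * t))) has_integral 2 * pi * (deriv ^^ k) F 0 / fact k) {0..2*pi}"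
proof -
  have "((\<lambda>u. F u / (u - 0) ^ Suc k) has_contour_integral ((2 * pi * \<i>) / fact k * (deriv ^^ k) F 0)) (circlepath 0 1)"
    using assms by (intro Cauchy_has_contour_integral_higher_derivative_circlepath)
      (auto intro: holomorphic_on_imp_continuous_on holomorphic_on_subset)
  then have "((\<lambda>t. F (0 + of_real 1 * cis t) / (0 + of_real 1 * cis t - 0) ^ Suc k * of_real 1 * \<i> * cis t)
      has_integral ((2 * pi * \<i>) / fact k * (deriv ^^ k) F 0)) {0..2*pi}"
    unfolding circlepath_def by (subst (asm) has_contour_integral_part_circlepath_iff) auto
  from has_integral_mult_right[OF this, of "- \<i>"]
  have *: "((\<lambda>t. - \<i> * (F (cis t) / cis t ^ Suc k * \<i> * cis t)) has_integral 2 * pi * (deriv ^^ k) F 0 / fact k) {0..2*pi}"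
    by (simp add: algebra_simps)
  have "- \<i> * (F (cis t) / cis t ^ Suc k * \<i> * cis t) = F (cis t) * cis (- (real k * t))" for t
  proof -
    have c: "cis (- (real k * t)) = inverse (cis t ^ k)" by (simp only: Complex.DeMoivre cis_inverse)
    have "- \<i> * (a / z ^ Suc k * \<i> * z) = a * inverse (z ^ k)" if "z \<noteq> 0" for a z :: complex
      using that by (simp add: field_simps)
    from this[of "cis t"] show ?thesis unfolding c by simp
  qed
  with * show ?thesis by simp
qed

text \<open>On the circle cos(nt) is the mean of z^n and z^(-n): against F the first integrates to 0
  for n > 0 and the second extracts a Taylor coefficient at 0. The Poisson kernel reproduces the
  value at p.\<close>

lemma holomorphic_trig_poisson:
  fixes F :: "complex \<Rightarrow> complex"
  assumes F: "F holomorphic_on cball 0 1" and p: "\<bar>p\<bar> < 1"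
  shows "((\<lambda>t. F (cis t) * of_real (trig_poisson c0 c1 c2 d p t)) has_integral
     2 * pi * (c0 * F 0 + c1 / 2 * deriv F 0 + c2 / 4 * (deriv ^^ 2) F 0 + d * F (of_real p))) {0..2*pi}"
proof -
  have sub: "((\<lambda>t. F (cis t)) has_integral 2 * pi * F 0) {0..2*pi}"
    using cauchy_circle_deriv[OF F, of 0] by simp
  have cosn: "((\<lambda>t. F (cis t) * of_real (cos (real n * t))) has_integral pi * (deriv ^^ n) F 0 / fact n) {0..2*pi}"
    if "0 < n" for n
  proof -
    have G: "(\<lambda>z. F z * z ^ n) holomorphic_on cball 0 1" using F by (intro holomorphic_intros)
    have 1: "((\<lambda>t. F (cis t) * cis t ^ n) has_integral 0) {0..2*pi}"
      using cauchy_circle[OF G, of 0] that by (simp add: zero_power)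
    have 2: "((\<lambda>t. (F (cis t) * cis t ^ n + F (cis t) * cis (- (real n * t))) / 2) has_integral
      (0 + 2 * pi * (deriv ^^ n) F 0 / fact n) / 2) {0..2*pi}"
      by (intro has_integral_divide has_integral_add 1 cauchy_circle_deriv F)
    have "(F (cis t) * cis t ^ n + F (cis t) * cis (- (real n * t))) / 2 = F (cis t) * of_real (cos (real n * t))" for t
    proof -
      have "cis (real n * t) + cis (- (real n * t)) = 2 * of_real (cos (real n * t))"
        by (simp add: complex_eq_iff)
      then show ?thesis by (simp add: Complex.DeMoivre distrib_left[symmetric])
    qed
    with 2 show ?thesis by simp
  qed
  have pois: "((\<lambda>t. F (cis t) * of_real (poisson p t)) has_integral 2 * pi * F (of_real p)) {0..2*pi}"
  proof -
    have nz: "1 - of_real p * z \<noteq> 0" if "norm z \<le> 1" for z :: complex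
    proof
      assume "1 - of_real p * z = 0"
      then have "norm (of_real p * z) = 1" by simp
      moreover have "norm (of_real p * z) \<le> \<bar>p\<bar> * 1" unfolding norm_mult using that by (intro mult_mono) auto
      ultimately show False using p by simp
    qed
    have G: "(\<lambda>z. F z * (of_real p * z / (1 - of_real p * z))) holomorphic_on cball 0 1"
      using F nz by (intro holomorphic_intros) auto
    have 1: "((\<lambda>t. F (cis t) * (of_real p * cis t / (1 - of_real p * cis t))) has_integral 0) {0..2*pi}"
      using cauchy_circle[OF G, of 0] by simp
    \<comment> \<open>The Poisson kernel is split as z / (z - p) + p z / (1 - p z). The first part
      is Cauchy's formula at p; the second is holomorphic on the closed disc and vanishes at
      0.\<close>
    have 2: "((\<lambda>t. F (cis t) * cis t / (cis t - of_real p) + F (cis t) * (of_real p * cis t / (1 - of_real p * cis t)))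
       has_integral 2 * pi * F (of_real p) + 0) {0..2*pi}"
      using p by (intro has_integral_add 1 cauchy_circle[OF F]) simp
    have "F (cis t) * cis t / (cis t - of_real p) + F (cis t) * (of_real p * cis t / (1 - of_real p * cis t))
        = F (cis t) * of_real (poisson p t)" for t
    proof -
      let ?z = "cis t"
      have a: "?z - of_real p \<noteq> 0"
      proof
        assume "?z - of_real p = 0"
        then have "norm ?z = norm (of_real p :: complex)" by simp
        then show False using p by simp
      qed
      have b: "1 - of_real p * ?z \<noteq> 0" using nz[of ?z] by simp
      have c: "?z * of_real (1 - 2 * p * cos t + p\<^sup>2) = (?z - of_real p) * (1 - of_real p * ?z)"
      proof -
        have s: "(sin t)\<^sup>2 = 1 - (cos t)\<^sup>2" by (simp add: sin_squared_eq)
        show ?thesis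
          by (auto simp: complex_eq_iff algebra_simps power2_eq_square s[unfolded power2_eq_square])
      qed
      have d: "of_real (1 - 2 * p * cos t + p\<^sup>2) \<noteq> (0::complex)"
        using poisson_denom_pos[OF p, of t] by (metis less_irrefl of_real_eq_0_iff)
      have "?z / (?z - of_real p) + of_real p * ?z / (1 - of_real p * ?z)
         = ?z * (1 - of_real p ^ 2) / ((?z - of_real p) * (1 - of_real p * ?z))"
        using a b by (simp add: divide_simps) (simp add: algebra_simps power2_eq_square)
      also have "\<dots> = of_real (poisson p t)"
        unfolding c[symmetric] poisson_def using d by (simp add: divide_simps)
      finally show ?thesis by (metis (no_types, lifting) distrib_left times_divide_eq_right)
    qed
    with 2 show ?thesis by simp
  qed
  have "((\<lambda>t. of_real c0 * F (cis t) + of_real c1 * (F (cis t) * of_real (cos (real 1 * t)))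
       + of_real c2 * (F (cis t) * of_real (cos (real 2 * t))) + of_real d * (F (cis t) * of_real (poisson p t))) has_integral
     of_real c0 * (2 * pi * F 0) + of_real c1 * (pi * (deriv ^^ 1) F 0 / fact 1) + of_real c2 * (pi * (deriv ^^ 2) F 0 / fact 2)
       + of_real d * (2 * pi * F (of_real p))) {0..2*pi}"
    by (intro has_integral_add has_integral_mult_right sub cosn pois) auto
  then show ?thesis
    by (simp add: trig_poisson_def algebra_simps)
qed

lemma Re_one_minus_pos:
  assumes "norm u < 1" "norm z \<le> 1"
  shows "0 < Re (1 - u * z)"
proof -
  have "Re (u * z) \<le> norm (u * z)" by (rule complex_Re_le_cmod)
  also have "\<dots> \<le> norm u * 1" unfolding norm_mult using assms by (intro mult_left_mono) auto
  finally show ?thesis using assms by simp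
qed

text \<open>The mean of ln \<bar>1 - u exp(i t)\<bar> against \<open>trig_poisson\<close>. The
  coefficient \<open>c0\<close> is absent because the logarithm vanishes at the centre of the
  disc.\<close>

definition circle_log_potential :: "real \<Rightarrow> real \<Rightarrow> real \<Rightarrow> real \<Rightarrow> complex \<Rightarrow> real" where
  "circle_log_potential c1 c2 d p u = - c1 / 2 * Re u - c2 / 4 * Re (u\<^sup>2) + d * ln (cmod (1 - of_real p * u))"

text \<open>Real part of the preceding formula for the holomorphic function Ln(1 - u z), whose first
  two derivatives at 0 are -u and -u^2. For \<bar>u\<bar> < 1 the values 1 - u z stay in the right
  half-plane, off the branch cut.\<close>

lemma log_trig_poisson:
  assumes u: "norm u < 1" and p: "\<bar>p\<bar> < 1"
  shows "((\<lambda>t. ln (cmod (1 - u * cis t)) * trig_poisson c0 c1 c2 d p t) has_integral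
     2 * pi * circle_log_potential c1 c2 d p u) {0..2*pi}"
proof -
  let ?L = "\<lambda>z. Ln (1 - u * z)"
  have nn: "1 - u * z \<notin> \<real>\<^sub>\<le>\<^sub>0" if "norm z \<le> 1" for z
    using Re_one_minus_pos[OF u that] by (auto simp: complex_nonpos_Reals_iff)
  have L: "?L holomorphic_on cball 0 1"
    using nn by (intro holomorphic_intros) auto
  have D: "(?L has_field_derivative - u / (1 - u * z)) (at z)" if "norm z \<le> 1" for z
    using nn[OF that] by (auto intro!: derivative_eq_intros simp: field_simps)
  have d1: "deriv ?L z = - u / (1 - u * z)" if "norm z \<le> 1" for z
    using D[OF that] by (rule DERIV_imp_deriv)
  have "deriv (deriv ?L) 0 = deriv (\<lambda>z. - u / (1 - u * z)) 0"
  proof (rule deriv_cong_ev)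
    have "eventually (\<lambda>z. z \<in> ball 0 1) (nhds (0::complex))" by (intro eventually_nhds_in_open) auto
    then show "\<forall>\<^sub>F z in nhds 0. deriv ?L z = - u / (1 - u * z)"
      by eventually_elim (use d1 in auto)
  qed simp
  also have "\<dots> = - (u\<^sup>2)"
    by (rule DERIV_imp_deriv) (auto intro!: derivative_eq_intros simp: power2_eq_square)
  finally have d2: "(deriv ^^ 2) ?L 0 = - (u\<^sup>2)" by (simp add: numeral_2_eq_2)
  have "Re (?L (cis t) * of_real x) = ln (cmod (1 - u * cis t)) * x" for t x
    using nn[of "cis t"] by (subst Re_complex_of_real[symmetric, of x], simp) (metis Re_Ln nonpos_Reals_zero_I)
  moreover have "Re (2 * pi * (c0 * ?L 0 + c1 / 2 * deriv ?L 0 + c2 / 4 * (deriv ^^ 2) ?L 0 + d * ?L (of_real p)))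
     = 2 * pi * circle_log_potential c1 c2 d p u"
  proof -
    have "Re (?L (of_real p)) = ln (cmod (1 - u * of_real p))"
      using nn[of "of_real p"] p by (intro Re_Ln) auto
    then show ?thesis unfolding d2 d1[of 0, simplified] circle_log_potential_def
      by (simp add: mult.commute[of u])
  qed
  ultimately show ?thesis
    using has_integral_linear[OF holomorphic_trig_poisson[OF L p, of c0 c1 c2 d] bounded_linear_Re]
    by (simp only: o_def of_real_divide of_real_numeral)
qed

lemma trig_poisson_mass:
  assumes p: "\<bar>p\<bar> < 1"
  shows "(trig_poisson c0 c1 c2 d p has_integral 2 * pi * (c0 + d)) {0..2*pi}"
  using has_integral_linear[OF holomorphic_trig_poisson[of "\<lambda>_. 1 :: complex", OF _ p, of c0 c1 c2 d] bounded_linear_Re]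
  by (simp add: o_def numeral_2_eq_2)

lemma trig_poisson_continuous: "\<bar>p\<bar> < 1 \<Longrightarrow> continuous_on A (trig_poisson c0 c1 c2 d p)"
  unfolding trig_poisson_def[abs_def] poisson_def
  using poisson_denom_pos[of p] by (intro continuous_intros) (auto simp: less_imp_neq[symmetric])

lemma trig_poisson_measurable[measurable]: "trig_poisson c0 c1 c2 d p \<in> borel_measurable borel"
  unfolding trig_poisson_def[abs_def] poisson_def by measurable

section \<open>Probability measures on the circle and their logarithmic integrals\<close>

locale circle_density =
  fixes c0 c1 c2 d p :: real
  assumes p: "\<bar>p\<bar> < 1" and mass: "pi * (c0 + d) = 1"
    and nonneg: "\<And>t. 0 \<le> trig_poisson c0 c1 c2 d p t"
begin

definition "h = trig_poisson c0 c1 c2 d p"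
abbreviation "V \<equiv> circle_log_potential c1 c2 d p"

text \<open>The factor 1/2 is there because t and 2 pi - t have the same cosine: the full circle
  covers the arc twice, and \<open>h\<close> is the density on one half of it.\<close>

definition circ :: "real measure" where
  "circ = density lborel (\<lambda>t. ennreal (indicator {0..2*pi} t * (h t / 2)))"

lemma h_nonneg: "0 \<le> h t" and h_measurable[measurable]: "h \<in> borel_measurable borel"
  and h_cont: "continuous_on A h"
  using nonneg trig_poisson_continuous[OF p] by (auto simp: h_def)

lemma sets_circ[measurable_cong, simp]: "sets circ = sets borel" and space_circ[simp]: "space circ = UNIV"
  by (auto simp: circ_def)

lemma circ_integral:
  assumes [measurable]: "f \<in> borel_measurable borel" and cont: "continuous_on {0..2*pi} f"
    and I: "((\<lambda>t. f t * h t) has_integral I) {0..2*pi}"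
  shows "integrable circ f" "(\<integral>t. f t \<partial>circ) = I / 2"
proof -
  have S: "set_integrable lborel {0..2*pi} (\<lambda>t. f t * h t)"
    using cont h_cont by (intro borel_integrable_atLeastAtMost' continuous_intros)
  have L: "(LINT t:{0..2*pi}|lborel. f t * h t) = I"
    using set_borel_integral_eq_integral(2)[OF S] I by (simp add: integral_unique)
  have e: "(indicator {0..2*pi} t * (h t / 2)) *\<^sub>R f t = (indicator {0..2*pi} t *\<^sub>R (f t * h t)) / 2" for t
    by simp
  have hm: "(\<lambda>t. indicator {0..2*pi} t * (h t / 2)) \<in> borel_measurable lborel" by measurable
  have hn: "AE t in lborel. 0 \<le> indicator {0..2*pi} t * (h t / 2)" using h_nonneg by auto
  show "integrable circ f"
    unfolding circ_def using S
    by (subst integrable_density[OF _ hm hn]) (simp_all only: e set_integrable_def integrable_divide assms(1) measurable_lborel1 measurable_lborel2)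
  show "(\<integral>t. f t \<partial>circ) = I / 2"
    unfolding circ_def
    by (subst integral_density[OF _ hm hn]) (simp_all only: e integral_divide_zero L[unfolded set_lebesgue_integral_def] assms(1) measurable_lborel1 measurable_lborel2)
qed

lemma circ_integrable_continuous:
  assumes [measurable]: "f \<in> borel_measurable borel" and cont: "continuous_on {0..2*pi} (f :: real \<Rightarrow> real)"
  shows "integrable circ f"
proof -
  have "(\<lambda>t. f t * h t) integrable_on {0..2*pi}"
    using cont h_cont by (intro integrable_continuous_interval continuous_intros)
  then show ?thesis using circ_integral(1)[OF assms] by (auto simp: integrable_on_def)
qed

lemma prob_space_circ: "prob_space circ"
proof -
  have "(h has_integral 2) {0..2*pi}"
    using trig_poisson_mass[OF p, of c0 c1 c2 d] mass by (simp add: h_def mult.assoc)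
  then have 1: "integrable circ (\<lambda>_. 1::real)" "(\<integral>t. 1 \<partial>circ) = (1::real)"
    using circ_integral[of "\<lambda>_. 1" 2] by auto
  then have "emeasure circ (space circ) = ennreal 1"
    using nn_integral_eq_integral[OF 1(1)] by simp
  then show ?thesis by (intro prob_spaceI) simp
qed

sublocale C: prob_space circ by (rule prob_space_circ)

lemma log_circ_interior:
  assumes "norm u < 1"
  shows "integrable circ (\<lambda>t. ln (cmod (1 - u * cis t)))"
    and "(\<integral>t. ln (cmod (1 - u * cis t)) \<partial>circ) = pi * V u"
proof -
  have nz: "1 - u * cis t \<noteq> 0" for t
  proof
    assume "1 - u * cis t = 0"
    then show False using Re_one_minus_pos[OF assms, of "cis t"] by (simp only: zero_complex.sel norm_cis) simp
  qed
  have c: "continuous_on A (\<lambda>t. ln (cmod (1 - u * cis t)))" for A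
    using nz by (intro continuous_intros) auto
  have m: "(\<lambda>t. ln (cmod (1 - u * cis t))) \<in> borel_measurable borel"
    by (rule borel_measurable_continuous_onI[OF c])
  show "integrable circ (\<lambda>t. ln (cmod (1 - u * cis t)))"
    "(\<integral>t. ln (cmod (1 - u * cis t)) \<partial>circ) = pi * V u"
    using circ_integral[OF m c, of "2 * pi * V u"] log_trig_poisson[OF assms p, of c0 c1 c2 d] by (auto simp: h_def)
qed

lemma circ_AE_nonzero: "AE t in circ. 1 - u * cis t \<noteq> 0"
proof -
  have "countable {t. 1 - u * cis t = 0}"
  proof (cases "\<exists>t0. 1 - u * cis t0 = 0")
    case True
    then obtain t0 where t0: "u * cis t0 = 1" by auto
    then have u: "u \<noteq> 0" by auto
    have "{t. 1 - u * cis t = 0} \<subseteq> range (\<lambda>n::int. t0 + of_int n * (2 * pi))"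
    proof
      fix t assume "t \<in> {t. 1 - u * cis t = 0}"
      then have "u * cis t = u * cis t0" using t0 by simp
      then have "cis t = cis t0" using u by simp
      then have "cis (t - t0) = 1" by (simp add: cis_divide[symmetric])
      then have "cos (t - t0) = 1" by (simp add: complex_eq_iff)
      then obtain n :: int where "t - t0 = of_int n * (2 * pi)" by (auto simp: cos_one_2pi_int)
      then show "t \<in> range (\<lambda>n::int. t0 + of_int n * (2 * pi))" by (intro range_eqI[of _ _ n]) simp
    qed
    then show ?thesis by (rule countable_subset) simp
  qed simp
  then have "{t. 1 - u * cis t = 0} \<in> null_sets lborel" by (rule countable_imp_null_set_lborel)
  then have "AE t in lborel. t \<notin> {t. 1 - u * cis t = 0}" by (rule AE_not_in)
  then show ?thesis
    unfolding circ_def by (subst AE_density) (auto elim: eventually_mono)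
qed

text \<open>For \<open>norm u = 1\<close> let \<open>u\<close> be approached radially: Fatou gives integrability, and then
  \<open>\<bar>1 - z\<bar> / 2 \<le> \<bar>1 - \<rho> z\<bar>\<close> gives a dominating function.\<close>

lemma log_circ:
  assumes "norm u \<le> 1"
  shows "integrable circ (\<lambda>t. ln (cmod (1 - u * cis t)))"
    and "(\<integral>t. ln (cmod (1 - u * cis t)) \<partial>circ) = pi * V u"
proof -
  \<comment> \<open>The shift by 2 keeps the radius positive already at n = 0.\<close>
  define r where "r n = 1 - 1 / real (n + 2)" for n
  have r: "0 < r n" "r n < 1" for n by (auto simp: r_def field_simps)
  have rlim: "r \<longlonglongrightarrow> 1" unfolding r_def by real_asymp
  have nu: "norm (of_real (r n) * u) < 1" for n
  proof -
    have "norm (of_real (r n) * u) = r n * norm u" using r[of n] by (simp add: norm_mult)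
    also have "\<dots> \<le> r n * 1" using r[of n] assms by (intro mult_left_mono) auto
    finally show ?thesis using r[of n] by simp
  qed
  let ?f = "\<lambda>t. ln (cmod (1 - u * cis t))"
  let ?g = "\<lambda>n t. ln (cmod (1 - (of_real (r n) * u) * cis t))"
  have [measurable]: "(\<lambda>t. cmod (1 - v * cis t)) \<in> borel_measurable borel" for v
    by (rule borel_measurable_continuous_onI) (intro continuous_intros)
  have le2: "cmod (1 - v * cis t) \<le> 2" if "norm v \<le> 1" for v t
    using norm_triangle_ineq4[of 1 "v * cis t"] that by (simp add: norm_mult)
  have lnle: "ln (cmod (1 - v * cis t)) \<le> ln 2" if "norm v \<le> 1" for v t
    using le2[OF that, of t] by (cases "1 - v * cis t = 0") auto
  \<comment> \<open>With z = u exp(i t), the numbers 1 - z and 1 - \<rho> z differ by (1 - \<rho>)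
    z, of norm at most 1 - \<rho>, and 1 - \<rho> is itself at most \<bar>1 - \<rho>
    z\<bar>.\<close>
  have low: "cmod (1 - u * cis t) / 2 \<le> cmod (1 - of_real (r n) * u * cis t)" for n t
  proof -
    let ?z = "u * cis t"
    have z: "norm ?z \<le> 1" using assms by (simp add: norm_mult)
    have "1 - ?z = (1 - of_real (r n) * ?z) - of_real (1 - r n) * ?z" by (simp add: algebra_simps)
    then have "cmod (1 - ?z) \<le> cmod (1 - of_real (r n) * ?z) + cmod (of_real (1 - r n) * ?z)"
      by (metis norm_triangle_ineq4)
    also have "cmod (of_real (1 - r n) * ?z) \<le> 1 - r n"
      using mult_left_mono[OF z, of "1 - r n"] r[of n] by (simp only: norm_mult norm_of_real) simp
    also have "1 - r n \<le> cmod (1 - of_real (r n) * ?z)"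
    proof -
      have "1 - cmod (of_real (r n) * ?z) \<le> cmod (1 - of_real (r n) * ?z)"
        using norm_triangle_ineq2[of 1 "of_real (r n) * ?z"] by simp
      moreover have "cmod (of_real (r n) * ?z) \<le> r n"
        using mult_left_mono[OF z, of "r n"] r[of n] by (simp only: norm_mult norm_of_real) simp
      ultimately show ?thesis by linarith
    qed
    finally show ?thesis by (simp add: mult.assoc)
  qed
  have Vlim: "(\<lambda>n. V (of_real (r n) * u)) \<longlonglongrightarrow> V u"
  proof -
    have "1 - of_real p * u \<noteq> 0"
    proof
      assume "1 - of_real p * u = 0"
      then have "norm (of_real p * u) = 1" by simp
      moreover have "norm (of_real p * u) \<le> \<bar>p\<bar> * 1" unfolding norm_mult using assms by (intro mult_mono) auto
      ultimately show False using p by simp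
    qed
    moreover have "(\<lambda>n. of_real (r n) * u) \<longlonglongrightarrow> of_real 1 * u"
      by (intro tendsto_intros rlim)
    ultimately show ?thesis
      unfolding circle_log_potential_def by (intro tendsto_intros) auto
  qed
  have glim: "AE t in circ. (\<lambda>n. ?g n t) \<longlonglongrightarrow> ?f t"
    using circ_AE_nonzero[of u]
  proof eventually_elim
    case (elim t)
    have "(\<lambda>n. 1 - (of_real (r n) * u) * cis t) \<longlonglongrightarrow> 1 - (of_real 1 * u) * cis t"
      by (intro tendsto_intros rlim)
    from tendsto_norm[OF this] show ?case using elim by (intro tendsto_ln) simp_all
  qed
  have bnd: "(\<integral>\<^sup>+t. ennreal (ln 2 - ?g n t) \<partial>circ) = ennreal (ln 2 - pi * V (of_real (r n) * u))" for n
  proof -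
    have nn: "0 \<le> ln 2 - ?g n t" for t using lnle[OF less_imp_le[OF nu[of n]], of t] by simp
    show ?thesis
      using log_circ_interior[OF nu[of n]] nn
      by (subst nn_integral_eq_integral) (auto simp: C.prob_space[simplified])
  qed
  have "(\<integral>\<^sup>+t. ennreal (ln 2 - ?f t) \<partial>circ) = (\<integral>\<^sup>+t. liminf (\<lambda>n. ennreal (ln 2 - ?g n t)) \<partial>circ)"
  proof (rule nn_integral_cong_AE)
    show "AE t in circ. ennreal (ln 2 - ?f t) = liminf (\<lambda>n. ennreal (ln 2 - ?g n t))"
      using glim
    proof eventually_elim
      case (elim t)
      then have "(\<lambda>n. ennreal (ln 2 - ?g n t)) \<longlonglongrightarrow> ennreal (ln 2 - ?f t)"
        by (rule tendsto_ennrealI[OF tendsto_diff[OF tendsto_const]])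
      then show ?case by (intro lim_imp_Liminf[symmetric]) auto
    qed
  qed
  also have "\<dots> \<le> liminf (\<lambda>n. \<integral>\<^sup>+t. ennreal (ln 2 - ?g n t) \<partial>circ)"
    by (intro nn_integral_liminf) simp
  also have "\<dots> = liminf (\<lambda>n. ennreal (ln 2 - pi * V (of_real (r n) * u)))" by (simp only: bnd)
  also have "\<dots> = ennreal (ln 2 - pi * V u)"
    by (intro lim_imp_Liminf tendsto_ennrealI tendsto_intros Vlim) simp
  also have "\<dots> < \<infinity>" by simp
  finally have fin: "(\<integral>\<^sup>+t. ennreal (ln 2 - ?f t) \<partial>circ) < \<infinity>" .
  have "integrable circ (\<lambda>t. ln 2 - ?f t)"
    using fin lnle[OF assms] by (intro integrableI_nonneg) auto
  from Bochner_Integration.integrable_diff[OF _ this, of "\<lambda>_. ln 2"]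
  show f: "integrable circ ?f" by simp
  have "(\<lambda>n. \<integral>t. ?g n t \<partial>circ) \<longlonglongrightarrow> (\<integral>t. ?f t \<partial>circ)"
  proof (rule integral_dominated_convergence)
    show "integrable circ (\<lambda>t. 2 * ln 2 + \<bar>?f t\<bar>)" using f by simp
    show "AE t in circ. norm (?g n t) \<le> 2 * ln 2 + \<bar>?f t\<bar>" for n
      using circ_AE_nonzero[of u]
    proof eventually_elim
      case (elim t)
      then have "ln (cmod (1 - u * cis t) / 2) \<le> ?g n t"
        using low[of t n] by (subst ln_le_cancel_iff) auto
      then have "?f t - ln 2 \<le> ?g n t" using elim by (simp add: ln_div)
      moreover have "?g n t \<le> ln 2" using lnle[OF less_imp_le[OF nu[of n]], of t] .
      moreover have "0 < ln (2::real)" by simp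
      ultimately show ?case unfolding real_norm_def by linarith
    qed
  qed (use glim in auto)
  moreover have "(\<lambda>n. \<integral>t. ?g n t \<partial>circ) \<longlonglongrightarrow> pi * V u"
    unfolding log_circ_interior(2)[OF nu] by (intro tendsto_intros Vlim)
  ultimately show "(\<integral>t. ?f t \<partial>circ) = pi * V u" by (rule LIMSEQ_unique)
qed

end

section \<open>Logarithmic potentials of arc measures\<close>

text \<open>The smaller root of v^2 - 2 X v + 1; the two roots have product 1.\<close>

lemma joukowski_real:
  fixes X :: real
  assumes "1 < X"
  obtains v where "0 < v" "v < 1" "v + 1 / v = 2 * X"
proof -
  define s where "s = sqrt (X\<^sup>2 - 1)"
  have "1 < X\<^sup>2" using one_less_power[OF assms, of 2] by simp
  then have s: "s\<^sup>2 = X\<^sup>2 - 1" "0 < s" by (auto simp: s_def)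
  have "s\<^sup>2 < X\<^sup>2" using s by simp
  then have v0: "0 < X - s" using power_less_imp_less_base[of s 2 X] assms by simp
  have "(X - s) * (X + s) = 1" using s by (simp add: power2_eq_square algebra_simps)
  then have inv: "1 / (X - s) = X + s" using v0 by (simp add: field_simps)
  have "1 < 1 / (X - s)" unfolding inv using s(2) assms by simp
  then have "X - s < 1" using v0 by simp
  with v0 inv show ?thesis by (intro that[of "X - s"]) auto
qed

text \<open>Points of [-1, 1] come from the unit circle by u = exp(i arccos X), all others from a
  real u inside the disc, with the sign of X.\<close>

lemma joukowski_cover:
  fixes X :: real
  obtains u :: complex where "u \<noteq> 0" "norm u \<le> 1" "u + 1 / u = of_real (2 * X)"
proof (cases "\<bar>X\<bar> \<le> 1")
  case True
  show ?thesis
  proof (rule that[of "cis (arccos X)"])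
    show "cis (arccos X) + 1 / cis (arccos X) = of_real (2 * X)"
      using True by (simp add: complex_eq_iff divide_inverse)
  qed auto
next
  case False
  then obtain v where v: "0 < v" "v < 1" "v + 1 / v = 2 * \<bar>X\<bar>"
    using joukowski_real[of "\<bar>X\<bar>"] by auto
  show ?thesis
  proof (rule that[of "of_real (sgn X * v)"])
    have sX: "sgn X * sgn X = 1" "sgn X \<noteq> 0" "\<bar>sgn X\<bar> = 1" using False by (auto simp: sgn_if split: if_splits)
    show "complex_of_real (sgn X * v) \<noteq> 0" using sX v by simp
    show "norm (complex_of_real (sgn X * v)) \<le> 1" using sX v by (simp only: norm_of_real abs_mult)
    have "1 / (sgn X * v) = sgn X * (1 / v)" using sX v by (simp add: field_simps)
    then have "sgn X * v + 1 / (sgn X * v) = sgn X * (v + 1 / v)" by (simp add: distrib_left)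
    also have "\<dots> = 2 * X" unfolding v by (simp add: sgn_if)
    finally show "complex_of_real (sgn X * v) + 1 / complex_of_real (sgn X * v) = of_real (2 * X)"
      by (metis of_real_1 of_real_add of_real_divide)
  qed
qed

text \<open>If \<open>\<alpha> > 0\<close>, the conditions on \<open>p\<close> and \<open>C\<close> say that \<open>x = C (1 - p u) (1 - p / u)\<close> for
  \<open>x = m - (r / 2) (u + 1 / u)\<close>, so that the \<open>ln x\<close> in the external field cancels against the
  Poisson part of the potential. If \<open>\<alpha> = 0\<close>, then \<open>p\<close> and \<open>C\<close> play no role.\<close>

locale arc =
  fixes \<alpha> m r p C :: real
  assumes \<alpha>: "0 \<le> \<alpha>" and r: "0 < r" and p0: "0 \<le> p" and p1: "p < 1"
    and C: "0 < C" and mC: "0 < \<alpha> \<Longrightarrow> m = C * (1 + p\<^sup>2)" and rC: "0 < \<alpha> \<Longrightarrow> r = 2 * C * p"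
begin

text \<open>The density times the square root of (b - x)(x - a). In the angle t the coefficients
  \<open>k1\<close>, \<open>k2\<close> cancel the cosines of x^2 in 2 U + Q, the Poisson kernel with
  weight \<open>k3\<close> cancels -2 \<alpha> ln x, and \<open>k0\<close> is then forced by total
  mass one.\<close>

definition H :: "real \<Rightarrow> real" where
  "H x = (1 + \<alpha> + r\<^sup>2 / 2 - x * (x - m) - \<alpha> * (C * (1 - p\<^sup>2) / x)) / pi"

definition "k0 = (1 + \<alpha>) / pi"
definition "k1 = m * r / pi"
definition "k2 = - (r\<^sup>2) / (2 * pi)"
definition "k3 = - \<alpha> / pi"

lemma H_measurable[measurable]: "H \<in> borel_measurable borel"
  unfolding H_def by measurable

lemma H_param:
  "H (m - r * cos t) = trig_poisson k0 k1 k2 k3 p t"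
proof -
  have P: "\<alpha> * (C * (1 - p\<^sup>2) / (m - r * cos t)) = \<alpha> * poisson p t"
  proof (cases "\<alpha> = 0")
    case False
    then have "m - r * cos t = C * (1 - 2 * p * cos t + p\<^sup>2)"
      using mC rC \<alpha> by (simp add: algebra_simps)
    then show ?thesis using C by (simp add: poisson_def)
  qed simp
  have Q: "r\<^sup>2 / 2 - (m - r * cos t) * (m - r * cos t - m) = m * r * cos t - r\<^sup>2 / 2 * cos (2 * t)"
    unfolding cos_double_cos[of t] by (simp add: power2_eq_square algebra_simps)
  have "H (m - r * cos t) = (1 + \<alpha> + (m * r * cos t - r\<^sup>2 / 2 * cos (2 * t)) - \<alpha> * poisson p t) / pi"
    unfolding H_def P Q[symmetric] by (simp add: algebra_simps)
  then show ?thesis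
    by (simp add: trig_poisson_def k0_def k1_def k2_def k3_def add_divide_distrib diff_divide_distrib)
qed

definition "a = m - r"
definition "b = m + r"

lemma ab: "a < b" using r by (simp add: a_def b_def)

lemma a_pos: "0 < \<alpha> \<Longrightarrow> 0 < a"
proof -
  assume "0 < \<alpha>"
  then have "a = C * (1 - p)\<^sup>2" using mC rC unfolding a_def by (simp add: power2_eq_square algebra_simps)
  then show ?thesis using C p1 by simp
qed

lemma range_cos: "m - r * cos t \<in> {a..b}"
proof -
  have "r * cos t \<le> r * 1" "r * (-1) \<le> r * cos t" using r by (intro mult_left_mono; simp)+
  then show ?thesis by (simp add: a_def b_def)
qed

lemma Icc_dom: "{a..b} \<subseteq> ext_field_dom \<alpha>"
  using a_pos by (auto simp: ext_field_dom_def)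

end

locale nonneg_arc = arc +
  assumes H_nonneg: "\<And>x. x \<in> {a..b} \<Longrightarrow> 0 \<le> H x"
begin

sublocale circle_density k0 k1 k2 k3 p
proof
  show "\<bar>p\<bar> < 1" using p0 p1 by simp
  show "pi * (k0 + k3) = 1" by (simp add: k0_def k3_def field_simps)
  show "0 \<le> trig_poisson k0 k1 k2 k3 p t" for t
    unfolding H_param[symmetric] using H_nonneg range_cos by blast
qed

lemma h_eq: "h t = H (m - r * cos t)" by (simp add: h_def H_param)

definition arc_measure :: "real measure" where
  "arc_measure = distr circ borel (\<lambda>t. m - r * cos t)"

lemma real_distribution_arc: "real_distribution arc_measure"
proof -
  have "prob_space arc_measure" unfolding arc_measure_def by (rule C.prob_space_distr) simp
  then show ?thesis by (auto intro!: real_distribution.intro real_distribution_axioms.intro simp: arc_measure_def)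
qed

text \<open>Under x = m - r cos t the Jacobian r sin t equals the square root of (b - x)(x - a), so
  the singular weight disappears.\<close>

lemma half_circle:
  assumes [measurable]: "A \<in> sets borel"
  shows "(\<integral>\<^sup>+t. ennreal (H (m - r * cos t)) * indicator A (m - r * cos t) * indicator {0..pi} t \<partial>lborel)
     = (\<integral>\<^sup>+x. ennreal (indicator {a..b} x * (H x / sqrt ((b - x) * (x - a)))) * indicator A x \<partial>lborel)"
proof -
  let ?F = "\<lambda>x. ennreal (indicator {a..b} x * (H x / sqrt ((b - x) * (x - a)))) * indicator A x"
  let ?g = "\<lambda>t. m - r * cos t"
  have "(\<integral>\<^sup>+x. ?F x \<partial>lborel) = (\<integral>\<^sup>+x. ?F x * indicator {?g 0..?g pi} x \<partial>lborel)"
    by (intro nn_integral_cong) (auto simp: a_def b_def split: split_indicator)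
  also have "\<dots> = (\<integral>\<^sup>+t. ?F (?g t) * ennreal (r * sin t) * indicator {0..pi} t \<partial>lborel)"
  proof (rule nn_integral_substitution_aux)
    show "?F \<in> borel_measurable borel" by measurable
    show "((\<lambda>t. m - r * cos t) has_real_derivative r * sin t) (at t)" for t
      by (auto intro!: derivative_eq_intros)
    show "continuous_on {0..pi} (\<lambda>t. r * sin t)" by (intro continuous_intros)
    show "0 \<le> r * sin t" if "t \<in> {0..pi}" for t using that r sin_ge_zero by simp
  qed auto
  also have "\<dots> = (\<integral>\<^sup>+t. ennreal (H (?g t)) * indicator A (?g t) * indicator {0..pi} t \<partial>lborel)"
  proof (rule nn_integral_cong_AE)
    \<comment> \<open>At 0 and pi the quotient is a division by zero with value 0, while
      \<open>H\<close> may be nonzero there.\<close>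
    have "AE t in lborel. t \<notin> {0, pi}" by (rule AE_not_in) (intro finite_imp_null_set_lborel, simp)
    then show "AE t in lborel. ?F (?g t) * ennreal (r * sin t) * indicator {0..pi} t
        = ennreal (H (?g t)) * indicator A (?g t) * indicator {0..pi} t"
    proof eventually_elim
      case (elim t)
      show ?case
      proof (cases "t \<in> {0..pi}")
        case True
        then have s: "0 < sin t" using elim by (intro sin_gt_zero) auto
        have "(b - ?g t) * (?g t - a) = (r * sin t)\<^sup>2"
          by (simp add: a_def b_def power_mult_distrib sin_squared_eq) (simp add: power2_eq_square algebra_simps)
        then have q: "sqrt ((b - ?g t) * (?g t - a)) = r * sin t" using s r by simp
        have e: "ennreal (H (?g t) / (r * sin t)) * ennreal (r * sin t) = ennreal (H (?g t))"
          using s r H_nonneg[OF range_cos[of t]] by (subst ennreal_mult[symmetric]) auto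
        have F: "?F (?g t) = ennreal (H (?g t) / (r * sin t)) * indicator A (?g t)"
          using range_cos[of t] unfolding q by simp
        have "?F (?g t) * ennreal (r * sin t) * indicator {0..pi} t
          = (ennreal (H (?g t) / (r * sin t)) * ennreal (r * sin t)) * indicator A (?g t) * indicator {0..pi} t"
          unfolding F by (simp only: mult_ac)
        then show ?thesis unfolding e .
      qed simp
    qed
  qed
  finally show ?thesis by simp
qed

lemma arc_measure_eq: "arc_measure = dens_measure {a..b} (\<lambda>x. H x / sqrt ((b - x) * (x - a)))"
proof (rule measure_eqI)
  show "sets arc_measure = sets (dens_measure {a..b} (\<lambda>x. H x / sqrt ((b - x) * (x - a))))"
    by (simp add: arc_measure_def dens_measure_def)
  fix A assume "A \<in> sets arc_measure"
  then have A[measurable]: "A \<in> sets borel" by (simp add: arc_measure_def)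
  let ?\<phi> = "\<lambda>t. ennreal (H (m - r * cos t)) * indicator A (m - r * cos t)"
  have "emeasure arc_measure A = (\<integral>\<^sup>+t. indicator A (m - r * cos t) \<partial>circ)"
    using nn_integral_distr[of "\<lambda>t. m - r * cos t" circ borel "indicator A"]
    by (simp add: arc_measure_def)
  also have "\<dots> = (\<integral>\<^sup>+t. ennreal (indicator {0..2*pi} t * (h t / 2)) * indicator A (m - r * cos t) \<partial>lborel)"
    unfolding circ_def by (subst nn_integral_density) auto
  also have "\<dots> = (\<integral>\<^sup>+t. ennreal (1/2) * (?\<phi> t * indicator {0..pi} t + ?\<phi> t * indicator {pi..2*pi} t) \<partial>lborel)"
  proof (rule nn_integral_cong_AE)
    show "AE t in lborel. ennreal (indicator {0..2*pi} t * (h t / 2)) * indicator A (m - r * cos t)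
       = ennreal (1/2) * (?\<phi> t * indicator {0..pi} t + ?\<phi> t * indicator {pi..2*pi} t)"
      using AE_lborel_singleton[of pi]
    proof eventually_elim
      case (elim t)
      have "ennreal (h t / 2) = ennreal (1/2) * ennreal (H (m - r * cos t))"
        using h_nonneg[of t] by (subst ennreal_mult[symmetric]) (auto simp: h_eq)
      then show ?case using elim pi_gt_zero by (auto split: split_indicator)
    qed
  qed
  also have "\<dots> = ennreal (1/2) * ((\<integral>\<^sup>+t. ?\<phi> t * indicator {0..pi} t \<partial>lborel) + (\<integral>\<^sup>+t. ?\<phi> t * indicator {pi..2*pi} t \<partial>lborel))"
    by (subst nn_integral_cmult, simp, subst nn_integral_add) auto
  \<comment> \<open>The reflection of t to 2 pi - t identifies the lower half of the circle with the
    upper one.\<close>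
  also have "(\<integral>\<^sup>+t. ?\<phi> t * indicator {pi..2*pi} t \<partial>lborel) = (\<integral>\<^sup>+t. ?\<phi> t * indicator {0..pi} t \<partial>lborel)"
  proof -
    have "(\<integral>\<^sup>+t. ?\<phi> t * indicator {pi..2*pi} t \<partial>lborel)
      = ennreal \<bar>-1\<bar> * (\<integral>\<^sup>+t. ?\<phi> (2*pi + (-1) * t) * indicator {pi..2*pi} (2*pi + (-1) * t) \<partial>lborel)"
      by (rule nn_integral_real_affine) auto
    also have "\<dots> = (\<integral>\<^sup>+t. ?\<phi> t * indicator {0..pi} t \<partial>lborel)"
      by (simp, intro nn_integral_cong) (auto simp: cos_diff split: split_indicator)
    finally show ?thesis .
  qed
  also have "ennreal (1/2) * ((\<integral>\<^sup>+t. ?\<phi> t * indicator {0..pi} t \<partial>lborel) + (\<integral>\<^sup>+t. ?\<phi> t * indicator {0..pi} t \<partial>lborel))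
    = (\<integral>\<^sup>+t. ?\<phi> t * indicator {0..pi} t \<partial>lborel)"
  proof -
    have "ennreal (1/2) * (z + z) = z" for z
    proof -
      have "ennreal (1/2) * (z + z) = (ennreal (1/2) + ennreal (1/2)) * z" by (simp only: distrib_left distrib_right)
      also have "\<dots> = z" by (subst ennreal_plus[symmetric]) auto
      finally show ?thesis .
    qed
    then show ?thesis .
  qed
  also have "\<dots> = (\<integral>\<^sup>+x. ennreal (indicator {a..b} x * (H x / sqrt ((b - x) * (x - a)))) * indicator A x \<partial>lborel)"
    by (rule half_circle) simp
  also have "\<dots> = emeasure (dens_measure {a..b} (\<lambda>x. H x / sqrt ((b - x) * (x - a)))) A"
    unfolding dens_measure_def by (subst emeasure_density) auto
  finally show "emeasure arc_measure A = emeasure (dens_measure {a..b} (\<lambda>x. H x / sqrt ((b - x) * (x - a)))) A" .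
qed

lemma integrable_arc_continuous:
  assumes [measurable]: "f \<in> borel_measurable borel" and f: "continuous_on {a..b} (f :: real \<Rightarrow> real)"
  shows "integrable arc_measure f"
  unfolding arc_measure_def
proof (subst integrable_distr_eq)
  show "integrable circ (\<lambda>t. f (m - r * cos t))"
  proof (rule circ_integrable_continuous)
    show "continuous_on {0..2*pi} (\<lambda>t. f (m - r * cos t))"
      using range_cos by (intro continuous_on_compose2[OF f] continuous_intros) auto
  qed measurable
qed auto

text \<open>As a polynomial in u, 1 - 2 u cos t + u^2 has the factors 1 - u exp(i t) and 1 - u
  exp(-i t). Conjugating the second inside its modulus brings it to the form treated by
  \<open>log_circ\<close>.\<close>

lemma dist_factor:
  assumes u: "u \<noteq> 0" and x: "of_real x = of_real m - of_real (r / 2) * (u + 1 / u)"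
  shows "\<bar>x - (m - r * cos t)\<bar> = r / (2 * norm u) * cmod (1 - u * cis t) * cmod (1 - cnj u * cis t)"
proof -
  have "of_real (x - (m - r * cos t)) = - (of_real r / (2 * u)) * ((1 - u * cis t) * (1 - u * cis (- t)))"
  proof -
    have c: "(1 - u * cis t) * (1 - u * cis (- t)) = 1 - 2 * of_real (cos t) * u + u\<^sup>2"
    proof -
      have s: "cis t + cis (- t) = 2 * of_real (cos t)" by (simp add: complex_eq_iff)
      have e: "cis t * cis (- t) = 1" by (simp add: cis_mult)
      have "(1 - u * cis t) * (1 - u * cis (- t)) = 1 - u * (cis t + cis (- t)) + u\<^sup>2 * (cis t * cis (- t))"
        by (simp add: algebra_simps power2_eq_square)
      then show ?thesis unfolding s e by simp
    qed
    show ?thesis unfolding c using u x by (simp add: field_simps power2_eq_square)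
  qed
  then have "\<bar>x - (m - r * cos t)\<bar> = norm (- (of_real r / (2 * u)) * ((1 - u * cis t) * (1 - u * cis (- t))))"
    by (metis norm_of_real)
  also have "\<dots> = r / (2 * norm u) * (cmod (1 - u * cis t) * cmod (1 - u * cis (- t)))"
    using r by (simp add: norm_mult norm_divide)
  also have "cmod (1 - u * cis (- t)) = cmod (cnj (1 - u * cis (- t)))" by (rule complex_mod_cnj[symmetric])
  also have "cnj (1 - u * cis (- t)) = 1 - cnj u * cis t" by (simp add: cis_cnj)
  finally show ?thesis by (simp add: mult.assoc)
qed

lemma V_cnj: "V (cnj u) = V u"
proof -
  have "cmod (1 - of_real p * cnj u) = cmod (cnj (1 - of_real p * u))"
    by (simp only: complex_cnj_diff complex_cnj_mult complex_cnj_one complex_cnj_complex_of_real)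
  also have "\<dots> = cmod (1 - of_real p * u)" by (rule complex_mod_cnj)
  finally show ?thesis by (simp add: circle_log_potential_def power2_eq_square)
qed

definition W :: "complex \<Rightarrow> real" where
  "W u = - m * r * Re u + r\<^sup>2 / 4 * Re (u\<^sup>2) - 2 * \<alpha> * ln (cmod (1 - of_real p * u))"

lemma W_eq: "2 * pi * V u = W u"
  by (simp add: W_def circle_log_potential_def k1_def k2_def k3_def field_simps)

lemma log_potential:
  assumes u: "u \<noteq> 0" "norm u \<le> 1" and x: "of_real x = of_real m - of_real (r / 2) * (u + 1 / u)"
  shows "integrable arc_measure (\<lambda>y. ln \<bar>x - y\<bar>)"
    and "potential arc_measure x = ln (2 * norm u / r) - W u"
proof -
  let ?f = "\<lambda>t. ln (r / (2 * norm u)) + ln (cmod (1 - u * cis t)) + ln (cmod (1 - cnj u * cis t))"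
  have u': "norm (cnj u) \<le> 1" using u by simp
  have i: "integrable circ ?f" "(\<integral>t. ?f t \<partial>circ) = ln (r / (2 * norm u)) + W u"
    using log_circ[OF u(2)] log_circ[OF u'] W_eq[of u] by (simp_all add: V_cnj C.prob_space[simplified])
  have ae: "AE t in circ. ?f t = ln \<bar>x - (m - r * cos t)\<bar>"
    using circ_AE_nonzero[of u] circ_AE_nonzero[of "cnj u"]
  proof eventually_elim
    case (elim t)
    have "0 < r / (2 * norm u)" "0 < cmod (1 - u * cis t)" "0 < cmod (1 - cnj u * cis t)"
      using elim u r by auto
    then show ?case unfolding dist_factor[OF u(1) x, of t] by (simp only: ln_mult_pos mult_pos_pos)
  qed
  have I: "integrable circ (\<lambda>t. ln \<bar>x - (m - r * cos t)\<bar>)"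
    by (rule integrable_cong_AE_imp[OF i(1) _ ae]) measurable
  have E: "(\<integral>t. ln \<bar>x - (m - r * cos t)\<bar> \<partial>circ) = ln (r / (2 * norm u)) + W u"
    unfolding i(2)[symmetric]
  proof (rule integral_cong_AE)
    show "AE t in circ. ln \<bar>x - (m - r * cos t)\<bar> = ?f t" using ae by eventually_elim simp
    show "?f \<in> borel_measurable circ" using i(1) by auto
  qed measurable
  show "integrable arc_measure (\<lambda>y. ln \<bar>x - y\<bar>)"
    unfolding arc_measure_def using I by (subst integrable_distr_eq) auto
  have "potential arc_measure x = - (ln (r / (2 * norm u)) + W u)"
    unfolding potential_def arc_measure_def E[symmetric] by (subst integral_distr) auto
  also have "ln (r / (2 * norm u)) = - ln (2 * norm u / r)" using u r by (simp add: ln_div)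
  finally show "potential arc_measure x = ln (2 * norm u / r) - W u" by simp
qed

lemma joukowski_param:
  obtains u :: complex where "u \<noteq> 0" "norm u \<le> 1" "of_real x = of_real m - of_real (r / 2) * (u + 1 / u)"
proof -
  obtain u :: complex where u: "u \<noteq> 0" "norm u \<le> 1" "u + 1 / u = of_real (2 * ((m - x) / r))"
    by (rule joukowski_cover[of "(m - x) / r"])
  show thesis
  proof (rule that[OF u(1,2)])
    show "complex_of_real x = of_real m - of_real (r / 2) * (u + 1 / u)"
      unfolding u(3) of_real_mult[symmetric] of_real_diff[symmetric] using r by (simp add: field_simps)
  qed
qed

text \<open>Every real x is reached from some u in the closed unit disc. There \<open>W\<close> is
  bounded, and ln \<bar>u\<bar> is at most 0, so the bound is uniform in x.\<close>

lemma potential_bounded: "potential arc_measure x \<le> ln (2 / r) + \<bar>m\<bar> * r + r\<^sup>2 / 4 + 2 * \<alpha> * ln 2"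
proof -
  obtain u :: complex where u: "u \<noteq> 0" "norm u \<le> 1" "of_real x = of_real m - of_real (r / 2) * (u + 1 / u)"
    by (rule joukowski_param)
  have 1: "ln (2 * norm u / r) \<le> ln (2 / r)"
    using u r by (subst ln_le_cancel_iff) (auto simp: divide_right_mono)
  have 2: "\<bar>m * r * Re u\<bar> \<le> \<bar>m\<bar> * r"
    using abs_Re_le_cmod[of u] u(2) r mult_left_mono[of "\<bar>Re u\<bar>" 1 "\<bar>m\<bar> * r"] by (simp add: abs_mult)
  have "\<bar>Re (u\<^sup>2)\<bar> \<le> (cmod u)\<^sup>2" using abs_Re_le_cmod[of "u\<^sup>2"] by (simp add: norm_power)
  also have "\<dots> \<le> 1" using u(2) power_mono[of "cmod u" 1 2] by simp
  finally have 3: "\<bar>r\<^sup>2 / 4 * Re (u\<^sup>2)\<bar> \<le> r\<^sup>2 / 4" using mult_left_mono[of "\<bar>Re (u\<^sup>2)\<bar>" 1 "r\<^sup>2 / 4"] by (simp add: abs_mult)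
  have pu: "norm (of_real p * u) \<le> p * 1" unfolding norm_mult using p0 u(2) by (intro mult_mono) auto
  have "cmod (1 - of_real p * u) \<le> 2" using norm_triangle_ineq4[of 1 "of_real p * u"] pu p1 by simp
  moreover have "0 < cmod (1 - of_real p * u)" using pu p1 by auto
  ultimately have "ln (cmod (1 - of_real p * u)) \<le> ln 2" by simp
  then have 4: "2 * \<alpha> * ln (cmod (1 - of_real p * u)) \<le> 2 * \<alpha> * ln 2" using \<alpha> by (intro mult_left_mono) auto
  show ?thesis unfolding log_potential(2)[OF u] W_def using 1 2 3 4 by linarith
qed

sublocale B: bounded_potential arc_measure "ln (2 / r) + \<bar>m\<bar> * r + r\<^sup>2 / 4 + 2 * \<alpha> * ln 2"
proof -
  interpret real_distribution arc_measure by (rule real_distribution_arc)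
  show "bounded_potential arc_measure (ln (2 / r) + \<bar>m\<bar> * r + r\<^sup>2 / 4 + 2 * \<alpha> * ln 2)"
  proof
    fix x
    show "integrable arc_measure (\<lambda>y. ln \<bar>x - y\<bar>)"
      by (rule joukowski_param[of x], rule log_potential(1))
    show "potential arc_measure x \<le> ln (2 / r) + \<bar>m\<bar> * r + r\<^sup>2 / 4 + 2 * \<alpha> * ln 2"
      by (rule potential_bounded)
    have "AE y in lborel. y \<noteq> x" by (rule AE_lborel_singleton)
    then show "AE y in arc_measure. y \<noteq> x"
      unfolding arc_measure_eq dens_measure_def by (subst AE_density) (auto elim: eventually_mono)
  next
    have "1 + y\<^sup>2 \<noteq> 0" for y :: real by (metis add_pos_nonneg less_irrefl zero_le_power2 zero_less_one)
    then show "integrable arc_measure (\<lambda>y. ln (1 + y\<^sup>2))"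
      by (intro integrable_arc_continuous continuous_intros) auto
  qed
qed

end

section \<open>The Euler--Lagrange conditions\<close>

context nonneg_arc
begin

text \<open>The Robin constant of the arc: what remains of 2 U + Q once all cosine and logarithmic
  terms have cancelled.\<close>

definition "robin = 2 * ln (2 / r) + m\<^sup>2 + r\<^sup>2 / 2 - 2 * \<alpha> * ln C"

text \<open>On the arc u = exp(i \<theta>). If \<alpha> > 0, then \<bar>1 - p u\<bar>^2 = x / C, so
  the logarithm in \<open>W\<close> cancels 2 \<alpha> ln x; the cosines in \<open>W\<close> cancel
  those of x^2.\<close>

lemma potential_on_arc:
  assumes x: "x \<in> {a..b}"
  shows "2 * potential arc_measure x + ext_field \<alpha> x = robin"
proof -
  define \<theta> where "\<theta> = arccos ((m - x) / r)"
  have "\<bar>(m - x) / r\<bar> \<le> 1" using x r by (auto simp: a_def b_def abs_le_iff field_simps)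
  then have "cos \<theta> = (m - x) / r" unfolding \<theta>_def by (intro cos_arccos_abs)
  then have xt: "x = m - r * cos \<theta>" using r by (simp add: field_simps)
  have u: "cis \<theta> \<noteq> 0" "norm (cis \<theta>) \<le> 1"
    "of_real x = of_real m - of_real (r / 2) * (cis \<theta> + 1 / cis \<theta>)"
  proof -
    have "cis \<theta> + 1 / cis \<theta> = of_real (2 * cos \<theta>)" by (simp add: complex_eq_iff divide_inverse)
    then show "of_real x = of_real m - of_real (r / 2) * (cis \<theta> + 1 / cis \<theta>)" unfolding xt by simp
  qed auto
  have nrm: "2 * ln (cmod (1 - of_real p * cis \<theta>)) = ln (1 - 2 * p * cos \<theta> + p\<^sup>2)"
  proof -
    have s: "(sin \<theta>)\<^sup>2 = 1 - (cos \<theta>)\<^sup>2" by (simp add: sin_squared_eq)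
    have "(cmod (1 - of_real p * cis \<theta>))\<^sup>2 = (1 - p * cos \<theta>)\<^sup>2 + (p * sin \<theta>)\<^sup>2"
      by (simp add: cmod_power2)
    also have "\<dots> = 1 - 2 * p * cos \<theta> + p\<^sup>2"
      unfolding power_mult_distrib s by (simp add: power2_eq_square algebra_simps)
    finally have e: "(cmod (1 - of_real p * cis \<theta>))\<^sup>2 = 1 - 2 * p * cos \<theta> + p\<^sup>2" .
    show ?thesis unfolding e[symmetric] by (simp add: ln_realpow)
  qed
  have lnx: "2 * \<alpha> * ln x = 2 * \<alpha> * (ln C + 2 * ln (cmod (1 - of_real p * cis \<theta>)))"
  proof (cases "\<alpha> = 0")
    case False
    then have "x = C * (1 - 2 * p * cos \<theta> + p\<^sup>2)"
      unfolding xt using mC rC \<alpha> by (simp add: algebra_simps)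
    then have "ln x = ln C + ln (1 - 2 * p * cos \<theta> + p\<^sup>2)"
      using C poisson_denom_pos[OF p, of \<theta>] by (simp add: ln_mult_pos)
    then show ?thesis unfolding nrm by simp
  qed simp
  have "(cis \<theta>)\<^sup>2 = cis (2 * \<theta>)" using Complex.DeMoivre[of \<theta> 2] by simp
  then have W: "W (cis \<theta>) = - m * r * cos \<theta> + r\<^sup>2 / 4 * cos (2 * \<theta>) - 2 * \<alpha> * ln (cmod (1 - of_real p * cis \<theta>))"
    by (simp add: W_def)
  have sq: "(m - r * cos \<theta>)\<^sup>2 = m\<^sup>2 - 2 * m * r * cos \<theta> + r\<^sup>2 / 2 + r\<^sup>2 / 2 * cos (2 * \<theta>)"
    unfolding cos_double_cos by (simp add: power2_eq_square algebra_simps)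
  have "2 * potential arc_measure x + ext_field \<alpha> x = 2 * (ln (2 / r) - W (cis \<theta>)) + (x\<^sup>2 - 2 * \<alpha> * ln x)"
    unfolding log_potential(2)[OF u] ext_field_def by simp
  also have "\<dots> = robin" unfolding lnx W unfolding xt sq robin_def by (simp add: algebra_simps)
  finally show ?thesis .
qed

section \<open>The potential outside the arc\<close>

definition jk :: "real \<Rightarrow> real" where
  "jk v = m - r / 2 * (v + 1 / v)"

text \<open>The excess of 2 U + Q over \<open>robin\<close> at the point \<open>jk v\<close>.
  Positive v in ]0, 1[ parametrise x < a, negative v in ]-1, 0[ parametrise x > b, and v = 1, -1 are
  the end points.\<close>

definition \<Phi> :: "real \<Rightarrow> real" where
  "\<Phi> v = 2 * ln \<bar>v\<bar> + m * r * (v - 1 / v) + r\<^sup>2 / 4 * (1 / v\<^sup>2 - v\<^sup>2) + 2 * (\<alpha> * (ln (1 - p * v) - ln (1 - p / v)))"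

lemma one_minus_pv: "\<bar>v\<bar> \<le> 1 \<Longrightarrow> 0 < 1 - p * v"
proof -
  assume "\<bar>v\<bar> \<le> 1"
  then have "p * v \<le> p * 1" using p0 by (intro mult_left_mono) auto
  then show ?thesis using p1 by simp
qed

lemma jk_factor: "0 < \<alpha> \<Longrightarrow> v \<noteq> 0 \<Longrightarrow> jk v = C * ((1 - p * v) * (1 - p / v))"
  using mC rC unfolding jk_def by (simp add: field_simps power2_eq_square)

text \<open>In the factorisation of \<open>jk v\<close> the other factors C and 1 - p v are
  positive, so 1 - p / v has the sign of x; the singularity x = 0 of the field sits at v =
  p.\<close>

lemma one_minus_p_over:
  assumes "0 < \<alpha>" "v \<noteq> 0" "\<bar>v\<bar> \<le> 1" "0 < jk v"
  shows "0 < 1 - p / v"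
  using assms C one_minus_pv[of v] jk_factor[of v] by (simp add: zero_less_mult_iff)

lemma potential_off_arc:
  assumes v: "v \<noteq> 0" "\<bar>v\<bar> < 1" and d: "jk v \<in> ext_field_dom \<alpha>"
  shows "2 * potential arc_measure (jk v) + ext_field \<alpha> (jk v) = robin + \<Phi> v"
proof -
  have u: "complex_of_real v \<noteq> 0" "norm (complex_of_real v) \<le> 1"
    "of_real (jk v) = of_real m - of_real (r / 2) * (complex_of_real v + 1 / complex_of_real v)"
    using v by (simp_all add: jk_def)
  have pv: "0 < 1 - p * v" using one_minus_pv[of v] v by simp
  have "1 - complex_of_real p * complex_of_real v = of_real (1 - p * v)" by simp
  then have cm: "cmod (1 - complex_of_real p * complex_of_real v) = 1 - p * v"
    using pv by (simp only: norm_of_real)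
  have W: "W (of_real v) = - m * r * v + r\<^sup>2 / 4 * v\<^sup>2 - 2 * (\<alpha> * ln (1 - p * v))"
    unfolding W_def cm by (simp add: power2_eq_square)
  have lnx: "\<alpha> * ln (jk v) = \<alpha> * ln C + \<alpha> * ln (1 - p * v) + \<alpha> * ln (1 - p / v)"
  proof (cases "\<alpha> = 0")
    case False
    then have "0 < jk v" using d \<alpha> by (auto simp: ext_field_dom_def)
    then have "0 < 1 - p / v" using one_minus_p_over[of v] v False \<alpha> by simp
    then have "ln (jk v) = ln C + (ln (1 - p * v) + ln (1 - p / v))"
      using jk_factor[of v] v False \<alpha> C pv by (simp add: ln_mult_pos)
    then show ?thesis by (simp add: algebra_simps)
  qed simp
  have l: "ln (2 * norm (complex_of_real v) / r) = ln (2 / r) + ln \<bar>v\<bar>"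
    using v r by (simp add: ln_div ln_mult_pos)
  have sq: "(jk v)\<^sup>2 = m\<^sup>2 - m * r * (v + 1 / v) + r\<^sup>2 / 4 * (v\<^sup>2 + 2 + 1 / v\<^sup>2)"
    using v unfolding jk_def by (simp add: power2_eq_square field_simps)
  have "2 * potential arc_measure (jk v) + ext_field \<alpha> (jk v)
     = 2 * (ln (2 / r) + ln \<bar>v\<bar> - W (of_real v)) + ((jk v)\<^sup>2 - 2 * (\<alpha> * ln (jk v)))"
    unfolding log_potential(2)[OF u] l ext_field_def by simp
  also have "\<dots> = robin + \<Phi> v"
    unfolding lnx W sq robin_def \<Phi>_def by (simp add: algebra_simps)
  finally show ?thesis .
qed

text \<open>With x = \<open>jk v\<close> inside the disc, the x-derivative of 2 U + Q is, up to the
  sign of v, 2 pi H(x) over the square root of (x - a)(x - b). The derivative of \<open>jk\<close>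
  is that root divided by \<bar>v\<bar>, so the root cancels and a formula regular at the end points
  remains.\<close>

lemma \<Phi>_deriv:
  assumes v: "v \<noteq> 0" "\<bar>v\<bar> \<le> 1" and d: "0 < \<alpha> \<Longrightarrow> 0 < jk v"
  shows "(\<Phi> has_real_derivative 2 * pi * H (jk v) / v) (at v)"
proof -
  let ?T = "\<lambda>v. \<alpha> * (ln (1 - p * v) - ln (1 - p / v))"
  have T: "(?T has_real_derivative (\<alpha> - \<alpha> * (C * (1 - p\<^sup>2) / jk v)) / v) (at v)"
  proof (cases "\<alpha> = 0")
    case False
    then have a: "0 < \<alpha>" using \<alpha> by simp
    have p1: "0 < 1 - p * v" and p2: "0 < 1 - p / v"
      using one_minus_pv[of v] one_minus_p_over[OF a, of v] v d[OF a] by auto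
    have "(?T has_real_derivative \<alpha> * (- p / (1 - p * v) - (p / v\<^sup>2) / (1 - p / v))) (at v)"
      using v p1 p2 by (auto intro!: derivative_eq_intros simp: power2_eq_square field_simps)
    moreover have E1: "- p / (1 - p * v) - (p / v\<^sup>2) / (1 - p / v) = (1 - (1 - p\<^sup>2) / ((1 - p * v) * (1 - p / v))) / v"
    proof -
      have "v - p \<noteq> 0" using p2 v by auto
      have q: "1 - p / v = (v - p) / v" using v by (simp add: field_simps)
      show ?thesis unfolding q using v p1 \<open>v - p \<noteq> 0\<close>
        by (simp add: divide_simps power2_eq_square) (simp add: algebra_simps)
    qed
    moreover have E2: "(1 - p\<^sup>2) / ((1 - p * v) * (1 - p / v)) = C * (1 - p\<^sup>2) / jk v"
      unfolding jk_factor[OF a v(1)] using C by simp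
    have "\<alpha> * (- p / (1 - p * v) - (p / v\<^sup>2) / (1 - p / v)) = (\<alpha> - \<alpha> * (C * (1 - p\<^sup>2) / jk v)) / v"
      unfolding E1 E2 by (simp add: right_diff_distrib diff_divide_distrib)
    ultimately show ?thesis by (simp only:)
  qed simp
  have L: "((\<lambda>v. ln \<bar>v\<bar>) has_real_derivative 1 / v) (at v)"
  proof (cases "0 < v")
    case True
    have "(ln has_real_derivative 1 / v) (at v)" using True by (auto intro!: derivative_eq_intros)
    then show ?thesis
      by (rule has_field_derivative_transform_within_open[where S = "{0<..}"]) (use True in auto)
  next
    case False
    then have "((\<lambda>v. ln (- v)) has_real_derivative 1 / v) (at v)"
      using v by (auto intro!: derivative_eq_intros simp: field_simps)
    then show ?thesis
      by (rule has_field_derivative_transform_within_open[where S = "{..<0}"]) (use False v in auto)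
  qed
  have "(\<Phi> has_real_derivative 2 * (1 / v) + m * r * (1 + 1 / v\<^sup>2) + r\<^sup>2 / 4 * (- 2 / v ^ 3 - 2 * v)
      + 2 * ((\<alpha> - \<alpha> * (C * (1 - p\<^sup>2) / jk v)) / v)) (at v)"
    unfolding \<Phi>_def[abs_def]
  proof (intro DERIV_add DERIV_cmult L T)
    show "((\<lambda>v. v - 1 / v) has_real_derivative 1 + 1 / v\<^sup>2) (at v)"
      using v by (auto intro!: derivative_eq_intros simp: power2_eq_square)
    show "((\<lambda>v. 1 / v\<^sup>2 - v\<^sup>2) has_real_derivative - 2 / v ^ 3 - 2 * v) (at v)"
      using v by (auto intro!: derivative_eq_intros simp: power2_eq_square power3_eq_cube field_simps)
  qed
  moreover have "2 * (1 / v) + m * r * (1 + 1 / v\<^sup>2) + r\<^sup>2 / 4 * (- 2 / v ^ 3 - 2 * v)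
      + 2 * ((\<alpha> - \<alpha> * (C * (1 - p\<^sup>2) / jk v)) / v) = 2 * pi * H (jk v) / v"
  proof -
    have j: "r\<^sup>2 / 2 - jk v * (jk v - m) = m * r / 2 * (v + 1 / v) - r\<^sup>2 / 4 * (v\<^sup>2 + 1 / v\<^sup>2)"
      using v unfolding jk_def by (simp add: field_simps power2_eq_square)
    have "2 * pi * H (jk v) = 2 * (1 + \<alpha> + (r\<^sup>2 / 2 - jk v * (jk v - m)) - \<alpha> * (C * (1 - p\<^sup>2) / jk v))"
      unfolding H_def by simp
    moreover have "2 * (1 + \<alpha> + K - D) / v = 2 * (1 + K) / v + 2 * ((\<alpha> - D) / v)" for K D
      using v by (simp add: field_simps)
    ultimately have "2 * pi * H (jk v) / v = 2 * (1 + (m * r / 2 * (v + 1 / v) - r\<^sup>2 / 4 * (v\<^sup>2 + 1 / v\<^sup>2))) / v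
       + 2 * ((\<alpha> - \<alpha> * (C * (1 - p\<^sup>2) / jk v)) / v)"
      unfolding j by (simp only:)
    also have "2 * (1 + (m * r / 2 * (v + 1 / v) - r\<^sup>2 / 4 * (v\<^sup>2 + 1 / v\<^sup>2))) / v
       = 2 * (1 / v) + m * r * (1 + 1 / v\<^sup>2) + r\<^sup>2 / 4 * (- 2 / v ^ 3 - 2 * v)"
      using v by (simp add: field_simps power2_eq_square power3_eq_cube)
    finally show ?thesis by simp
  qed
  ultimately show ?thesis by simp
qed

lemma jk_eqI:
  assumes "v + 1 / v = 2 * ((m - x) / r)"
  shows "jk v = x"
  unfolding jk_def assms using r by (simp add: field_simps)

lemma \<Phi>_ends: "\<Phi> 1 = 0" "\<Phi> (- 1) = 0"
  using one_minus_pv[of 1] by (auto simp: \<Phi>_def)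

lemma inv_sum_mono:
  assumes "0 < u" "u \<le> v" "v \<le> (1::real)"
  shows "v + 1 / v \<le> u + 1 / u"
proof -
  have "u * v \<le> 1 * 1" using assms by (intro mult_mono) auto
  then have "0 \<le> (v - u) * (1 - u * v)" using assms by simp
  then show ?thesis using assms by (simp add: field_simps)
qed

text \<open>Mean value theorem for \<open>\<Phi>\<close> between u and 1, where
  \<open>\<Phi>\<close> vanishes. All intermediate points \<open>jk v\<close> lie between x and a,
  so they stay in the domain of the field and in the range of the sign assumption.\<close>

lemma potential_left:
  assumes xa: "x < a" and d: "x \<in> ext_field_dom \<alpha>"
    and neg: "\<And>y. x \<le> y \<Longrightarrow> y < a \<Longrightarrow> H y \<le> 0"
  shows "robin \<le> 2 * potential arc_measure x + ext_field \<alpha> x"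
proof -
  obtain u where u: "0 < u" "u < 1" "u + 1 / u = 2 * ((m - x) / r)"
    using joukowski_real[of "(m - x) / r"] xa r by (auto simp: a_def field_simps)
  have x: "jk u = x" using u(3) by (rule jk_eqI)
  have ge: "x \<le> jk v" if "u \<le> v" "v \<le> 1" for v
    unfolding x[symmetric] jk_def using inv_sum_mono[OF u(1) that] r by simp
  have der: "(\<Phi> has_real_derivative 2 * pi * H (jk v) / v) (at v)" if "u \<le> v" "v \<le> 1" for v
    using that u ge[OF that] d by (intro \<Phi>_deriv) (auto simp: ext_field_dom_def)
  obtain z where z: "u < z" "z < 1" "\<Phi> 1 - \<Phi> u = (1 - u) * (2 * pi * H (jk z) / z)"
    using MVT2[OF u(2), of \<Phi>, OF der] by blast
  have "jk z < a"
  proof -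
    have "0 < (1 - z) * (1 - z)" using z by simp
    then have "2 < z + 1 / z" using z u by (simp add: field_simps)
    then show ?thesis unfolding jk_def a_def using r by simp
  qed
  then have "H (jk z) \<le> 0" using neg ge[of z] z by simp
  then have "2 * pi * H (jk z) / z \<le> 0" using z u by (simp add: divide_nonpos_pos mult_nonneg_nonpos)
  then have "(1 - u) * (2 * pi * H (jk z) / z) \<le> 0" using u by (intro mult_nonneg_nonpos) auto
  then have "0 \<le> \<Phi> u" using z(3) \<Phi>_ends(1) by linarith
  then show ?thesis using potential_off_arc[of u] u d x by simp
qed

text \<open>The same argument on [-1, -u]; the division by the negative v reverses the sign of the
  derivative, as the direction towards the end point is reversed too.\<close>

lemma potential_right:
  assumes xb: "b < x" and neg: "\<And>y. b < y \<Longrightarrow> y \<le> x \<Longrightarrow> H y \<le> 0"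
  shows "robin \<le> 2 * potential arc_measure x + ext_field \<alpha> x"
proof -
  obtain u where u: "0 < u" "u < 1" "u + 1 / u = 2 * ((x - m) / r)"
    using joukowski_real[of "(x - m) / r"] xb r by (auto simp: b_def field_simps)
  have "(m - x) / r = - ((x - m) / r)" by (simp add: minus_divide_left)
  then have x: "jk (- u) = x" using u by (intro jk_eqI) simp
  have b0: "0 < b" if "0 < \<alpha>" using a_pos[OF that] ab by simp
  have le: "b \<le> jk (- v)" "jk (- v) \<le> x" if "u \<le> v" "v \<le> 1" for v
  proof -
    have "2 \<le> v + 1 / v"
    proof -
      have "0 \<le> (1 - v) * (1 - v)" by simp
      then show ?thesis using that u by (simp add: field_simps)
    qed
    then have "r / 2 * 2 \<le> r / 2 * (v + 1 / v)" using r by (intro mult_left_mono) auto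
    moreover have "jk (- v) = m + r / 2 * (v + 1 / v)" by (simp add: jk_def algebra_simps)
    ultimately show "b \<le> jk (- v)" unfolding b_def by simp
    show "jk (- v) \<le> x"
      unfolding x[symmetric] jk_def using inv_sum_mono[OF u(1) that] r by simp
  qed
  have der: "(\<Phi> has_real_derivative 2 * pi * H (jk v) / v) (at v)" if "- 1 \<le> v" "v \<le> - u" for v
    using that u le(1)[of "- v"] b0 by (intro \<Phi>_deriv) auto
  have "- 1 < - u" using u by simp
  from MVT2[OF this, of \<Phi>, OF der]
  obtain z where z: "- 1 < z" "z < - u" "\<Phi> (- u) - \<Phi> (- 1) = (- u - - 1) * (2 * pi * H (jk z) / z)"
    by blast
  have "b < jk z"
  proof -
    have "0 < (1 + z) * (1 + z)" using z by simp
    then have "z + 1 / z < - 2" using z u by (simp add: field_simps)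
    then have "r / 2 * (z + 1 / z) < r / 2 * (- 2)" using r by (intro mult_strict_left_mono) auto
    then show ?thesis unfolding jk_def b_def by linarith
  qed
  then have "H (jk z) \<le> 0" using neg le(2)[of "- z"] z by simp
  then have "0 \<le> 2 * pi * H (jk z) / z" using z u by (intro divide_nonpos_neg) (auto simp: mult_nonneg_nonpos)
  then have "0 \<le> (- u - - 1) * (2 * pi * H (jk z) / z)" using u by (intro mult_nonneg_nonneg) auto
  then have "0 \<le> \<Phi> (- u)" using z(3) \<Phi>_ends(2) by linarith
  moreover have "jk (- u) \<in> ext_field_dom \<alpha>" unfolding x using xb b0 by (auto simp: ext_field_dom_def)
  ultimately show ?thesis using potential_off_arc[of "- u"] u x by simp
qed

theorem equilibrium_measure_arc:
  assumes \<sigma>: "\<sigma> \<le> a" and right: "\<And>y. b < y \<Longrightarrow> H y \<le> 0"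
    and left: "\<And>y. \<sigma> \<le> y \<Longrightarrow> y < a \<Longrightarrow> y \<in> ext_field_dom \<alpha> \<Longrightarrow> H y \<le> 0"
  shows "equilibrium_measure {\<sigma>..} (Q_alpha \<alpha>) = dens_measure {a..b} (\<lambda>x. H x / sqrt ((b - x) * (x - a)))"
proof -
  have "equilibrium_measure {\<sigma>..} (Q_alpha \<alpha>) = arc_measure"
  proof (rule B.equilibrium_measureI[OF \<alpha>])
    show "AE x in arc_measure. x \<in> {a..b}"
      unfolding arc_measure_def by (subst AE_distr_iff) (use range_cos in auto)
    show "{a..b} \<subseteq> {\<sigma>..}" using \<sigma> by auto
    show "{a..b} \<subseteq> ext_field_dom \<alpha>" by (rule Icc_dom)
    show "integrable arc_measure (ext_field \<alpha>)"
    proof (rule integrable_arc_continuous)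
      show "continuous_on {a..b} (ext_field \<alpha>)"
      proof (cases "\<alpha> = 0")
        case True
        then show ?thesis unfolding ext_field_def[abs_def] by (simp add: continuous_intros)
      next
        case False
        then have "x \<noteq> 0" if "x \<in> {a..b}" for x using a_pos \<alpha> that by auto
        then show ?thesis unfolding ext_field_def[abs_def] by (intro continuous_intros) auto
      qed
    qed simp
    show "2 * potential arc_measure x + ext_field \<alpha> x = robin" if "x \<in> {a..b}" for x
      using potential_on_arc[OF that] .
    show "robin \<le> 2 * potential arc_measure x + ext_field \<alpha> x" if x: "x \<in> {\<sigma>..}" "x \<in> ext_field_dom \<alpha>" for x
    proof -
      consider "x < a" | "x \<in> {a..b}" | "b < x" by fastforce
      then show ?thesis
      proof cases
        case 1
        show ?thesis
        proof (rule potential_left[OF 1 x(2)])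
          fix y assume "x \<le> y" "y < a"
          then show "H y \<le> 0" using x by (intro left) (auto simp: ext_field_dom_def)
        qed
      next
        case 2
        then show ?thesis using potential_on_arc by simp
      next
        case 3
        then show ?thesis using right by (intro potential_right) auto
      qed
    qed
  qed simp
  then show ?thesis by (simp add: arc_measure_eq)
qed

end

section \<open>End points of the support\<close>

text \<open>\<open>H\<close> written through the end points: m = (a + b) / 2, r = (b - a) / 2 and,
  when \<alpha> > 0, C (1 - p^2) = sqrt(a b).\<close>

definition arc_poly :: "real \<Rightarrow> real \<Rightarrow> real \<Rightarrow> real \<Rightarrow> real" where
  "arc_poly \<alpha> a b x = (1 + \<alpha> + (b - a)\<^sup>2 / 8 - x * (x - (a + b) / 2) - \<alpha> * (sqrt (a * b) / x)) / pi"

lemma equilibrium_measure_interval: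
  assumes \<alpha>: "0 \<le> \<alpha>" and ab: "a < b" and a: "0 < \<alpha> \<Longrightarrow> 0 < a" and \<sigma>: "\<sigma> \<le> a"
    and mid: "\<And>x. a \<le> x \<Longrightarrow> x \<le> b \<Longrightarrow> 0 \<le> arc_poly \<alpha> a b x"
    and right: "\<And>x. b < x \<Longrightarrow> arc_poly \<alpha> a b x \<le> 0"
    and left: "\<And>x. \<sigma> \<le> x \<Longrightarrow> x < a \<Longrightarrow> (0 < \<alpha> \<longrightarrow> 0 < x) \<Longrightarrow> arc_poly \<alpha> a b x \<le> 0"
  shows "equilibrium_measure {\<sigma>..} (Q_alpha \<alpha>)
    = dens_measure {a..b} (\<lambda>x. arc_poly \<alpha> a b x / sqrt ((b - x) * (x - a)))"
proof -
  obtain p C where pC: "0 \<le> p" "p < 1" "0 < C"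
    "0 < \<alpha> \<longrightarrow> (a + b) / 2 = C * (1 + p\<^sup>2) \<and> (b - a) / 2 = 2 * C * p \<and> sqrt (a * b) = C * (1 - p\<^sup>2)"
  proof (cases "\<alpha> = 0")
    case True
    then show thesis by (intro that[of 0 1]) auto
  next
    case False
    then have a0: "0 < a" "0 < b" using a \<alpha> ab by auto
    define s t where "s = sqrt a" and "t = sqrt b"
    have st: "0 < s" "s < t" "a = s\<^sup>2" "b = t\<^sup>2" "sqrt (a * b) = s * t"
      using a0 ab by (auto simp: s_def t_def real_sqrt_mult)
    \<comment> \<open>From a = C (1 - p)^2 and b = C (1 + p)^2: the half sum of the roots s, t of a,
      b is sqrt C, and p is the ratio of their difference to their sum.\<close>
    show thesis
    proof (rule that[of "(t - s) / (t + s)" "((s + t) / 2)\<^sup>2"])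
      have n: "t + s \<noteq> 0" using st by simp
      have e: "((s + t) / 2)\<^sup>2 * ((t - s) / (t + s))\<^sup>2 = ((t - s) / 2)\<^sup>2"
        using n by (simp add: power_divide add.commute)
      have e1: "((s + t) / 2)\<^sup>2 * ((t - s) / (t + s)) = (s + t) * (t - s) / 4"
        using n by (simp add: power2_eq_square field_simps)
      show "0 < \<alpha> \<longrightarrow> (a + b) / 2 = ((s + t) / 2)\<^sup>2 * (1 + ((t - s) / (t + s))\<^sup>2) \<and>
        (b - a) / 2 = 2 * ((s + t) / 2)\<^sup>2 * ((t - s) / (t + s)) \<and>
        sqrt (a * b) = ((s + t) / 2)\<^sup>2 * (1 - ((t - s) / (t + s))\<^sup>2)"
        unfolding distrib_left right_diff_distrib e mult.assoc[of 2] e1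
        unfolding st(5) unfolding st(3,4) by (simp add: power2_eq_square field_simps)
    qed (use st in auto)
  qed
  interpret arc \<alpha> "(a + b) / 2" "(b - a) / 2" p C
    using \<alpha> ab pC by unfold_locales auto
  have H: "H x = arc_poly \<alpha> a b x" for x
    unfolding H_def arc_poly_def using pC(4) \<alpha> by (cases "\<alpha> = 0") (auto simp: power_divide)
  have ends: "arc.a ((a + b) / 2) ((b - a) / 2) = a" "arc.b ((a + b) / 2) ((b - a) / 2) = b"
    unfolding a_def b_def by (auto simp: field_simps)
  interpret nonneg_arc \<alpha> "(a + b) / 2" "(b - a) / 2" p C
    by unfold_locales (use mid in \<open>auto simp: H ends\<close>)
  show ?thesis
    using equilibrium_measure_arc[of \<sigma>] \<sigma> right left by (simp add: H ends ext_field_dom_def)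
qed

lemma dens_measure_cong:
  assumes "\<And>x. x \<in> S \<or> x \<in> T \<Longrightarrow> indicator S x * f x = indicator T x * g x"
  shows "dens_measure S f = dens_measure T g"
proof -
  have "indicator S x * f x = indicator T x * g x" for x
    using assms[of x] by (cases "x \<in> S \<or> x \<in> T") auto
  then show ?thesis by (simp add: dens_measure_def)
qed

lemma divide_sqrt_mult: "0 < A \<Longrightarrow> 0 < B \<Longrightarrow> A / sqrt (A * B) = sqrt (A / B)"
  by (simp add: real_sqrt_mult real_sqrt_divide field_simps)

text \<open>\<open>S1\<close> and \<open>S2\<close> together say that \<open>arc_poly\<close>
  vanishes at a and at b. Then (b - x)(x - a) splits off, and the remaining factor is positive for x
  > 0, which yields all three sign conditions at once.\<close>

lemma equilibrium_measure_soft: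
  assumes \<alpha>: "0 < \<alpha>" and ab: "0 < a" "a < b" and \<sigma>: "\<sigma> \<le> a"
    and S1: "sqrt (a * b) * (a + b) = 2 * \<alpha>" and S2: "3 * a\<^sup>2 + 3 * b\<^sup>2 + 2 * a * b = 8 * (1 + \<alpha>)"
  shows "equilibrium_measure {\<sigma>..} (Q_alpha \<alpha>) = dens_measure {a..b} (f_crit \<alpha> a b)"
proof -
  let ?s = "sqrt (a * b)"
  have s: "0 < ?s" "?s * ?s = a * b" using ab by auto
  have "z * w / 2 / z = w / 2" if "0 < z" for z w :: real using that by simp
  from this[OF s(1), of "a + b"] have c: "\<alpha> / ?s = (a + b) / 2" unfolding S1 by simp
  have as: "\<alpha> * ?s = a * b * (a + b) / 2"
  proof -
    have "\<alpha> * ?s = (?s * (a + b)) * ?s / 2" unfolding S1 by simp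
    also have "\<dots> = (?s * ?s) * (a + b) / 2" by simp
    finally show ?thesis unfolding s .
  qed
  have P: "arc_poly \<alpha> a b x = (b - x) * (x - a) * (1 + (a + b) / 2 * (1 / x)) / pi" if "x \<noteq> 0" for x
  proof -
    have k: "1 + \<alpha> + (b - a)\<^sup>2 / 8 = (a\<^sup>2 + b\<^sup>2) / 2"
      using S2 by (simp add: power2_eq_square field_simps)
    have "arc_poly \<alpha> a b x = ((a\<^sup>2 + b\<^sup>2) / 2 - x * (x - (a + b) / 2) - (a * b * (a + b) / 2) / x) / pi"
      unfolding arc_poly_def k as[symmetric] by simp
    also have "(a\<^sup>2 + b\<^sup>2) / 2 - x * (x - (a + b) / 2) - (a * b * (a + b) / 2) / x
       = (b - x) * (x - a) * (1 + (a + b) / 2 * (1 / x))"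
      using that by (simp add: power2_eq_square field_simps)
    finally show ?thesis .
  qed
  have pos: "0 < 1 + (a + b) / 2 * (1 / x)" if "0 < x" for x using that ab by (simp add: add_pos_pos)
  have "equilibrium_measure {\<sigma>..} (Q_alpha \<alpha>)
    = dens_measure {a..b} (\<lambda>x. arc_poly \<alpha> a b x / sqrt ((b - x) * (x - a)))"
  proof (rule equilibrium_measure_interval)
    fix x
    show "0 \<le> arc_poly \<alpha> a b x" if "a \<le> x" "x \<le> b"
      using that ab pos[of x] P[of x] by (simp add: less_imp_le)
    show "arc_poly \<alpha> a b x \<le> 0" if "b < x"
    proof -
      have "(b - x) * (x - a) \<le> 0" using that ab by (simp add: mult_nonpos_nonneg)
      then show ?thesis using that ab pos[of x] P[of x] by (simp add: divide_nonpos_pos mult_nonpos_nonneg less_imp_le)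
    qed
    show "arc_poly \<alpha> a b x \<le> 0" if "x < a" "0 < \<alpha> \<longrightarrow> 0 < x"
    proof -
      have "(b - x) * (x - a) \<le> 0" using that ab by (simp add: mult_nonneg_nonpos)
      then show ?thesis using that \<alpha> pos[of x] P[of x] by (simp add: divide_nonpos_pos mult_nonpos_nonneg less_imp_le)
    qed
  qed (use \<alpha> ab \<sigma> in auto)
  also have "\<dots> = dens_measure {a..b} (f_crit \<alpha> a b)"
  proof (rule dens_measure_cong)
    fix x assume "x \<in> {a..b} \<or> x \<in> {a..b}"
    then have x: "a \<le> x" "x \<le> b" by auto
    let ?w = "(b - x) * (x - a)"
    have w: "?w / sqrt ?w = sqrt ?w" using x by (simp add: real_div_sqrt)
    have "z * q / pi / y = 1 / pi * (z / y) * q" for z q y :: real by simp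
    from this[of ?w _ "sqrt ?w", unfolded w] have "arc_poly \<alpha> a b x / sqrt ?w = f_crit \<alpha> a b x"
      unfolding f_crit_def c using P[of x] x ab by simp
    then show "indicator {a..b} x * (arc_poly \<alpha> a b x / sqrt ?w) = indicator {a..b} x * f_crit \<alpha> a b x" by simp
  qed
  finally show ?thesis .
qed

text \<open>\<open>K2\<close> says that \<open>arc_poly\<close> vanishes at b, so b - x splits off.
  The cofactor g is increasing for x > 0, and \<open>K1\<close> is its nonnegativity at \<sigma>.
  Nothing is to be checked on the left, since the arc starts at the wall.\<close>

lemma equilibrium_measure_hard:
  assumes \<alpha>: "0 \<le> \<alpha>" and \<sigma>: "0 < \<alpha> \<Longrightarrow> 0 < \<sigma>" and b: "\<sigma> < b"
    and K1: "0 \<le> \<sigma> + b - 2 * \<alpha> / sqrt (\<sigma> * b)"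
    and K2: "3/4 * (b - \<sigma>)\<^sup>2 + \<sigma> * (b - \<sigma>) + 2 * \<alpha> * sqrt (\<sigma> / b) - 2 * \<alpha> - 2 = 0"
  shows "equilibrium_measure {\<sigma>..} (Q_alpha \<alpha>) = dens_measure {\<sigma><..b} (f_hard \<alpha> \<sigma> b)"
proof -
  define g where "g x = 2 * x + b - \<sigma> - 2 * \<alpha> * sqrt (\<sigma> / b) * (1 / x)" for x
  have k: "\<alpha> * (sqrt (\<sigma> / b) * b) = \<alpha> * sqrt (\<sigma> * b)" "\<alpha> * (sqrt (\<sigma> / b) / \<sigma>) = \<alpha> / sqrt (\<sigma> * b)"
  proof -
    have "sqrt (\<sigma> / b) * b = sqrt (\<sigma> * b) \<and> sqrt (\<sigma> / b) / \<sigma> = 1 / sqrt (\<sigma> * b)" if "0 < \<alpha>"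
    proof -
      define s t where "s = sqrt \<sigma>" and "t = sqrt b"
      have st: "0 < s" "0 < t" "\<sigma> = s\<^sup>2" "b = t\<^sup>2" using \<sigma>[OF that] b by (auto simp: s_def t_def)
      show ?thesis unfolding st(3,4) using st(1,2)
        by (simp add: real_sqrt_mult real_sqrt_divide power2_eq_square field_simps)
    qed
    then show "\<alpha> * (sqrt (\<sigma> / b) * b) = \<alpha> * sqrt (\<sigma> * b)" "\<alpha> * (sqrt (\<sigma> / b) / \<sigma>) = \<alpha> / sqrt (\<sigma> * b)"
      using \<alpha> by (cases "\<alpha> = 0"; simp)+
  qed
  have P: "arc_poly \<alpha> \<sigma> b x = (b - x) * g x / (2 * pi)" if "0 < \<alpha> \<longrightarrow> 0 < x" for x
  proof -
    have "(b - x) * g x = 2 * (1 + \<alpha> + (b - \<sigma>)\<^sup>2 / 8 - x * (x - (\<sigma> + b) / 2) - \<alpha> * (sqrt (\<sigma> * b) / x))"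
    proof (cases "\<alpha> = 0")
      case True
      then show ?thesis using K2 by (simp add: g_def power2_eq_square field_simps)
    next
      case False
      then have x: "x \<noteq> 0" using that \<alpha> by auto
      define Y where "Y = \<alpha> * (sqrt (\<sigma> * b) / x)"
      have Y: "Y = \<alpha> * (sqrt (\<sigma> / b) * b) / x" unfolding k Y_def by simp
      have "(b - x) * (2 * \<alpha> * sqrt (\<sigma> / b) * (1 / x)) = 2 * Y - 2 * \<alpha> * sqrt (\<sigma> / b)"
        unfolding Y using x by (simp add: left_diff_distrib diff_divide_distrib)
      then have "(b - x) * g x = (b - x) * (2 * x + b - \<sigma>) - (2 * Y - 2 * \<alpha> * sqrt (\<sigma> / b))"
        unfolding g_def right_diff_distrib[of "b - x" "2 * x + b - \<sigma>"] by simp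
      also have "\<dots> = 2 * (1 + \<alpha> + (b - \<sigma>)\<^sup>2 / 8 - x * (x - (\<sigma> + b) / 2) - Y)"
        using K2 by (simp add: power2_eq_square field_simps)
      finally show ?thesis unfolding Y_def .
    qed
    moreover have "z / pi = w / (2 * pi)" if "w = 2 * z" for w z using that by simp
    ultimately show ?thesis unfolding arc_poly_def by blast
  qed
  have g: "0 \<le> g x" if "\<sigma> \<le> x" for x
  proof (cases "\<alpha> = 0")
    case True
    then show ?thesis using that K1 b by (simp add: g_def)
  next
    case False
    then have s: "0 < \<sigma>" using \<sigma> \<alpha> by simp
    have "1 / x \<le> 1 / \<sigma>" using s that by (simp add: frac_le)
    then have "2 * \<alpha> * sqrt (\<sigma> / b) * (1 / x) \<le> 2 * \<alpha> * sqrt (\<sigma> / b) * (1 / \<sigma>)"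
      using \<alpha> s b by (intro mult_left_mono) auto
    also have "\<dots> = 2 * (\<alpha> * (sqrt (\<sigma> / b) / \<sigma>))" by simp
    also have "\<dots> = 2 * \<alpha> / sqrt (\<sigma> * b)" unfolding k by simp
    finally show ?thesis using K1 that unfolding g_def by linarith
  qed
  have dom: "0 < \<alpha> \<longrightarrow> 0 < x" if "\<sigma> \<le> x" for x using that \<sigma> by auto
  have "equilibrium_measure {\<sigma>..} (Q_alpha \<alpha>)
    = dens_measure {\<sigma>..b} (\<lambda>x. arc_poly \<alpha> \<sigma> b x / sqrt ((b - x) * (x - \<sigma>)))"
  proof (rule equilibrium_measure_interval[OF \<alpha> b \<sigma>])
    fix x
    show "0 \<le> arc_poly \<alpha> \<sigma> b x" if "\<sigma> \<le> x" "x \<le> b"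
      using that P[OF dom] g[of x] by simp
    show "arc_poly \<alpha> \<sigma> b x \<le> 0" if "b < x"
      using that b P[OF dom] g[of x] by (simp add: divide_nonpos_pos mult_nonpos_nonneg)
  qed auto
  also have "\<dots> = dens_measure {\<sigma><..b} (f_hard \<alpha> \<sigma> b)"
  proof (rule dens_measure_cong)
    fix x assume "x \<in> {\<sigma>..b} \<or> x \<in> {\<sigma><..b}"
    \<comment> \<open>At the two end points both sides are 0: on the left through division by sqrt
      0, on the right by the indicator at \<sigma> and by the numerator at b.\<close>
    then consider "x = \<sigma>" | "x = b" | "\<sigma> < x" "x < b" by fastforce
    then show "indicator {\<sigma>..b} x * (arc_poly \<alpha> \<sigma> b x / sqrt ((b - x) * (x - \<sigma>)))
      = indicator {\<sigma><..b} x * f_hard \<alpha> \<sigma> b x"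
    proof cases
      case 3
      have "arc_poly \<alpha> \<sigma> b x / sqrt ((b - x) * (x - \<sigma>)) = (b - x) / sqrt ((b - x) * (x - \<sigma>)) * g x / (2 * pi)"
        using P[OF dom] 3 by simp
      also have "\<dots> = f_hard \<alpha> \<sigma> b x"
        using 3 divide_sqrt_mult[of "b - x" "x - \<sigma>"] by (simp add: f_hard_def g_def)
      finally show ?thesis using 3 by simp
    qed (auto simp: f_hard_def)
  qed
  finally show ?thesis .
qed

section \<open>Solving for the end points\<close>

lemma critical_endpoints:
  fixes \<alpha> :: real
  assumes \<alpha>: "0 < \<alpha>"
  obtains a b where "0 < a" "a < sqrt \<alpha>" "sqrt \<alpha> < b"
    "sqrt (a * b) * (a + b) = 2 * \<alpha>" "3 * a\<^sup>2 + 3 * b\<^sup>2 + 2 * a * b = 8 * (1 + \<alpha>)"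
proof -
  \<comment> \<open>With s = (a + b)^2 and P = a b, the equations become P s = 4 \<alpha>^2 and 3 s
    - 4 P = 8 (1 + \<alpha>). Eliminating P leaves a quadratic in s, whose positive root is
    taken.\<close>
  define D where "D = sqrt ((1 + \<alpha>)\<^sup>2 + 3 * \<alpha>\<^sup>2)"
  define s where "s = 4 * (1 + \<alpha> + D) / 3"
  define P where "P = 4 * \<alpha>\<^sup>2 / s"
  have D2: "D\<^sup>2 = (1 + \<alpha>)\<^sup>2 + 3 * \<alpha>\<^sup>2" by (simp add: D_def)
  \<comment> \<open>This leads to s > 4 \<alpha>, hence to s > 4 P: the discriminant of the
    quadratic with roots a, b is positive.\<close>
  have "(2 * \<alpha>)\<^sup>2 \<le> (1 + \<alpha>)\<^sup>2 + 3 * \<alpha>\<^sup>2" using \<alpha> by (simp add: power2_eq_square algebra_simps)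
  then have "2 * \<alpha> \<le> D" unfolding D_def by (intro real_le_rsqrt) 
  then have s4: "4 * \<alpha> < s" by (simp add: s_def)
  then have s0: "0 < s" using \<alpha> by simp
  have quad: "3 * s\<^sup>2 - 16 * \<alpha>\<^sup>2 = 8 * (1 + \<alpha>) * s"
  proof -
    have "3 * s - 4 * (1 + \<alpha>) = 4 * D" unfolding s_def by argo
    then have "(3 * s - 4 * (1 + \<alpha>))\<^sup>2 = 16 * D\<^sup>2" by (simp add: power_mult_distrib)
    then show ?thesis unfolding D2 by (simp add: power2_eq_square algebra_simps)
  qed
  have P0: "0 < P" using \<alpha> s0 by (simp add: P_def)
  have Ps: "P * s = 4 * \<alpha>\<^sup>2" using s0 by (simp add: P_def)
  have "16 * \<alpha>\<^sup>2 < s\<^sup>2" using power_strict_mono[OF s4, of 2] \<alpha> by (simp add: power_mult_distrib)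
  then have sP: "4 * P < s" using s0 by (simp add: P_def power2_eq_square field_simps)
  define u w where "u = sqrt s" and "w = sqrt (s - 4 * P)"
  have u2: "u\<^sup>2 = s" "0 < u" and w2: "w\<^sup>2 = s - 4 * P" "0 < w" using s0 sP by (auto simp: u_def w_def)
  define a b where "a = (u - w) / 2" and "b = (u + w) / 2"
  have ab_sum: "a + b = u" and ab_prod: "a * b = P" and lt: "a < b"
    using u2 w2 by (auto simp: a_def b_def power2_eq_square field_simps)
  have "w\<^sup>2 < u\<^sup>2" using u2 w2 P0 by simp
  then have a0: "0 < a" using power_less_imp_less_base[of w 2 u] u2 by (simp add: a_def)
  have S1: "sqrt (a * b) * (a + b) = 2 * \<alpha>"
  proof -
    have "sqrt (a * b) * (a + b) = sqrt (P * s)" unfolding ab_sum ab_prod u_def by (simp add: real_sqrt_mult)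
    also have "\<dots> = 2 * \<alpha>" unfolding Ps using \<alpha> by (simp add: real_sqrt_mult)
    finally show ?thesis .
  qed
  have S2: "3 * a\<^sup>2 + 3 * b\<^sup>2 + 2 * a * b = 8 * (1 + \<alpha>)"
  proof -
    have "3 * a\<^sup>2 + 3 * b\<^sup>2 + 2 * a * b = 3 * (a + b)\<^sup>2 - 4 * (a * b)" by (simp add: power2_eq_square algebra_simps)
    also have "\<dots> = 3 * s - 4 * P" unfolding ab_sum ab_prod u2 ..
    finally have e: "3 * a\<^sup>2 + 3 * b\<^sup>2 + 2 * a * b = 3 * s - 4 * P" .
    have "(3 * s - 4 * P) * s = 8 * (1 + \<alpha>) * s"
      using quad Ps by (simp add: power2_eq_square algebra_simps)
    then show ?thesis unfolding e using s0 by simp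
  qed
  have b0: "0 < b" using a0 lt by simp
  have "a\<^sup>2 < \<alpha>"
  proof -
    have "a * a < a * b" using a0 lt by simp
    then have "a < sqrt (a * b)" using a0 by (intro real_less_rsqrt) (simp add: power2_eq_square)
    then have "a * (2 * a) < sqrt (a * b) * (a + b)" using a0 lt by (intro mult_strict_mono) auto
    then show ?thesis unfolding S1 by (simp add: power2_eq_square)
  qed
  then have "a < sqrt \<alpha>" by (rule real_less_rsqrt)
  have "\<alpha> < b\<^sup>2"
  proof -
    have "a * b < b * b" using b0 lt by simp
    then have "sqrt (a * b) < b" using b0 by (intro real_less_lsqrt) (auto simp: power2_eq_square)
    then have "sqrt (a * b) * (a + b) < b * (2 * b)" using a0 lt by (intro mult_strict_mono) auto
    then show ?thesis unfolding S1 by (simp add: power2_eq_square)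
  qed
  then have "sqrt \<alpha> < b" using b0 \<alpha> by (intro real_less_lsqrt) auto
  show thesis by (rule that) fact+
qed

text \<open>\<open>S2\<close> as a quadratic in b, with the square completed in 3 b + a.\<close>

lemma critical_right_endpoint:
  fixes \<alpha> :: real
  assumes "0 < a" "0 < b" "3 * a\<^sup>2 + 3 * b\<^sup>2 + 2 * a * b = 8 * (1 + \<alpha>)"
  shows "b = 2/3 * (sqrt (6 * (\<alpha> + 1) - 2 * a\<^sup>2) - a / 2)"
proof -
  have "((3 * b + a) / 2)\<^sup>2 = 6 * (\<alpha> + 1) - 2 * a\<^sup>2"
    using assms(3) by (simp add: power2_eq_square field_simps)
  then have "sqrt (6 * (\<alpha> + 1) - 2 * a\<^sup>2) = (3 * b + a) / 2"
    using assms by (intro real_sqrt_unique) auto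
  then show ?thesis by simp
qed

text \<open>The interval ]a', a[ is null for the first measure and has positive mass for the second.
  Comparing left end points is enough for uniqueness, since the right one is a function of the left
  one.\<close>

lemma dens_measure_left_endpoint:
  assumes \<alpha>: "0 < \<alpha>" and a: "0 < a'" "a' < a" "a < b'" and [measurable]: "f \<in> borel_measurable borel"
  shows "dens_measure {a..b} f \<noteq> dens_measure {a'..b'} (f_crit \<alpha> a' b')"
proof
  assume eq: "dens_measure {a..b} f = dens_measure {a'..b'} (f_crit \<alpha> a' b')"
  have [measurable]: "f_crit \<alpha> a' b' \<in> borel_measurable borel" unfolding f_crit_def[abs_def] by measurable
  have "emeasure (dens_measure {a..b} f) {a'<..<a}
     = (\<integral>\<^sup>+x. ennreal (indicator {a..b} x * f x) * indicator {a'<..<a} x \<partial>lborel)"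
    unfolding dens_measure_def by (rule emeasure_density) auto
  also have "\<dots> = (\<integral>\<^sup>+x. 0 \<partial>(lborel :: real measure))" by (rule nn_integral_cong) (auto split: split_indicator)
  finally have "emeasure (dens_measure {a'..b'} (f_crit \<alpha> a' b')) {a'<..<a} = 0" by (simp add: eq)
  then have "(\<integral>\<^sup>+x. ennreal (indicator {a'..b'} x * f_crit \<alpha> a' b' x) * indicator {a'<..<a} x \<partial>lborel) = 0"
    unfolding dens_measure_def by (subst (asm) emeasure_density) auto
  then have "AE x in lborel. ennreal (indicator {a'..b'} x * f_crit \<alpha> a' b' x) * indicator {a'<..<a} x = 0"
    by (subst (asm) nn_integral_0_iff_AE) auto
  then have "AE x in lborel. x \<notin> {a'<..<a}"
  proof eventually_elim
    case (elim x)
    show ?case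
    proof
      assume x: "x \<in> {a'<..<a}"
      have "0 < f_crit \<alpha> a' b' x"
        unfolding f_crit_def using x a \<alpha> by (intro mult_pos_pos add_pos_pos divide_pos_pos real_sqrt_gt_zero) auto
      then show False using elim x a by simp
    qed
  qed
  then have "emeasure lborel {a'<..<a} = 0"
    by (subst (asm) AE_iff_null_sets[symmetric]) auto
  then show False using a by simp
qed

text \<open>Equal to -2 pi times \<open>arc_poly \<alpha> \<sigma> b b\<close>: its zeros b are the
  right end points at which the numerator vanishes.\<close>

definition edge_eq :: "real \<Rightarrow> real \<Rightarrow> real \<Rightarrow> real" where
  "edge_eq \<alpha> \<sigma> b = 3/4 * (b - \<sigma>)\<^sup>2 + \<sigma> * (b - \<sigma>) + 2 * \<alpha> * sqrt (\<sigma> / b) - 2 * \<alpha> - 2"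

text \<open>The value at x = \<sigma> of the last factor of \<open>f_hard\<close>.\<close>

definition edge_slope :: "real \<Rightarrow> real \<Rightarrow> real \<Rightarrow> real" where
  "edge_slope \<alpha> \<sigma> b = \<sigma> + b - 2 * \<alpha> / sqrt (\<sigma> * b)"

lemma edge_slope_mono:
  assumes "0 < \<alpha>" "0 < s" "s \<le> s'" "0 < b" "b \<le> b'"
  shows "edge_slope \<alpha> s b \<le> edge_slope \<alpha> s' b'"
proof -
  have "s * b \<le> s' * b'" using assms by (intro mult_mono) auto
  then have "2 * \<alpha> / sqrt (s' * b') \<le> 2 * \<alpha> / sqrt (s * b)"
    using assms by (intro divide_left_mono) auto
  then show ?thesis using assms unfolding edge_slope_def by linarith
qed

text \<open>Only the term in \<alpha> decreases in b. The slope condition bounds 2 \<alpha> by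
  sqrt(\<sigma> b) (\<sigma> + b), so the loss from b to b' is at most (b' - b)(\<sigma> + b) / 2,
  less than the gain of the quadratic part.\<close>

lemma edge_eq_strict_mono:
  assumes \<alpha>: "0 < \<alpha>" and \<sigma>: "0 < \<sigma>" "\<sigma> \<le> b" "b < b'" and slope: "0 \<le> edge_slope \<alpha> \<sigma> b"
  shows "edge_eq \<alpha> \<sigma> b < edge_eq \<alpha> \<sigma> b'"
proof -
  define s t t' where "s = sqrt \<sigma>" and "t = sqrt b" and "t' = sqrt b'"
  have st: "0 < s" "s \<le> t" "t < t'" "\<sigma> = s\<^sup>2" "b = t\<^sup>2" "b' = t'\<^sup>2"
    using \<sigma> by (auto simp: s_def t_def t'_def)
  then have t0: "0 < t" "0 < t'" by auto
  have sq: "sqrt (\<sigma> / b) = s / t" "sqrt (\<sigma> / b') = s / t'" "sqrt (\<sigma> * b) = s * t"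
    by (simp_all add: s_def t_def t'_def real_sqrt_mult real_sqrt_divide)
  have sl: "2 * \<alpha> \<le> s * t * (\<sigma> + b)"
    using slope st t0 unfolding edge_slope_def sq by (simp add: field_simps)
  have "2 * \<alpha> * (s / t - s / t') \<le> (b' - b) * ((\<sigma> + b) / 2)"
  proof -
    have e: "s / t - s / t' = s * (t' - t) / (t * t')" using t0 by (simp add: field_simps)
    have "2 * \<alpha> * (s / t - s / t') \<le> s * t * (\<sigma> + b) * (s * (t' - t) / (t * t'))"
      unfolding e using sl st t0 by (intro mult_right_mono) auto
    also have "\<dots> = s * s * (t' - t) * (\<sigma> + b) / t'" using t0 by (simp add: field_simps)
    also have "\<dots> \<le> (t' + t) * t' / 2 * (t' - t) * (\<sigma> + b) / t'"
    proof -
      have 1: "s * s \<le> t * t" using st by (intro mult_mono) auto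
      have 2: "t * t \<le> t * t'" "t * t' \<le> t' * t'" using st t0 by auto
      have "s * s \<le> (t' + t) * t' / 2" using 1 2 by (simp add: distrib_right)
      then show ?thesis using st t0 \<sigma> by (intro divide_right_mono mult_right_mono) auto
    qed
    also have "\<dots> = (b' - b) * ((\<sigma> + b) / 2)" unfolding st(5,6) using t0 by (simp add: field_simps power2_eq_square)
    finally show ?thesis .
  qed
  moreover have "(b' - b) * ((\<sigma> + b) / 2) < (b' - b) * (3 / 4 * (b + b' - 2 * \<sigma>) + \<sigma>)"
  proof (rule mult_strict_left_mono)
    show "(\<sigma> + b) / 2 < 3 / 4 * (b + b' - 2 * \<sigma>) + \<sigma>" using \<sigma> by argo
  qed (use \<sigma> in simp)
  moreover have "edge_eq \<alpha> \<sigma> b' - edge_eq \<alpha> \<sigma> b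
     = (b' - b) * (3 / 4 * (b + b' - 2 * \<sigma>) + \<sigma>) - 2 * \<alpha> * (s / t - s / t')"
    unfolding edge_eq_def sq by (simp add: power2_eq_square field_simps)
  ultimately show ?thesis by linarith
qed

text \<open>\<^term>\<open>edge_eq \<alpha> \<sigma> b\<close> vanishes at \<open>\<sigma> = a\<close>, and its derivative in \<open>\<sigma>\<close> is minus half of
  \<^const>\<open>edge_slope\<close>, which is nonnegative from there on.\<close>

lemma edge_eq_critical_nonpos:
  assumes \<alpha>: "0 < \<alpha>" and ab: "0 < a" "a \<le> \<sigma>" "\<sigma> \<le> b"
    and S1: "sqrt (a * b) * (a + b) = 2 * \<alpha>" and S2: "3 * a\<^sup>2 + 3 * b\<^sup>2 + 2 * a * b = 8 * (1 + \<alpha>)"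
  shows "edge_eq \<alpha> \<sigma> b \<le> 0"
proof -
  define x y t where "x = sqrt a" and "y = sqrt \<sigma>" and "t = sqrt b"
  have xy: "0 < x" "x \<le> y" "0 < t" "a = x\<^sup>2" "\<sigma> = y\<^sup>2" "b = t\<^sup>2"
    using ab by (auto simp: x_def y_def t_def)
  have sq: "sqrt (\<sigma> / b) = y / t" "sqrt (a * b) = x * t"
    by (simp_all add: x_def y_def t_def real_sqrt_mult real_sqrt_divide)
  have al: "2 * \<alpha> * (y / t) = x * y * (a + b)" unfolding S1[symmetric] sq using xy(3) by simp
  have c: "3/4 * (b - a)\<^sup>2 + a * (b - a) + x * x * (a + b) - 2 * \<alpha> - 2 = 0"
    using S2 xy(4) by (simp add: power2_eq_square field_simps)
  \<comment> \<open>The subtracted quantity is \<open>edge_eq \<alpha> a b\<close>, which is 0; the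
    difference is divisible by y - x, the difference of the square roots of \<sigma> and a.\<close>
  have "edge_eq \<alpha> \<sigma> b = edge_eq \<alpha> \<sigma> b - (3/4 * (b - a)\<^sup>2 + a * (b - a) + x * x * (a + b) - 2 * \<alpha> - 2)"
    unfolding c by simp
  also have "\<dots> = (y - x) * (x * (x\<^sup>2 + b) - (y + x) * ((y\<^sup>2 + x\<^sup>2) / 4 + b / 2))"
    unfolding edge_eq_def sq al unfolding xy(4,5) by (simp add: power2_eq_square field_simps)
  also have "\<dots> \<le> 0"
  proof (rule mult_nonneg_nonpos)
    have "2 * x * ((x\<^sup>2 + x\<^sup>2) / 4 + b / 2) \<le> (y + x) * ((y\<^sup>2 + x\<^sup>2) / 4 + b / 2)"
      using xy ab by (intro mult_mono add_mono divide_right_mono power_mono) auto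
    then show "x * (x\<^sup>2 + b) - (y + x) * ((y\<^sup>2 + x\<^sup>2) / 4 + b / 2) \<le> 0"
      by (simp add: field_simps)
  qed (use xy in auto)
  finally show ?thesis .
qed

lemma edge_exists:
  assumes \<alpha>: "0 < \<alpha>" and a: "0 < a" "sqrt \<alpha> < b0" "a < \<sigma>"
    and S1: "sqrt (a * b0) * (a + b0) = 2 * \<alpha>" and S2: "3 * a\<^sup>2 + 3 * b0\<^sup>2 + 2 * a * b0 = 8 * (1 + \<alpha>)"
  obtains b where "\<sigma> < b" "0 \<le> edge_slope \<alpha> \<sigma> b" "edge_eq \<alpha> \<sigma> b = 0"
proof -
  have s0: "0 < \<sigma>" using a by simp
  have b00: "0 < b0" using a \<alpha> real_sqrt_gt_zero[OF \<alpha>] by linarith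
  \<comment> \<open>A starting point for the intermediate value theorem: the critical right end
    point as long as it lies beyond the wall, otherwise the wall itself, where \<sigma>^2 > \<alpha>
    makes the slope nonnegative.\<close>
  have "\<exists>c. \<sigma> \<le> c \<and> 0 \<le> edge_slope \<alpha> \<sigma> c \<and> edge_eq \<alpha> \<sigma> c \<le> 0"
  proof (cases "\<sigma> < b0")
    case True
    have "edge_slope \<alpha> a b0 = 0" unfolding edge_slope_def S1[symmetric] using a b00 by simp
    then have "0 \<le> edge_slope \<alpha> \<sigma> b0" using edge_slope_mono[of \<alpha> a \<sigma> b0 b0] \<alpha> a b00 by simp
    moreover have "edge_eq \<alpha> \<sigma> b0 \<le> 0" using edge_eq_critical_nonpos[OF \<alpha> a(1) _ _ S1 S2] a True by simp
    ultimately show ?thesis using True by (intro exI[of _ b0]) simp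
  next
    case False
    then have "sqrt \<alpha> < \<sigma>" using a by simp
    then have "\<alpha> < \<sigma> * \<sigma>" using \<alpha> s0 by (metis power2_eq_square real_less_lsqrt real_sqrt_less_iff real_sqrt_abs abs_of_pos)
    then have "0 \<le> edge_slope \<alpha> \<sigma> \<sigma>" unfolding edge_slope_def using s0 by (simp add: field_simps)
    moreover have "edge_eq \<alpha> \<sigma> \<sigma> \<le> 0" using s0 by (simp add: edge_eq_def)
    ultimately show ?thesis by blast
  qed
  then obtain c where c: "\<sigma> \<le> c" "0 \<le> edge_slope \<alpha> \<sigma> c" "edge_eq \<alpha> \<sigma> c \<le> 0" by blast
  \<comment> \<open>Far enough that the quadratic term alone outweighs 2 \<alpha> + 2, because 3 (1
    + \<alpha>)^2 \<ge> 2 (1 + \<alpha>).\<close>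
  define B where "B = c + 2 * (1 + \<alpha>)"
  have "0 \<le> edge_eq \<alpha> \<sigma> B"
  proof -
    have d: "2 * (1 + \<alpha>) \<le> B - \<sigma>" using c by (simp add: B_def)
    then have "(2 * (1 + \<alpha>))\<^sup>2 \<le> (B - \<sigma>)\<^sup>2" using \<alpha> by (intro power_mono) auto
    moreover have "2 * (1 + \<alpha>) \<le> 3/4 * (2 * (1 + \<alpha>))\<^sup>2" using \<alpha> by (simp add: power2_eq_square algebra_simps)
    ultimately have "2 * (1 + \<alpha>) \<le> 3/4 * (B - \<sigma>)\<^sup>2" by linarith
    moreover have "0 \<le> \<sigma> * (B - \<sigma>)" using s0 d \<alpha> by (intro mult_nonneg_nonneg) auto
    moreover have "0 \<le> 2 * \<alpha> * sqrt (\<sigma> / B)" using s0 d \<alpha> by (intro mult_nonneg_nonneg) auto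
    moreover have "0 \<le> X + Y + Z - 2 * \<alpha> - 2" if "2 * (1 + \<alpha>) \<le> X" "0 \<le> Y" "0 \<le> Z" for X Y Z
      using that by simp
    ultimately show ?thesis unfolding edge_eq_def by blast
  qed
  moreover have "continuous_on {c..B} (edge_eq \<alpha> \<sigma>)"
    unfolding edge_eq_def[abs_def] using c s0 by (intro continuous_intros) auto
  ultimately obtain b where b: "c \<le> b" "b \<le> B" "edge_eq \<alpha> \<sigma> b = 0"
    using IVT'[of "edge_eq \<alpha> \<sigma>" c 0 B] c \<alpha> by (auto simp: B_def)
  have "b \<noteq> \<sigma>"
  proof
    assume "b = \<sigma>"
    then have "edge_eq \<alpha> \<sigma> b = - 2" using s0 by (simp add: edge_eq_def)
    then show False using b by simp
  qed
  moreover have "0 \<le> edge_slope \<alpha> \<sigma> b" using edge_slope_mono[of \<alpha> \<sigma> \<sigma> c b] \<alpha> s0 c b by simp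
  ultimately show thesis using b c by (intro that[of b]) auto
qed

lemma edge_unique:
  assumes "0 < \<alpha>" "0 < \<sigma>" "\<sigma> < b" "0 \<le> edge_slope \<alpha> \<sigma> b" "edge_eq \<alpha> \<sigma> b = 0"
    "\<sigma> < b'" "0 \<le> edge_slope \<alpha> \<sigma> b'" "edge_eq \<alpha> \<sigma> b' = 0"
  shows "b' = b"
  using edge_eq_strict_mono[of \<alpha> \<sigma> b b'] edge_eq_strict_mono[of \<alpha> \<sigma> b' b] assms
  by (cases b b' rule: linorder_cases) auto

text \<open>For \<alpha> = 0 the end point equation is quadratic in b - \<sigma>, with positive root
  2/3 (sqrt(\<sigma>^2 + 6) - \<sigma>). The slope condition becomes sqrt(\<sigma>^2 + 6) \<ge> -2
  \<sigma>, that is \<sigma> \<ge> -sqrt 2.\<close>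

lemma equilibrium_measure_gauss_hard:
  fixes \<sigma> :: real
  assumes \<sigma>: "- sqrt 2 \<le> \<sigma>" and b: "b = 2/3 * (sqrt (\<sigma>\<^sup>2 + 6) + \<sigma> / 2)"
  shows "equilibrium_measure {\<sigma>..} (Q_alpha 0) = dens_measure {\<sigma><..b} (f_hard 0 \<sigma> b)"
proof -
  define S where "S = sqrt (\<sigma>\<^sup>2 + 6)"
  have S2: "S\<^sup>2 = \<sigma>\<^sup>2 + 6" and S0: "0 \<le> S" by (auto simp: S_def)
  have bS: "b = 2/3 * S + \<sigma> / 3" by (simp add: b S_def)
  have "\<bar>\<sigma>\<bar> < S" unfolding S_def by (intro real_less_rsqrt) simp
  then have "\<sigma> < b" by (simp add: bS)
  have "- 2 * \<sigma> \<le> S"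
  proof (cases "0 \<le> \<sigma>")
    case True
    then show ?thesis using S0 by linarith
  next
    case False
    then have "(- \<sigma>)\<^sup>2 \<le> (sqrt 2)\<^sup>2" using \<sigma> by (intro power_mono) auto
    then have "(- 2 * \<sigma>)\<^sup>2 \<le> \<sigma>\<^sup>2 + 6" by (simp add: power2_eq_square)
    then show ?thesis unfolding S_def by (rule real_le_rsqrt)
  qed
  then have "0 \<le> \<sigma> + b" by (simp add: bS)
  moreover have "3/4 * (b - \<sigma>)\<^sup>2 + \<sigma> * (b - \<sigma>) - 2 = 0"
    using S2 unfolding bS by (simp add: power2_eq_square field_simps)
  ultimately show ?thesis using \<open>\<sigma> < b\<close> by (intro equilibrium_measure_hard) auto
qed

text \<open>On the symmetric interval the numerator is (2 - x^2) / pi, which vanishes at both ends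
  and is negative outside, so a wall further to the left is not felt.\<close>

lemma equilibrium_measure_semicircle:
  fixes \<sigma> :: real
  assumes \<sigma>: "\<sigma> \<le> - sqrt 2"
  shows "equilibrium_measure {\<sigma>..} (Q_alpha 0) = dens_measure {- sqrt 2..sqrt 2} (\<lambda>x. 1 / pi * sqrt (2 - x\<^sup>2))"
proof -
  have P: "arc_poly 0 (- sqrt 2) (sqrt 2) x = (2 - x\<^sup>2) / pi" for x
    by (simp add: arc_poly_def power2_eq_square algebra_simps)
  have w: "(sqrt 2 - x) * (x - - sqrt 2) = 2 - x\<^sup>2" for x by (simp add: power2_eq_square algebra_simps)
  have "equilibrium_measure {\<sigma>..} (Q_alpha 0)
    = dens_measure {- sqrt 2..sqrt 2} (\<lambda>x. arc_poly 0 (- sqrt 2) (sqrt 2) x / sqrt ((sqrt 2 - x) * (x - - sqrt 2)))"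
  proof (rule equilibrium_measure_interval)
    fix x :: real
    show "0 \<le> arc_poly 0 (- sqrt 2) (sqrt 2) x" if "- sqrt 2 \<le> x" "x \<le> sqrt 2"
    proof -
      have "0 \<le> (sqrt 2 - x) * (x - - sqrt 2)" using that by (intro mult_nonneg_nonneg) auto
      then show ?thesis unfolding P w by simp
    qed
    show "arc_poly 0 (- sqrt 2) (sqrt 2) x \<le> 0" if "sqrt 2 < x"
    proof -
      have "(sqrt 2 - x) * (x - - sqrt 2) \<le> 0"
        using that less_trans[OF _ that, of 0] by (intro mult_nonpos_nonneg) auto
      then show ?thesis unfolding P w by (simp add: divide_nonpos_pos)
    qed
    show "arc_poly 0 (- sqrt 2) (sqrt 2) x \<le> 0" if "x < - sqrt 2"
    proof -
      have "x < 0" using that less_trans[OF that, of 0] by simp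
      then have "(sqrt 2 - x) * (x - - sqrt 2) \<le> 0" using that by (intro mult_nonneg_nonpos) (auto intro: order_trans[of x 0])
      then show ?thesis unfolding P w by (simp add: divide_nonpos_pos)
    qed
  qed (use \<sigma> in auto)
  also have "\<dots> = dens_measure {- sqrt 2..sqrt 2} (\<lambda>x. 1 / pi * sqrt (2 - x\<^sup>2))"
  proof (rule dens_measure_cong)
    fix x :: real assume "x \<in> {- sqrt 2..sqrt 2} \<or> x \<in> {- sqrt 2..sqrt 2}"
    then have "0 \<le> (sqrt 2 - x) * (x - - sqrt 2)" by (intro mult_nonneg_nonneg) auto
    then have "0 \<le> 2 - x\<^sup>2" by (simp only: w)
    then have "(2 - x\<^sup>2) / sqrt (2 - x\<^sup>2) = sqrt (2 - x\<^sup>2)" by (rule real_div_sqrt)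
    moreover have "(2 - x\<^sup>2) / pi / sqrt (2 - x\<^sup>2) = 1 / pi * ((2 - x\<^sup>2) / sqrt (2 - x\<^sup>2))" by simp
    ultimately show "indicator {- sqrt 2..sqrt 2} x * (arc_poly 0 (- sqrt 2) (sqrt 2) x / sqrt ((sqrt 2 - x) * (x - - sqrt 2)))
      = indicator {- sqrt 2..sqrt 2} x * (1 / pi * sqrt (2 - x\<^sup>2))"
      unfolding P w by simp
  qed
  finally show ?thesis .
qed

theorem theorem2p4:
  shows
   "(\<forall>\<alpha>::real. \<alpha> > 0 \<longrightarrow>
      (\<exists>ac bc.
         0 < ac \<and> ac < sqrt \<alpha> \<and> sqrt \<alpha> < bc \<and>
         bc = 2/3 * (sqrt (6 * (\<alpha> + 1) - 2 * ac\<^sup>2) - ac / 2) \<and>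
         equilibrium_measure {0..} (Q_alpha \<alpha>) = dens_measure {ac..bc} (f_crit \<alpha> ac bc) \<and>
         (\<forall>a' b'. 0 < a' \<and> a' < sqrt \<alpha> \<and> sqrt \<alpha> < b' \<and>
            b' = 2/3 * (sqrt (6 * (\<alpha> + 1) - 2 * a'\<^sup>2) - a' / 2) \<and>
            equilibrium_measure {0..} (Q_alpha \<alpha>) = dens_measure {a'..b'} (f_crit \<alpha> a' b')
            \<longrightarrow> a' = ac \<and> b' = bc) \<and>
         (\<forall>\<sigma>. 0 < \<sigma> \<and> \<sigma> \<le> ac \<longrightarrow>
            equilibrium_measure {\<sigma>..} (Q_alpha \<alpha>) = equilibrium_measure {0..} (Q_alpha \<alpha>)) \<and>
         (\<forall>\<sigma>. \<sigma> > ac \<longrightarrow>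
            (\<exists>b. (b > \<sigma> \<and> \<sigma> + b - 2 * \<alpha> / sqrt (\<sigma> * b) \<ge> 0 \<and>
                   3/4 * (b - \<sigma>)\<^sup>2 + \<sigma> * (b - \<sigma>) + 2 * \<alpha> * sqrt (\<sigma> / b) - 2 * \<alpha> - 2 = 0) \<and>
                 (\<forall>b'. b' > \<sigma> \<and> \<sigma> + b' - 2 * \<alpha> / sqrt (\<sigma> * b') \<ge> 0 \<and>
                   3/4 * (b' - \<sigma>)\<^sup>2 + \<sigma> * (b' - \<sigma>) + 2 * \<alpha> * sqrt (\<sigma> / b') - 2 * \<alpha> - 2 = 0
                   \<longrightarrow> b' = b) \<and>
                 equilibrium_measure {\<sigma>..} (Q_alpha \<alpha>) = dens_measure {\<sigma><..b} (f_hard \<alpha> \<sigma> b)))))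
    \<and>
    (\<forall>\<sigma>::real. \<sigma> \<ge> - sqrt 2 \<longrightarrow>
       (let b = 2/3 * (sqrt (\<sigma>\<^sup>2 + 6) + \<sigma> / 2) in
        equilibrium_measure {\<sigma>..} (Q_alpha 0) = dens_measure {\<sigma><..b} (f_hard 0 \<sigma> b)))
    \<and>
    (\<forall>\<sigma>::real. \<sigma> \<le> - sqrt 2 \<longrightarrow>
       equilibrium_measure {\<sigma>..} (Q_alpha 0)
         = dens_measure {- sqrt 2..sqrt 2} (\<lambda>x. 1 / pi * sqrt (2 - x\<^sup>2)))"
proof (intro conjI allI impI)
  fix \<alpha> :: real assume \<alpha>: "\<alpha> > 0"
  obtain a b where ab: "0 < a" "a < sqrt \<alpha>" "sqrt \<alpha> < b"
    and S1: "sqrt (a * b) * (a + b) = 2 * \<alpha>" and S2: "3 * a\<^sup>2 + 3 * b\<^sup>2 + 2 * a * b = 8 * (1 + \<alpha>)"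
    using critical_endpoints[OF \<alpha>] by metis
  have b0: "a < b" "0 < b" using ab by auto
  have soft: "equilibrium_measure {\<sigma>..} (Q_alpha \<alpha>) = dens_measure {a..b} (f_crit \<alpha> a b)" if "\<sigma> \<le> a" for \<sigma>
    using equilibrium_measure_soft[OF \<alpha> ab(1) b0(1) that S1 S2] .
  show "\<exists>ac bc.
         0 < ac \<and> ac < sqrt \<alpha> \<and> sqrt \<alpha> < bc \<and>
         bc = 2/3 * (sqrt (6 * (\<alpha> + 1) - 2 * ac\<^sup>2) - ac / 2) \<and>
         equilibrium_measure {0..} (Q_alpha \<alpha>) = dens_measure {ac..bc} (f_crit \<alpha> ac bc) \<and>
         (\<forall>a' b'. 0 < a' \<and> a' < sqrt \<alpha> \<and> sqrt \<alpha> < b' \<and>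
            b' = 2/3 * (sqrt (6 * (\<alpha> + 1) - 2 * a'\<^sup>2) - a' / 2) \<and>
            equilibrium_measure {0..} (Q_alpha \<alpha>) = dens_measure {a'..b'} (f_crit \<alpha> a' b')
            \<longrightarrow> a' = ac \<and> b' = bc) \<and>
         (\<forall>\<sigma>. 0 < \<sigma> \<and> \<sigma> \<le> ac \<longrightarrow>
            equilibrium_measure {\<sigma>..} (Q_alpha \<alpha>) = equilibrium_measure {0..} (Q_alpha \<alpha>)) \<and>
         (\<forall>\<sigma>. \<sigma> > ac \<longrightarrow>
            (\<exists>b. (b > \<sigma> \<and> \<sigma> + b - 2 * \<alpha> / sqrt (\<sigma> * b) \<ge> 0 \<and>
                   3/4 * (b - \<sigma>)\<^sup>2 + \<sigma> * (b - \<sigma>) + 2 * \<alpha> * sqrt (\<sigma> / b) - 2 * \<alpha> - 2 = 0) \<and>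
                 (\<forall>b'. b' > \<sigma> \<and> \<sigma> + b' - 2 * \<alpha> / sqrt (\<sigma> * b') \<ge> 0 \<and>
                   3/4 * (b' - \<sigma>)\<^sup>2 + \<sigma> * (b' - \<sigma>) + 2 * \<alpha> * sqrt (\<sigma> / b') - 2 * \<alpha> - 2 = 0
                   \<longrightarrow> b' = b) \<and>
                 equilibrium_measure {\<sigma>..} (Q_alpha \<alpha>) = dens_measure {\<sigma><..b} (f_hard \<alpha> \<sigma> b)))"
  proof (rule exI[of _ a], rule exI[of _ b], intro conjI)
    show bf: "b = 2/3 * (sqrt (6 * (\<alpha> + 1) - 2 * a\<^sup>2) - a / 2)"
      by (rule critical_right_endpoint[OF ab(1) b0(2) S2])
    show "\<forall>a' b'. 0 < a' \<and> a' < sqrt \<alpha> \<and> sqrt \<alpha> < b' \<and>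
            b' = 2/3 * (sqrt (6 * (\<alpha> + 1) - 2 * a'\<^sup>2) - a' / 2) \<and>
            equilibrium_measure {0..} (Q_alpha \<alpha>) = dens_measure {a'..b'} (f_crit \<alpha> a' b')
            \<longrightarrow> a' = a \<and> b' = b"
    proof (intro allI impI, elim conjE)
      fix a' b' assume h: "0 < a'" "a' < sqrt \<alpha>" "sqrt \<alpha> < b'"
        "b' = 2/3 * (sqrt (6 * (\<alpha> + 1) - 2 * a'\<^sup>2) - a' / 2)"
        "equilibrium_measure {0..} (Q_alpha \<alpha>) = dens_measure {a'..b'} (f_crit \<alpha> a' b')"
      have eq: "dens_measure {a..b} (f_crit \<alpha> a b) = dens_measure {a'..b'} (f_crit \<alpha> a' b')"
        using h(5) soft[of 0] ab by simp
      have m: "f_crit \<alpha> c d \<in> borel_measurable borel" for c d unfolding f_crit_def[abs_def] by measurable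
      \<comment> \<open>Both intervals contain sqrt \<alpha> in their interior, so each left end
        point lies below the other right end point, as the lemma requires.\<close>
      have "\<not> a' < a" using dens_measure_left_endpoint[OF \<alpha> h(1) _ _ m, of a b' b a b] eq ab h by auto
      moreover have "\<not> a < a'" using dens_measure_left_endpoint[OF \<alpha> ab(1) _ _ m, of a' b b' a' b'] eq ab h by auto
      ultimately have "a' = a" by simp
      then show "a' = a \<and> b' = b" using h(4) bf by simp
    qed
    show "\<forall>\<sigma>. \<sigma> > a \<longrightarrow>
            (\<exists>b. (b > \<sigma> \<and> \<sigma> + b - 2 * \<alpha> / sqrt (\<sigma> * b) \<ge> 0 \<and>
                   3/4 * (b - \<sigma>)\<^sup>2 + \<sigma> * (b - \<sigma>) + 2 * \<alpha> * sqrt (\<sigma> / b) - 2 * \<alpha> - 2 = 0) \<and>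
                 (\<forall>b'. b' > \<sigma> \<and> \<sigma> + b' - 2 * \<alpha> / sqrt (\<sigma> * b') \<ge> 0 \<and>
                   3/4 * (b' - \<sigma>)\<^sup>2 + \<sigma> * (b' - \<sigma>) + 2 * \<alpha> * sqrt (\<sigma> / b') - 2 * \<alpha> - 2 = 0
                   \<longrightarrow> b' = b) \<and>
                 equilibrium_measure {\<sigma>..} (Q_alpha \<alpha>) = dens_measure {\<sigma><..b} (f_hard \<alpha> \<sigma> b))"
    proof (intro allI impI)
      fix \<sigma> assume \<sigma>: "\<sigma> > a"
      obtain b1 where b1: "\<sigma> < b1" "0 \<le> edge_slope \<alpha> \<sigma> b1" "edge_eq \<alpha> \<sigma> b1 = 0"
        by (rule edge_exists[OF \<alpha> ab(1,3) \<sigma> S1 S2])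
      have s0: "0 < \<sigma>" using \<sigma> ab by simp
      show "\<exists>b. (b > \<sigma> \<and> \<sigma> + b - 2 * \<alpha> / sqrt (\<sigma> * b) \<ge> 0 \<and>
                   3/4 * (b - \<sigma>)\<^sup>2 + \<sigma> * (b - \<sigma>) + 2 * \<alpha> * sqrt (\<sigma> / b) - 2 * \<alpha> - 2 = 0) \<and>
                 (\<forall>b'. b' > \<sigma> \<and> \<sigma> + b' - 2 * \<alpha> / sqrt (\<sigma> * b') \<ge> 0 \<and>
                   3/4 * (b' - \<sigma>)\<^sup>2 + \<sigma> * (b' - \<sigma>) + 2 * \<alpha> * sqrt (\<sigma> / b') - 2 * \<alpha> - 2 = 0
                   \<longrightarrow> b' = b) \<and>
                 equilibrium_measure {\<sigma>..} (Q_alpha \<alpha>) = dens_measure {\<sigma><..b} (f_hard \<alpha> \<sigma> b)"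
        unfolding edge_slope_def[symmetric] edge_eq_def[symmetric]
      proof (rule exI[of _ b1], intro conjI)
        show "\<forall>b'. b' > \<sigma> \<and> edge_slope \<alpha> \<sigma> b' \<ge> 0 \<and> edge_eq \<alpha> \<sigma> b' = 0 \<longrightarrow> b' = b1"
          using edge_unique[OF \<alpha> s0 b1] by blast
        show "equilibrium_measure {\<sigma>..} (Q_alpha \<alpha>) = dens_measure {\<sigma><..b1} (f_hard \<alpha> \<sigma> b1)"
          using equilibrium_measure_hard[of \<alpha> \<sigma> b1] \<alpha> s0 b1 by (simp add: edge_slope_def edge_eq_def)
      qed (use b1 in auto)
    qed
  qed (use ab soft in auto)
next
  fix \<sigma> :: real assume "\<sigma> \<ge> - sqrt 2"
  then show "let b = 2/3 * (sqrt (\<sigma>\<^sup>2 + 6) + \<sigma> / 2) in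
        equilibrium_measure {\<sigma>..} (Q_alpha 0) = dens_measure {\<sigma><..b} (f_hard 0 \<sigma> b)"
    unfolding Let_def by (intro equilibrium_measure_gauss_hard) auto
next
  fix \<sigma> :: real assume "\<sigma> \<le> - sqrt 2"
  then show "equilibrium_measure {\<sigma>..} (Q_alpha 0)
         = dens_measure {- sqrt 2..sqrt 2} (\<lambda>x. 1 / pi * sqrt (2 - x\<^sup>2))"
    by (rule equilibrium_measure_semicircle)
qed

end
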